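(* Let $x,\gamma\in\Bbbk$ with $x\neq0$. Then $N_x^\gamma\cong M_{x;\gamma-1}$ as $W$-modules. Moreover, $N_x^\gamma$ is a simple $W$-module if and only if $\gamma\neq1$. There is an exact sequence of $W$-modules $$0\to N_x^0\to N_x^1\to\Bbbk\to0.$$ For all $\gamma$ the annihilator of $N_x^\gamma$ in $\mathrm{U}(W)$ is equal to $\ker\pi_\gamma$, which is a primitive ideal of $\mathrm{U}(W)$.
   Context: $\Bbbk$ is an uncountable algebraically closed field of characteristic $0$. $W=\Bbbk[t,t^{-1}]\partial$ is the Witt algebra, with $[f\partial,g\partial]=(fg'-f'g)\partial$, and $\mathrm{U}(W)$ is its universal enveloping algebra. $A=\Bbbk[t,t^{-1},\partial]$ with $\partial t=t\partial+1$ is the localised Weyl algebra. For $\gamma\in\Bbbk$, the map $\pi_\gamma:W\to A$, $f\partial\mapsto f\partial+\gamma f'$ is a Lie algebra homomorphism and extends to a ring homomorphism $\pi_\gamma:\mathrm{U}(W)\to A$. For $x\in\Bbbk^\times$, $N_x=\Bbbk[t,t^{-1},(t-x)^{-1}]/\Bbbk[t,t^{-1}]$, a left $A$-module (with $\partial$ acting as $d/dt$); $N_x^\gamma$ denotes $N_x$ regarded as a $W$-module via $\pi_\gamma$. $W(t-x)=(t-x)\Bbbk[t,t^{-1}]\partial$; for $\gamma\in\Bbbk$, $\Bbbk m_{x;\gamma}$ is the one-dimensional $W(t-x)$-module with $p\partial\cdot m_{x;\gamma}=\gamma p'(x)m_{x;\gamma}$, and $M_{x;\gamma}=\mathrm{U}(W)\otimes_{\mathrm{U}(W(t-x))}\Bbbk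 m_{x;\gamma}$. $\Bbbk$ in the exact sequence is the trivial module. A (left) primitive ideal is the annihilator of a simple left module. *)

theory Defs
  imports
    "HOL-Algebra.Algebraic_Closure_Type"
    "HOL-Algebra.Free_Abelian_Groups"
    "HOL-Algebra.QuotRing"
    "HOL-Algebra.Module"
    "HOL-Computational_Algebra.Formal_Laurent_Series"
    "HOL-Library.Countable_Set"
begin

section \<open>Left modules over noncommutative rings\<close>

text \<open>
  The locale \<^locale>\<open>module\<close> of the library insists on a commutative ring of scalars. Its record
  type is reused; the fields \<^const>\<open>monoid.mult\<close> and \<^const>\<open>one\<close> of a module record carry no meaning.
  The library's \<^locale>\<open>submodule\<close> (an additive subgroup closed under scalars) makes no
  commutativity assumption and is used as it stands.
\<close>

locale left_module = R?: ring R + M?: abelian_group M 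
  for R :: "('r, 'p) ring_scheme" (structure) and M :: "('r, 'm, 'q) module_scheme" (structure) +
  assumes smult_closed:
      "\<lbrakk>a \<in> carrier R; m \<in> carrier M\<rbrakk> \<Longrightarrow> a \<odot>\<^bsub>M\<^esub> m \<in> carrier M"
    and smult_l_distr:
      "\<lbrakk>a \<in> carrier R; b \<in> carrier R; m \<in> carrier M\<rbrakk> \<Longrightarrow>
       (a \<oplus> b) \<odot>\<^bsub>M\<^esub> m = a \<odot>\<^bsub>M\<^esub> m \<oplus>\<^bsub>M\<^esub> b \<odot>\<^bsub>M\<^esub> m"
    and smult_r_distr:
      "\<lbrakk>a \<in> carrier R; m \<in> carrier M; n \<in> carrier M\<rbrakk> \<Longrightarrow>
       a \<odot>\<^bsub>M\<^esub> (m \<oplus>\<^bsub>M\<^esub> n) = a \<odot>\<^bsub>M\<^esub> m \<oplus>\<^bsub>M\<^esub> a \<odot>\<^bsub>M\<^esub> n"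
    and smult_assoc1:
      "\<lbrakk>a \<in> carrier R; b \<in> carrier R; m \<in> carrier M\<rbrakk> \<Longrightarrow>
       (a \<otimes> b) \<odot>\<^bsub>M\<^esub> m = a \<odot>\<^bsub>M\<^esub> (b \<odot>\<^bsub>M\<^esub> m)"
    and smult_one:
      "m \<in> carrier M \<Longrightarrow> \<one> \<odot>\<^bsub>M\<^esub> m = m"

definition left_module_hom ::
  "('r, 'p) ring_scheme \<Rightarrow> ('r, 'm) module \<Rightarrow> ('r, 'n) module \<Rightarrow> ('m \<Rightarrow> 'n) set" where
  "left_module_hom R M N =
     {f \<in> carrier M \<rightarrow> carrier N.
        (\<forall>m\<in>carrier M. \<forall>m'\<in>carrier M. f (m \<oplus>\<^bsub>M\<^esub> m') = f m \<oplus>\<^bsub>N\<^esub> f m') \<and>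
        (\<forall>a\<in>carrier R. \<forall>m\<in>carrier M. f (a \<odot>\<^bsub>M\<^esub> m) = a \<odot>\<^bsub>N\<^esub> f m)}"

definition left_modules_isomorphic ::
  "('r, 'p) ring_scheme \<Rightarrow> ('r, 'm) module \<Rightarrow> ('r, 'n) module \<Rightarrow> bool" where
  "left_modules_isomorphic R M N \<longleftrightarrow>
     left_module R M \<and> left_module R N \<and>
     (\<exists>f\<in>left_module_hom R M N. bij_betw f (carrier M) (carrier N))"

text \<open>There is an exact sequence \<open>0 \<rightarrow> M \<rightarrow> N \<rightarrow> P \<rightarrow> 0\<close>.\<close>

definition exists_short_exact_sequence ::
  "('r, 'p) ring_scheme \<Rightarrow> ('r, 'm) module \<Rightarrow> ('r, 'n) module \<Rightarrow> ('r, 'l) module \<Rightarrow> bool" where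
  "exists_short_exact_sequence R M N P \<longleftrightarrow>
     left_module R M \<and> left_module R N \<and> left_module R P \<and>
     (\<exists>f\<in>left_module_hom R M N. \<exists>g\<in>left_module_hom R N P.
        inj_on f (carrier M) \<and> f ` carrier M = a_kernel N P g \<and> g ` carrier N = carrier P)"

definition simple_left_module :: "('r, 'p) ring_scheme \<Rightarrow> ('r, 'm) module \<Rightarrow> bool" where
  "simple_left_module R M \<longleftrightarrow>
     left_module R M \<and> carrier M \<noteq> {\<zero>\<^bsub>M\<^esub>} \<and>
     (\<forall>H. submodule H R M \<longrightarrow> H = {\<zero>\<^bsub>M\<^esub>} \<or> H = carrier M)"

definition module_annihilator :: "('r, 'p) ring_scheme \<Rightarrow> ('r, 'm) module \<Rightarrow> 'r set" where
  "module_annihilator R M = {a \<in> carrier R. \<forall>m\<in>carrier M. a \<odot>\<^bsub>M\<^esub> m = \<zero>\<^bsub>M\<^esub>}"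

text \<open>
  A simple module over \<open>R\<close> is isomorphic to \<open>R / L\<close> for a maximal left ideal \<open>L\<close>, whose elements are
  sets of elements of \<open>R\<close>. So letting \<open>M\<close> range over modules with elements in \<^typ>\<open>'r set\<close>
  covers all simple modules.
\<close>

definition left_primitive_ideal :: "('r, 'p) ring_scheme \<Rightarrow> 'r set \<Rightarrow> bool" where
  "left_primitive_ideal R I \<longleftrightarrow>
     (\<exists>M :: ('r, 'r set) module. simple_left_module R M \<and> I = module_annihilator R M)"

definition restrict_scalars :: "('s \<Rightarrow> 'r) \<Rightarrow> ('r, 'm) module \<Rightarrow> ('s, 'm) module" where
  "restrict_scalars h M =
     \<lparr>carrier = carrier M, monoid.mult = monoid.mult M, one = \<one>\<^bsub>M\<^esub>,
      ring.zero = \<zero>\<^bsub>M\<^esub>, ring.add = ring.add M, module.smult = (\<lambda>s m. h s \<odot>\<^bsub>M\<^esub> m)\<rparr>"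

definition regular_left_module :: "'r ring \<Rightarrow> ('r, 'r) module" where
  "regular_left_module R =
     \<lparr>carrier = carrier R, monoid.mult = monoid.mult R, one = \<one>\<^bsub>R\<^esub>,
      ring.zero = \<zero>\<^bsub>R\<^esub>, ring.add = ring.add R, module.smult = monoid.mult R\<rparr>"

text \<open>
  Maps out of quotients are given on representatives: for a coset \<open>C\<close> on which \<open>h\<close> is constant,
  \<open>the_elem (h ` C)\<close> is that constant value.
\<close>

definition quotient_module :: "('r, 'm) module \<Rightarrow> 'm set \<Rightarrow> ('r, 'm set) module" where
  "quotient_module M H =
     \<lparr>carrier = a_rcosets\<^bsub>M\<^esub> H, monoid.mult = (\<lambda>_ _. H), one = H, ring.zero = H, ring.add = set_add M,
      module.smult = (\<lambda>a C. the_elem ((\<lambda>m. H +>\<^bsub>M\<^esub> (a \<odot>\<^bsub>M\<^esub> m)) ` C))\<rparr>"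

text \<open>
  The induced module \<open>R \<otimes>\<^bsub>S\<^esub> N\<close> of a left \<open>S\<close>-module \<open>N\<close> along a ring homomorphism \<open>h\<close> from \<open>S\<close> to
  \<open>R\<close>: the free abelian group on \<open>R \<times> N\<close> (whose group operation is written multiplicatively in the
  library) modulo the usual biadditivity and balancing relations; \<open>R\<close> acts on the left factor.
\<close>

definition tensor_relations ::
  "'r ring \<Rightarrow> 's ring \<Rightarrow> ('s \<Rightarrow> 'r) \<Rightarrow> ('s, 'm) module \<Rightarrow> ('r \<times> 'm \<Rightarrow>\<^sub>0 int) set" where
  "tensor_relations R S h N =
     {frag_of (a \<oplus>\<^bsub>R\<^esub> b, n) - frag_of (a, n) - frag_of (b, n) | a b n.
        a \<in> carrier R \<and> b \<in> carrier R \<and> n \<in> carrier N} \<union>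
     {frag_of (a, n \<oplus>\<^bsub>N\<^esub> n') - frag_of (a, n) - frag_of (a, n') | a n n'.
        a \<in> carrier R \<and> n \<in> carrier N \<and> n' \<in> carrier N} \<union>
     {frag_of (a \<otimes>\<^bsub>R\<^esub> h s, n) - frag_of (a, s \<odot>\<^bsub>N\<^esub> n) | a s n.
        a \<in> carrier R \<and> s \<in> carrier S \<and> n \<in> carrier N}"

definition induced_module ::
  "'r ring \<Rightarrow> 's ring \<Rightarrow> ('s \<Rightarrow> 'r) \<Rightarrow> ('s, 'm) module \<Rightarrow> ('r, ('r \<times> 'm \<Rightarrow>\<^sub>0 int) set) module" where
  "induced_module R S h N =
     (let F = free_Abelian_group (carrier R \<times> carrier N);
          H = generate F (tensor_relations R S h N);
          act = (\<lambda>a. frag_extend (\<lambda>(b, n). frag_of (a \<otimes>\<^bsub>R\<^esub> b, n)))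
      in \<lparr>carrier = carrier (F Mod H), monoid.mult = (\<lambda>_ _. H), one = H,
          ring.zero = \<one>\<^bsub>F Mod H\<^esub>, ring.add = monoid.mult (F Mod H),
          module.smult = (\<lambda>a C. the_elem ((\<lambda>p. H #>\<^bsub>F\<^esub> act a p) ` C))\<rparr>)"


section \<open>Algebras given by generators and relations\<close>

text \<open>
  The free associative algebra \<open>k\<langle>B\<rangle>\<close> is the monoid algebra of the free monoid of words in \<open>B\<close>.
  To use the convolution product on finitely supported functions, words are made a monoid
  (written additively) under concatenation.
\<close>

instantiation list :: (type) monoid_add
begin
definition zero_list :: "'a list" where "zero_list = []"
definition plus_list :: "'a list \<Rightarrow> 'a list \<Rightarrow> 'a list" where "plus_list = (@)"
instance by standard (simp_all add: zero_list_def plus_list_def)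
end

definition free_algebra :: "'x set \<Rightarrow> ('x list \<Rightarrow>\<^sub>0 'k::field) ring" where
  "free_algebra B =
     \<lparr>carrier = {p. Poly_Mapping.keys p \<subseteq> lists B}, monoid.mult = (*), one = 1,
      ring.zero = 0, ring.add = (+)\<rparr>"

abbreviation fgen :: "'x \<Rightarrow> ('x list \<Rightarrow>\<^sub>0 'k::field)" where
  "fgen g \<equiv> Poly_Mapping.single [g] 1"

abbreviation fconst :: "'k \<Rightarrow> ('x list \<Rightarrow>\<^sub>0 'k::field)" where
  "fconst c \<equiv> Poly_Mapping.single [] c"

definition presented_algebra ::
  "'x set \<Rightarrow> ('x list \<Rightarrow>\<^sub>0 'k::field) set \<Rightarrow> ('x list \<Rightarrow>\<^sub>0 'k) set ring" where
  "presented_algebra B rels = free_algebra B Quot Idl\<^bsub>free_algebra B\<^esub> rels"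

definition presented_class ::
  "'x set \<Rightarrow> ('x list \<Rightarrow>\<^sub>0 'k::field) set \<Rightarrow> ('x list \<Rightarrow>\<^sub>0 'k) \<Rightarrow> ('x list \<Rightarrow>\<^sub>0 'k) set" where
  "presented_class B rels p = Idl\<^bsub>free_algebra B\<^esub> rels +>\<^bsub>free_algebra B\<^esub> p"

text \<open>
  The homomorphism from the free algebra (respectively from a presented algebra) to a \<open>k\<close>-algebra \<open>S\<close>
  with structure map \<open>\<eta> : k \<rightarrow> S\<close> that sends each generator \<open>g\<close> to \<open>\<phi> g\<close>.
\<close>

definition free_lift ::
  "('s, 'q) ring_scheme \<Rightarrow> ('k \<Rightarrow> 's) \<Rightarrow> ('x \<Rightarrow> 's) \<Rightarrow> ('x list \<Rightarrow>\<^sub>0 'k::field) \<Rightarrow> 's" where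
  "free_lift S \<eta> \<phi> p =
     (\<Oplus>\<^bsub>S\<^esub>w\<in>Poly_Mapping.keys p.
        \<eta> (Poly_Mapping.lookup p w) \<otimes>\<^bsub>S\<^esub> foldr (\<lambda>g s. \<phi> g \<otimes>\<^bsub>S\<^esub> s) w \<one>\<^bsub>S\<^esub>)"

definition presented_lift ::
  "('s, 'q) ring_scheme \<Rightarrow> ('k \<Rightarrow> 's) \<Rightarrow> ('x \<Rightarrow> 's) \<Rightarrow> ('x list \<Rightarrow>\<^sub>0 'k::field) set \<Rightarrow> 's" where
  "presented_lift S \<eta> \<phi> C = the_elem (free_lift S \<eta> \<phi> ` C)"


lemma keys_mult_lists:
  assumes "Poly_Mapping.keys p \<subseteq> lists B" "Poly_Mapping.keys q \<subseteq> lists B"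
  shows "Poly_Mapping.keys (p * q) \<subseteq> lists B"
proof -
  have "Poly_Mapping.keys (p * q) \<subseteq> {a + b | a b. a \<in> Poly_Mapping.keys p \<and> b \<in> Poly_Mapping.keys q}"
    by (rule keys_mult)
  then show ?thesis using assms by (force simp: plus_list_def)
qed

lemma one_eq_fconst: "(1 :: 'x list \<Rightarrow>\<^sub>0 'k::field) = fconst 1"
  by (simp only: single_one[symmetric] zero_list_def)

lemma ring_free_algebra: "ring (free_algebra B :: ('x list \<Rightarrow>\<^sub>0 'k::field) ring)"
proof (rule ringI)
  show "abelian_group (free_algebra B :: ('x list \<Rightarrow>\<^sub>0 'k) ring)"
  proof (rule abelian_groupI, goal_cases)
    case (6 p)
    then show ?case
      by (intro bexI[of _ "-p"]) (auto simp: free_algebra_def)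
  qed (use keys_add in \<open>fastforce simp: free_algebra_def algebra_simps\<close>)+
  show "Group.monoid (free_algebra B :: ('x list \<Rightarrow>\<^sub>0 'k) ring)"
    by (rule monoidI)
       (auto simp: free_algebra_def mult.assoc zero_list_def keys_mult_lists
          simp del: in_lists_conv_set)
qed (auto simp: free_algebra_def algebra_simps)

lemma free_lift_hom:
  fixes S :: "'s ring" and \<eta> :: "'k::field \<Rightarrow> 's" and B :: "'b set"
  assumes S: "ring S"
    and \<eta>: "\<eta> \<in> ring_hom ring_of_type_algebra S"
    and central: "\<And>c g. g \<in> B \<Longrightarrow> \<eta> c \<otimes>\<^bsub>S\<^esub> \<phi> g = \<phi> g \<otimes>\<^bsub>S\<^esub> \<eta> c"
    and \<phi>: "\<And>g. g \<in> B \<Longrightarrow> \<phi> g \<in> carrier S"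
  shows "free_lift S \<eta> \<phi> \<in> ring_hom (free_algebra B) S"
    and "\<And>c. free_lift S \<eta> \<phi> (fconst c) = \<eta> c"
    and "\<And>g. g \<in> B \<Longrightarrow> free_lift S \<eta> \<phi> (fgen g) = \<phi> g"
proof -
  interpret S: ring S by (rule S)
  note [simp] = ring_of_type_algebra_def
  have \<eta>c [simp]: "\<eta> c \<in> carrier S" for c
    using \<eta> by (auto simp: ring_hom_def)
  have \<eta>_add: "\<eta> (a + b) = \<eta> a \<oplus>\<^bsub>S\<^esub> \<eta> b" and \<eta>_mult: "\<eta> (a * b) = \<eta> a \<otimes>\<^bsub>S\<^esub> \<eta> b"
    and \<eta>1: "\<eta> 1 = \<one>\<^bsub>S\<^esub>" for a b
    using \<eta> by (auto simp: ring_hom_def)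
  have \<eta>0: "\<eta> 0 = \<zero>\<^bsub>S\<^esub>"
    using \<eta>_add[of 0 0] by (simp add: S.add.l_cancel_one)
  define W where "W w = foldr (\<lambda>g s. \<phi> g \<otimes>\<^bsub>S\<^esub> s) w \<one>\<^bsub>S\<^esub>" for w
  have Wc [simp]: "W w \<in> carrier S" if "w \<in> lists B" for w
    using that by (induction w) (auto simp: W_def \<phi>)
  have W_app: "W (v @ w) = W v \<otimes>\<^bsub>S\<^esub> W w" if "v \<in> lists B" "w \<in> lists B" for v w
    using that(1) 
  proof (induction v)
    case Nil then show ?case using that by (simp add: W_def)  (use Wc that in \<open>simp add: W_def\<close>)
  next
    case (Cons a v) 
    then show ?case using that \<phi>[of a] Wc[of v] Wc[of w]
      by (simp add: W_def S.m_assoc)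
  qed
  have W_comm: "\<eta> c \<otimes>\<^bsub>S\<^esub> W w = W w \<otimes>\<^bsub>S\<^esub> \<eta> c" if "w \<in> lists B" for c w
    using that
  proof (induction w)
    case Nil then show ?case by (simp add: W_def)
  next
    case (Cons a v)
    then show ?case using \<phi>[of a] Wc[of v] central[of a c]
      by (simp add: W_def S.m_assoc) (metis S.m_assoc \<eta>c)
  qed
  define F where "F = free_lift S \<eta> \<phi>"
  have F: "F p = (\<Oplus>\<^bsub>S\<^esub>w\<in>A. \<eta> (Poly_Mapping.lookup p w) \<otimes>\<^bsub>S\<^esub> W w)"
    if "finite A" "Poly_Mapping.keys p \<subseteq> A" "A \<subseteq> lists B" for p A
    unfolding F_def free_lift_def W_def[symmetric] using that
    by (intro S.add.finprod_mono_neutral_cong_left) (auto simp: in_keys_iff \<eta>0 subset_iff)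
  have Fc: "F p \<in> carrier S" if "Poly_Mapping.keys p \<subseteq> lists B" for p
    using that by (subst F[of "Poly_Mapping.keys p"]) (auto intro!: S.finsum_closed S.m_closed Wc simp del: in_lists_conv_set dest: subsetD)
  have F_add: "F (p + q) = F p \<oplus>\<^bsub>S\<^esub> F q"
    if "Poly_Mapping.keys p \<subseteq> lists B" "Poly_Mapping.keys q \<subseteq> lists B" for p q
  proof -
    let ?A = "Poly_Mapping.keys p \<union> Poly_Mapping.keys q"
    have A: "finite ?A" "?A \<subseteq> lists B" using that by auto
    have "F (p + q) = (\<Oplus>\<^bsub>S\<^esub>w\<in>?A. \<eta> (Poly_Mapping.lookup (p+q) w) \<otimes>\<^bsub>S\<^esub> W w)"
      using A by (intro F) (auto dest: subsetD[OF keys_add])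
    also have "\<dots> = (\<Oplus>\<^bsub>S\<^esub>w\<in>?A. \<eta> (Poly_Mapping.lookup p w) \<otimes>\<^bsub>S\<^esub> W w \<oplus>\<^bsub>S\<^esub> \<eta> (Poly_Mapping.lookup q w) \<otimes>\<^bsub>S\<^esub> W w)"
      using A that Wc by (intro S.finsum_cong') (auto simp: lookup_add \<eta>_add S.l_distr subset_iff)
    also have "\<dots> = F p \<oplus>\<^bsub>S\<^esub> F q"
      using A Wc by (subst S.finsum_addf) (auto simp: F[of ?A] subset_iff)
    finally show ?thesis .
  qed
  have F_single: "F (Poly_Mapping.single w c) = \<eta> c \<otimes>\<^bsub>S\<^esub> W w" if "w \<in> lists B" for w c
    using that Wc[OF that] by (subst F[of "{w}"]) auto
  have F0: "F 0 = \<zero>\<^bsub>S\<^esub>" by (subst F[of "{}"]) auto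
  have F_mult: "F (p * q) = F p \<otimes>\<^bsub>S\<^esub> F q"
    if "Poly_Mapping.keys p \<subseteq> lists B" "Poly_Mapping.keys q \<subseteq> lists B" for p q
  proof -
    have 1: "F (Poly_Mapping.single w c * q) = F (Poly_Mapping.single w c) \<otimes>\<^bsub>S\<^esub> F q"
      if "w \<in> lists B" "Poly_Mapping.keys q \<subseteq> lists B" for w c q
      using that(2)
    proof (induction q rule: update_induct)
      case const
      then show ?case using that Wc by (simp add: F0 F_single)
    next
      case (update f a b)
      have eq: "Poly_Mapping.update a b f = f + Poly_Mapping.single a b"
        using update.hyps by (intro poly_mapping_eqI)
          (auto simp: lookup_update lookup_add lookup_single in_keys_iff when_def)
      have k: "Poly_Mapping.keys f \<subseteq> lists B" "a \<in> lists B"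
        using update by (auto simp: keys_update simp del: in_lists_conv_set)
      have s: "Poly_Mapping.keys (Poly_Mapping.single v d) \<subseteq> lists B" if "v \<in> lists B" for v and d :: 'k
        using that by auto
      have wa: "w + a \<in> lists B" using that k by (simp add: plus_list_def)
      have "F (Poly_Mapping.single w c * (f + Poly_Mapping.single a b)) =
            F (Poly_Mapping.single w c * f) \<oplus>\<^bsub>S\<^esub> F (Poly_Mapping.single (w + a) (c * b))"
        using wa k that s by (simp add: distrib_left mult_single F_add keys_mult_lists del: in_lists_conv_set)
      also have "F (Poly_Mapping.single (w + a) (c * b)) =
                 (\<eta> c \<otimes>\<^bsub>S\<^esub> W w) \<otimes>\<^bsub>S\<^esub> (\<eta> b \<otimes>\<^bsub>S\<^esub> W a)"
      proof -
        have "F (Poly_Mapping.single (w + a) (c * b)) = (\<eta> c \<otimes>\<^bsub>S\<^esub> \<eta> b) \<otimes>\<^bsub>S\<^esub> (W w \<otimes>\<^bsub>S\<^esub> W a)"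
          using wa that k by (subst F_single) (simp_all add: plus_list_def W_app \<eta>_mult)
        also have "\<dots> = \<eta> c \<otimes>\<^bsub>S\<^esub> ((\<eta> b \<otimes>\<^bsub>S\<^esub> W w) \<otimes>\<^bsub>S\<^esub> W a)"
          using Wc[OF that(1)] Wc[OF k(2)] by (simp add: S.m_assoc)
        also have "\<dots> = (\<eta> c \<otimes>\<^bsub>S\<^esub> W w) \<otimes>\<^bsub>S\<^esub> (\<eta> b \<otimes>\<^bsub>S\<^esub> W a)"
          using Wc[OF that(1)] Wc[OF k(2)]
          by (simp only: W_comm[OF that(1), of b]) (simp add: S.m_assoc)
        finally show ?thesis .
      qed
      finally show ?case
        using update.IH k that Fc[OF k(1)] Wc[OF that(1)] Wc[OF k(2)] s
        by (simp add: eq F_add F_single S.r_distr del: in_lists_conv_set)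
    qed
    show ?thesis using that(1)
    proof (induction p rule: update_induct)
      case const
      then show ?case using that Fc[OF that(2)] by (simp add: F0)
    next
      case (update f a b)
      have eq: "Poly_Mapping.update a b f = f + Poly_Mapping.single a b"
        using update.hyps by (intro poly_mapping_eqI)
          (auto simp: lookup_update lookup_add lookup_single in_keys_iff when_def)
      have k: "Poly_Mapping.keys f \<subseteq> lists B" "a \<in> lists B"
        using update by (auto simp: keys_update simp del: in_lists_conv_set)
      have s: "Poly_Mapping.keys (Poly_Mapping.single a b) \<subseteq> lists B"
        using k by auto
      show ?case
        using update.IH[OF k(1)] k s that 1 Fc[OF k(1)] Fc[OF s] Fc[OF that(2)]
        by (simp add: eq distrib_right F_add keys_mult_lists S.l_distr del: in_lists_conv_set)
    qed
  qed
  have F_c: "F (fconst c) = \<eta> c" for c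
    by (subst F_single) (auto simp: W_def)
  show "free_lift S \<eta> \<phi> \<in> ring_hom (free_algebra B) S"
    unfolding F_def[symmetric]
  proof (rule ring_hom_memI)
    show "F \<one>\<^bsub>free_algebra B\<^esub> = \<one>\<^bsub>S\<^esub>"
      by (simp only: free_algebra_def monoid.simps one_eq_fconst F_c \<eta>1)
  next
    fix p :: "'b list \<Rightarrow>\<^sub>0 'k" assume p: "p \<in> carrier (free_algebra B)"
    have k: "Poly_Mapping.keys p \<subseteq> lists B" using p unfolding free_algebra_def by simp
    show "F p \<in> carrier S" by (rule Fc[OF k])
    fix q :: "'b list \<Rightarrow>\<^sub>0 'k" assume q: "q \<in> carrier (free_algebra B)"
    have k': "Poly_Mapping.keys q \<subseteq> lists B" using q unfolding free_algebra_def by simp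
    show "F (p \<otimes>\<^bsub>free_algebra B\<^esub> q) = F p \<otimes>\<^bsub>S\<^esub> F q"
      using F_mult[OF k k'] unfolding free_algebra_def by simp
    show "F (p \<oplus>\<^bsub>free_algebra B\<^esub> q) = F p \<oplus>\<^bsub>S\<^esub> F q"
      using F_add[OF k k'] unfolding free_algebra_def by simp
  qed
  show "free_lift S \<eta> \<phi> (fconst c) = \<eta> c" for c using F_c by (simp add: F_def)
  show "free_lift S \<eta> \<phi> (fgen g) = \<phi> g" if "g \<in> B" for g
    using that \<phi>[OF that] by (simp add: F_single \<eta>1 W_def F_def[symmetric])
qed

lemma presented_lift_hom:
  fixes S :: "'s ring" and \<eta> :: "'k::field \<Rightarrow> 's" and B :: "'b set"
  assumes S: "ring S"
    and \<eta>: "\<eta> \<in> ring_hom ring_of_type_algebra S"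
    and central: "\<And>c g. g \<in> B \<Longrightarrow> \<eta> c \<otimes>\<^bsub>S\<^esub> \<phi> g = \<phi> g \<otimes>\<^bsub>S\<^esub> \<eta> c"
    and \<phi>: "\<And>g. g \<in> B \<Longrightarrow> \<phi> g \<in> carrier S"
    and rels: "rels \<subseteq> carrier (free_algebra B)"
    and kill: "\<And>r. r \<in> rels \<Longrightarrow> free_lift S \<eta> \<phi> r = \<zero>\<^bsub>S\<^esub>"
  shows "presented_lift S \<eta> \<phi> \<in> ring_hom (presented_algebra B rels) S"
    and "\<And>p. p \<in> carrier (free_algebra B) \<Longrightarrow>
            presented_lift S \<eta> \<phi> (presented_class B rels p) = free_lift S \<eta> \<phi> p"
proof -
  let ?F = "free_algebra B :: ('b list \<Rightarrow>\<^sub>0 'k) ring"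
  let ?I = "Idl\<^bsub>?F\<^esub> rels"
  interpret F: ring ?F by (rule ring_free_algebra)
  interpret S: ring S by (rule S)
  interpret h: ring_hom_ring ?F S "free_lift S \<eta> \<phi>"
    by (rule ring_hom_ringI2[OF F.ring_axioms S.ring_axioms free_lift_hom(1)[OF S \<eta> central \<phi>]])
  interpret I: ideal ?I ?F by (rule F.genideal_ideal[OF rels])
  have "?I \<subseteq> a_kernel ?F S (free_lift S \<eta> \<phi>)"
  proof (rule F.genideal_minimal[OF h.kernel_is_ideal])
    show "rels \<subseteq> a_kernel ?F S (free_lift S \<eta> \<phi>)"
      unfolding a_kernel_def' using rels kill by blast
  qed
  then have I0: "free_lift S \<eta> \<phi> i = \<zero>\<^bsub>S\<^esub>" if "i \<in> ?I" for i
    using that unfolding a_kernel_def' by blast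
  have val: "presented_lift S \<eta> \<phi> (?I +>\<^bsub>?F\<^esub> p) = free_lift S \<eta> \<phi> p"
    if p: "p \<in> carrier ?F" for p
  proof -
    have "free_lift S \<eta> \<phi> q = free_lift S \<eta> \<phi> p" if q: "q \<in> ?I +>\<^bsub>?F\<^esub> p" for q
    proof -
      obtain i where i: "i \<in> ?I" "q = i \<oplus>\<^bsub>?F\<^esub> p"
        using q unfolding a_r_coset_def' by blast
      show ?thesis using i(1) p I.a_Hcarr[OF i(1)] by (simp add: i(2) I0)
    qed
    moreover have "p \<in> ?I +>\<^bsub>?F\<^esub> p" using p by (rule I.a_rcos_self)
    ultimately have "free_lift S \<eta> \<phi> ` (?I +>\<^bsub>?F\<^esub> p) = {free_lift S \<eta> \<phi> p}" by blast
    then show ?thesis by (simp add: presented_lift_def)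
  qed
  show "presented_lift S \<eta> \<phi> (presented_class B rels p) = free_lift S \<eta> \<phi> p"
    if "p \<in> carrier ?F" for p
    using val[OF that] by (simp add: presented_class_def)
  have car: "carrier (presented_algebra B rels) = (\<lambda>p. ?I +>\<^bsub>?F\<^esub> p) ` carrier ?F"
    unfolding presented_algebra_def FactRing_def partial_object.simps A_RCOSETS_def' by blast
  show "presented_lift S \<eta> \<phi> \<in> ring_hom (presented_algebra B rels) S"
  proof (rule ring_hom_memI)
    show "presented_lift S \<eta> \<phi> \<one>\<^bsub>presented_algebra B rels\<^esub> = \<one>\<^bsub>S\<^esub>"
      using val[OF F.one_closed] h.hom_one by (simp only: presented_algebra_def FactRing_def monoid.simps)
  next
    fix u v assume "u \<in> carrier (presented_algebra B rels)" "v \<in> carrier (presented_algebra B rels)"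
    then obtain p q where u: "u = ?I +>\<^bsub>?F\<^esub> p" "p \<in> carrier ?F" and v: "v = ?I +>\<^bsub>?F\<^esub> q" "q \<in> carrier ?F"
      unfolding car by blast
    have m: "u \<otimes>\<^bsub>presented_algebra B rels\<^esub> v = ?I +>\<^bsub>?F\<^esub> (p \<otimes>\<^bsub>?F\<^esub> q)"
      unfolding presented_algebra_def FactRing_def u v using u(2) v(2) by (simp add: I.rcoset_mult_add)
    have a: "u \<oplus>\<^bsub>presented_algebra B rels\<^esub> v = ?I +>\<^bsub>?F\<^esub> (p \<oplus>\<^bsub>?F\<^esub> q)"
      unfolding presented_algebra_def FactRing_def u v using u(2) v(2) by (simp add: I.a_rcos_sum)
    show "presented_lift S \<eta> \<phi> u \<in> carrier S" using u by (simp add: val)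
    show "presented_lift S \<eta> \<phi> (u \<otimes>\<^bsub>presented_algebra B rels\<^esub> v) =
       presented_lift S \<eta> \<phi> u \<otimes>\<^bsub>S\<^esub> presented_lift S \<eta> \<phi> v"
      unfolding m unfolding u(1) v(1) using u(2) v(2) by (simp add: val)
    show "presented_lift S \<eta> \<phi> (u \<oplus>\<^bsub>presented_algebra B rels\<^esub> v) =
       presented_lift S \<eta> \<phi> u \<oplus>\<^bsub>S\<^esub> presented_lift S \<eta> \<phi> v"
      unfolding a unfolding u(1) v(1) using u(2) v(2) by (simp add: val)
  qed
qed


section \<open>Universal enveloping algebras\<close>

text \<open>
  The universal enveloping algebra of the Lie algebra with underlying set \<open>L\<close>, scalar multiplication
  \<open>scl\<close> and bracket \<open>br\<close>: the tensor algebra of \<open>L\<close> (the free algebra on the set \<open>L\<close> modulo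
  linearity of \<open>L \<rightarrow> T(L)\<close>) modulo \<open>f g - g f = [f, g]\<close>.
\<close>

definition env_relations ::
  "('k \<Rightarrow> 'l \<Rightarrow> 'l) \<Rightarrow> ('l \<Rightarrow> 'l \<Rightarrow> 'l) \<Rightarrow> 'l::ab_group_add set \<Rightarrow> ('l list \<Rightarrow>\<^sub>0 'k::field) set" where
  "env_relations scl br L =
     {fgen (f + g) - fgen f - fgen g | f g. f \<in> L \<and> g \<in> L} \<union>
     {fgen (scl c f) - fconst c * fgen f | c f. f \<in> L} \<union>
     {fgen f * fgen g - fgen g * fgen f - fgen (br f g) | f g. f \<in> L \<and> g \<in> L}"

definition env_algebra ::
  "('k \<Rightarrow> 'l \<Rightarrow> 'l) \<Rightarrow> ('l \<Rightarrow> 'l \<Rightarrow> 'l) \<Rightarrow> 'l::ab_group_add set \<Rightarrow> ('l list \<Rightarrow>\<^sub>0 'k::field) set ring" where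
  "env_algebra scl br L = presented_algebra L (env_relations scl br L)"


section \<open>Laurent polynomials and the Witt algebra\<close>

unbundle fps_syntax

text \<open>
  \<open>k[t, t\<inverse>]\<close> and its localisation \<open>k[t, t\<inverse>, (t - x)\<inverse>]\<close> are realised as subrings of the field
  \<open>k((t))\<close>, with \<^const>\<open>fls_X\<close> as \<open>t\<close> and \<^const>\<open>fls_deriv\<close> as \<open>d/dt\<close>.
\<close>

definition laurent_polys :: "'k::field fls set" where
  "laurent_polys = {f. finite {n. f $$ n \<noteq> 0}}"

definition laurent_eval :: "'k::field fls \<Rightarrow> 'k \<Rightarrow> 'k" where
  "laurent_eval f x = (\<Sum>n\<in>{n. f $$ n \<noteq> 0}. f $$ n * x powi n)"

definition localised_laurent_polys :: "'k::field \<Rightarrow> 'k fls set" where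
  "localised_laurent_polys x = {f / (fls_X - fls_const x) ^ m | f m. f \<in> laurent_polys}"

text \<open>The element \<open>f\<partial>\<close> of the Witt algebra is represented by its coefficient \<open>f\<close>.\<close>

definition witt_bracket :: "'k::field fls \<Rightarrow> 'k fls \<Rightarrow> 'k fls" where
  "witt_bracket f g = f * fls_deriv g - fls_deriv f * g"

abbreviation witt_scale :: "'k::field \<Rightarrow> 'k fls \<Rightarrow> 'k fls" where
  "witt_scale c f \<equiv> fls_const c * f"

definition witt_at :: "'k::field \<Rightarrow> 'k fls set" where
  "witt_at x = {(fls_X - fls_const x) * f | f. f \<in> laurent_polys}"

definition U_W :: "('k::field fls list \<Rightarrow>\<^sub>0 'k) set ring" where
  "U_W = env_algebra witt_scale witt_bracket laurent_polys"

definition U_W_at :: "'k::field \<Rightarrow> ('k fls list \<Rightarrow>\<^sub>0 'k) set ring" where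
  "U_W_at x = env_algebra witt_scale witt_bracket (witt_at x)"

definition U_W_class :: "('k::field fls list \<Rightarrow>\<^sub>0 'k) \<Rightarrow> ('k fls list \<Rightarrow>\<^sub>0 'k) set" where
  "U_W_class = presented_class laurent_polys (env_relations witt_scale witt_bracket laurent_polys)"

text \<open>The homomorphism from \<open>U(W(t - x))\<close> to \<open>U(W)\<close> extending the inclusion.\<close>

definition U_W_at_incl :: "('k::field fls list \<Rightarrow>\<^sub>0 'k) set \<Rightarrow> ('k fls list \<Rightarrow>\<^sub>0 'k) set" where
  "U_W_at_incl = presented_lift U_W (\<lambda>c. U_W_class (fconst c)) (\<lambda>f. U_W_class (fgen f))"


section \<open>The localised Weyl algebra\<close>

datatype weyl_gen = Gen_t | Gen_tinv | Gen_d

definition weyl_relations :: "(weyl_gen list \<Rightarrow>\<^sub>0 'k::field) set" where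
  "weyl_relations =
     {fgen Gen_t * fgen Gen_tinv - 1, fgen Gen_tinv * fgen Gen_t - 1,
      fgen Gen_d * fgen Gen_t - fgen Gen_t * fgen Gen_d - 1}"

definition weyl_algebra :: "(weyl_gen list \<Rightarrow>\<^sub>0 'k::field) set ring" where
  "weyl_algebra = presented_algebra UNIV weyl_relations"

definition weyl_class :: "(weyl_gen list \<Rightarrow>\<^sub>0 'k::field) \<Rightarrow> (weyl_gen list \<Rightarrow>\<^sub>0 'k) set" where
  "weyl_class = presented_class UNIV weyl_relations"

definition t_power_word :: "int \<Rightarrow> weyl_gen list" where
  "t_power_word n = (if n \<ge> 0 then replicate (nat n) Gen_t else replicate (nat (- n)) Gen_tinv)"

text \<open>A Laurent polynomial in \<open>t\<close>, written as an element of the free algebra.\<close>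

definition laurent_word :: "'k::field fls \<Rightarrow> (weyl_gen list \<Rightarrow>\<^sub>0 'k)" where
  "laurent_word f = (\<Sum>n\<in>{n. f $$ n \<noteq> 0}. Poly_Mapping.single (t_power_word n) (f $$ n))"

definition witt_to_weyl :: "'k::field \<Rightarrow> 'k fls \<Rightarrow> (weyl_gen list \<Rightarrow>\<^sub>0 'k) set" where
  "witt_to_weyl \<gamma> f =
     weyl_class (laurent_word f * fgen Gen_d + fconst \<gamma> * laurent_word (fls_deriv f))"

definition weyl_pi :: "'k::field \<Rightarrow> ('k fls list \<Rightarrow>\<^sub>0 'k) set \<Rightarrow> (weyl_gen list \<Rightarrow>\<^sub>0 'k) set" where
  "weyl_pi \<gamma> = presented_lift weyl_algebra (\<lambda>c. weyl_class (fconst c)) (witt_to_weyl \<gamma>)"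


section \<open>The modules\<close>

definition additive_endomorphism_ring :: "('v::ab_group_add \<Rightarrow> 'v) ring" where
  "additive_endomorphism_ring =
     \<lparr>carrier = Collect additive, monoid.mult = (\<circ>), one = id,
      ring.zero = (\<lambda>_. 0), ring.add = (\<lambda>f g v. f v + g v)\<rparr>"

lemma ring_additive_endomorphism_ring:
  "ring (additive_endomorphism_ring :: ('v::ab_group_add \<Rightarrow> 'v) ring)"
proof (rule ringI)
  show "abelian_group (additive_endomorphism_ring :: ('v \<Rightarrow> 'v) ring)"
  proof (rule abelian_groupI, goal_cases)
    case (6 f)
    then show ?case
      by (intro bexI[of _ "\<lambda>v. - f v"])
         (auto simp: additive_endomorphism_ring_def additive_def)
  qed (auto simp: additive_endomorphism_ring_def additive_def algebra_simps)
  show "Group.monoid (additive_endomorphism_ring :: ('v \<Rightarrow> 'v) ring)"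
    by (rule monoidI) (auto simp: additive_endomorphism_ring_def additive_def)
qed (auto simp: additive_endomorphism_ring_def additive_def)

text \<open>The action of the Weyl algebra on functions: \<open>t\<close> by multiplication, \<open>\<partial>\<close> by \<open>d/dt\<close>.\<close>

fun weyl_gen_action :: "weyl_gen \<Rightarrow> 'k::field fls \<Rightarrow> 'k fls" where
  "weyl_gen_action Gen_t r = fls_X * r"
| "weyl_gen_action Gen_tinv r = fls_X_inv * r"
| "weyl_gen_action Gen_d r = fls_deriv r"

definition weyl_action :: "(weyl_gen list \<Rightarrow>\<^sub>0 'k::field) set \<Rightarrow> 'k fls \<Rightarrow> 'k fls" where
  "weyl_action =
     presented_lift additive_endomorphism_ring (\<lambda>c r. fls_const c * r) weyl_gen_action"

definition localised_module :: "'k::field \<Rightarrow> ((weyl_gen list \<Rightarrow>\<^sub>0 'k) set, 'k fls) module" where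
  "localised_module x =
     \<lparr>carrier = localised_laurent_polys x, monoid.mult = (*), one = 1, ring.zero = 0, ring.add = (+),
      module.smult = weyl_action\<rparr>"

definition N_weyl :: "'k::field \<Rightarrow> ((weyl_gen list \<Rightarrow>\<^sub>0 'k) set, 'k fls set) module" where
  "N_weyl x = quotient_module (localised_module x) laurent_polys"

definition N_module :: "'k::field \<Rightarrow> 'k \<Rightarrow> (('k fls list \<Rightarrow>\<^sub>0 'k) set, 'k fls set) module" where
  "N_module x \<gamma> = restrict_scalars (weyl_pi \<gamma>) (N_weyl x)"

text \<open>
  A one-dimensional representation \<open>\<chi> : L \<rightarrow> k\<close> of a Lie algebra, as a module over the enveloping
  algebra with underlying space \<open>k\<close>.
\<close>

definition character_module :: "('l \<Rightarrow> 'k::field) \<Rightarrow> (('l list \<Rightarrow>\<^sub>0 'k) set, 'k) module" where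
  "character_module \<chi> =
     restrict_scalars (presented_lift ring_of_type_algebra id \<chi>)
       (regular_left_module ring_of_type_algebra)"

definition M_module ::
  "'k::field \<Rightarrow> 'k \<Rightarrow>
   (('k fls list \<Rightarrow>\<^sub>0 'k) set, (('k fls list \<Rightarrow>\<^sub>0 'k) set \<times> 'k \<Rightarrow>\<^sub>0 int) set) module" where
  "M_module x \<gamma> =
     induced_module U_W (U_W_at x) U_W_at_incl
       (character_module (\<lambda>p. \<gamma> * laurent_eval (fls_deriv p) x))"

definition trivial_module :: "(('k::field fls list \<Rightarrow>\<^sub>0 'k) set, 'k) module" where
  "trivial_module = character_module (\<lambda>_. 0)"

end

theory Submission
  imports Defs
begin

text \<open>
  The key object is the chain of poles \<open>e\<^sub>n = (t - x)\<^bsup>-(n+1)\<^esup>\<close> (\<open>pole x n\<close> below), whose principal parts form a basis of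
  \<open>N\<^sub>x\<close>. The element \<open>\<partial>\<close> of the Witt algebra acts on every \<open>N\<^sub>x\<^sup>\<gamma>\<close> by \<open>d/dt\<close>, so it sends \<open>e\<^sub>n\<close> to
  \<open>-(n+1) e\<^bsub>n+1\<^esub>\<close>. Hence \<open>e\<^sub>0\<close> generates \<open>N\<^sub>x\<^sup>\<gamma>\<close>, and \<open>d/dt\<close> raises pole orders strictly; in particular
  \<open>s' + c e\<^sub>0\<close> has no pole only if \<open>s\<close> has none and \<open>c = 0\<close> (\<open>deriv_plus_simple_pole\<close>).

  \<^emph>\<open>Simplicity.\<close> If \<open>r\<close> has a pole of order \<open>n + 1\<close>, then \<open>(t-x)\<^bsup>n+1\<^esup>\<partial>\<close> removes all of the principal part of \<open>r\<close>
  except for \<open>(\<gamma> - 1)(n + 1)\<close> times its leading coefficient in front of \<open>e\<^sub>0\<close>. For \<open>\<gamma> \<noteq> 1\<close> every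
  nonzero submodule therefore contains the generator \<open>e\<^sub>0\<close>.

  \<^emph>\<open>Exact sequence.\<close> Since \<open>f\<partial> + f' = \<partial>f\<close> in the Weyl algebra, \<open>d/dt\<close> is a \<open>W\<close>-map \<open>N\<^sub>x\<^sup>0 \<rightarrow> N\<^sub>x\<^sup>1\<close>. It is
  injective, and its cokernel is spanned by \<open>e\<^sub>0\<close>; the quotient map is the residue.

  \<^emph>\<open>Induced module.\<close> The vector \<open>e\<^sub>0\<close> is an eigenvector of \<open>W(t-x)\<close> with the character that defines
  \<open>M\<^bsub>x;\<gamma>-1\<^esub>\<close>, which gives a surjection \<open>M\<^bsub>x;\<gamma>-1\<^esub> \<rightarrow> N\<^sub>x\<^sup>\<gamma>\<close>. As \<open>W\<close> is the sum of \<open>W(t-x)\<close> and the line through \<open>\<partial>\<close>,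
  the module \<open>M\<^bsub>x;\<gamma>-1\<^esub>\<close> is spanned by the vectors \<open>\<partial>\<^sup>i \<otimes> 1\<close> (\<open>horner_span_submodule\<close>), and the images
  of these vectors are nonzero multiples of the basis vectors \<open>e\<^sub>i\<close>. So the surjection is an isomorphism.

  \<^emph>\<open>Annihilators.\<close> The localised Weyl algebra acts faithfully on \<open>N\<^sub>x\<close>: commuting an operator
  \<open>\<Sum> f\<^sub>i \<partial>\<^sup>i\<close> with \<open>t\<close> lowers its order, which reduces the claim to a Laurent polynomial that is divisible by
  all powers of \<open>t - x\<close>. Hence the annihilator of \<open>N\<^sub>x\<^sup>\<gamma>\<close> is \<open>ker \<pi>\<^sub>\<gamma>\<close>, which is primitive for \<open>\<gamma> \<noteq> 1\<close>. For
  \<open>\<gamma> = 1\<close> the identity \<open>\<pi>\<^sub>1(u) \<partial> = \<partial> \<pi>\<^sub>0(u)\<close> shows that \<open>ker \<pi>\<^sub>1 = ker \<pi>\<^sub>0\<close>.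
\<close>

section \<open>Left modules: homomorphisms, quotients, primitive ideals\<close>

lemma (in abelian_group) add_minus_minus:
  assumes "a \<in> carrier G" "b \<in> carrier G"
  shows "a \<oplus> b \<ominus> a \<ominus> b = \<zero>"
proof -
  have "a \<oplus> b \<ominus> a \<ominus> b = (a \<oplus> b) \<oplus> (\<ominus> a \<oplus> \<ominus> b)"
    using assms by (simp add: minus_eq a_assoc)
  also have "\<dots> = (a \<oplus> b) \<oplus> \<ominus> (a \<oplus> b)"
    using assms by (simp add: minus_add)
  also have "\<dots> = \<zero>" using assms by (simp add: r_neg)
  finally show ?thesis .
qed

lemma (in abelian_group) minus_eq_zeroD:
  assumes "a \<ominus> b = \<zero>" "a \<in> carrier G" "b \<in> carrier G" shows "a = b"
proof -
  have "a = \<ominus> (\<ominus> b)"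
    using assms by (intro minus_equality[symmetric]) (auto simp: minus_eq)
  then show ?thesis using assms by simp
qed

lemma (in left_module) smult_r_zero:
  assumes "a \<in> carrier R" shows "a \<odot>\<^bsub>M\<^esub> \<zero>\<^bsub>M\<^esub> = \<zero>\<^bsub>M\<^esub>"
  using smult_r_distr[OF assms M.zero_closed M.zero_closed] smult_closed[OF assms M.zero_closed]
  by simp

lemma (in left_module) smult_r_minus:
  assumes "a \<in> carrier R" "m \<in> carrier M" shows "a \<odot>\<^bsub>M\<^esub> (\<ominus>\<^bsub>M\<^esub> m) = \<ominus>\<^bsub>M\<^esub> (a \<odot>\<^bsub>M\<^esub> m)"
proof (rule M.minus_equality[symmetric])
  show "a \<odot>\<^bsub>M\<^esub> (\<ominus>\<^bsub>M\<^esub> m) \<oplus>\<^bsub>M\<^esub> a \<odot>\<^bsub>M\<^esub> m = \<zero>\<^bsub>M\<^esub>"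
    using assms by (simp add: smult_r_distr[symmetric] M.l_neg smult_r_zero)
qed (use assms in \<open>auto intro: smult_closed\<close>)

lemma (in left_module) smult_l_zero:
  assumes "m \<in> carrier M" shows "\<zero>\<^bsub>R\<^esub> \<odot>\<^bsub>M\<^esub> m = \<zero>\<^bsub>M\<^esub>"
  using smult_l_distr[OF R.zero_closed R.zero_closed assms] smult_closed[OF R.zero_closed assms]
  by simp

lemma (in left_module) smult_l_minus:
  assumes "a \<in> carrier R" "m \<in> carrier M" shows "(\<ominus>\<^bsub>R\<^esub> a) \<odot>\<^bsub>M\<^esub> m = \<ominus>\<^bsub>M\<^esub> (a \<odot>\<^bsub>M\<^esub> m)"
proof (rule M.minus_equality[symmetric])
  show "(\<ominus>\<^bsub>R\<^esub> a) \<odot>\<^bsub>M\<^esub> m \<oplus>\<^bsub>M\<^esub> a \<odot>\<^bsub>M\<^esub> m = \<zero>\<^bsub>M\<^esub>"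
    using assms by (simp add: smult_l_distr[symmetric] R.l_neg smult_l_zero)
qed (use assms in \<open>auto intro: smult_closed\<close>)

lemma (in left_module) submoduleI:
  assumes "H \<subseteq> carrier M" "H \<noteq> {}"
    and "\<And>m n. m \<in> H \<Longrightarrow> n \<in> H \<Longrightarrow> m \<oplus>\<^bsub>M\<^esub> n \<in> H"
    and smult: "\<And>a m. a \<in> carrier R \<Longrightarrow> m \<in> H \<Longrightarrow> a \<odot>\<^bsub>M\<^esub> m \<in> H"
  shows "submodule H R M"
proof -
  have minus: "\<ominus>\<^bsub>M\<^esub> m \<in> H" if "m \<in> H" for m
  proof -
    have m: "m \<in> carrier M" using that assms(1) by blast
    have "\<ominus>\<^bsub>M\<^esub> m = (\<ominus>\<^bsub>R\<^esub> \<one>\<^bsub>R\<^esub>) \<odot>\<^bsub>M\<^esub> m"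
      using m by (simp add: smult_l_minus smult_one)
    then show ?thesis using smult[OF _ that] by simp
  qed
  obtain m where m: "m \<in> H" using assms(2) by blast
  have "\<zero>\<^bsub>M\<^esub> = \<zero>\<^bsub>R\<^esub> \<odot>\<^bsub>M\<^esub> m" using m assms(1) by (subst smult_l_zero) auto
  then have "\<zero>\<^bsub>M\<^esub> \<in> H" using smult[OF R.zero_closed m] by simp
  then show ?thesis
    using assms minus unfolding submodule_def submodule_axioms_def subgroup_def
    by (auto simp: a_inv_def)
qed

lemma left_module_hom_image:
  assumes M: "left_module R M" and N: "left_module R N" and f: "f \<in> left_module_hom R M N"
  shows "submodule (f ` carrier M) R N"
proof -
  interpret M: left_module R M by (rule M)
  interpret N: left_module R N by (rule N)
  have fc: "f m \<in> carrier N" if "m \<in> carrier M" for m using f that by (auto simp: left_module_hom_def)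
  have add: "f (m \<oplus>\<^bsub>M\<^esub> n) = f m \<oplus>\<^bsub>N\<^esub> f n" if "m \<in> carrier M" "n \<in> carrier M" for m n
    using f that by (auto simp: left_module_hom_def)
  have smult: "f (a \<odot>\<^bsub>M\<^esub> m) = a \<odot>\<^bsub>N\<^esub> f m" if "a \<in> carrier R" "m \<in> carrier M" for a m
    using f that by (auto simp: left_module_hom_def)
  show ?thesis
  proof (rule N.submoduleI)
    show "m \<oplus>\<^bsub>N\<^esub> n \<in> f ` carrier M" if "m \<in> f ` carrier M" "n \<in> f ` carrier M" for m n
      using that by (auto simp: add[symmetric])
    show "a \<odot>\<^bsub>N\<^esub> m \<in> f ` carrier M" if "a \<in> carrier R" "m \<in> f ` carrier M" for a m
      using that by (auto simp: smult[symmetric] M.smult_closed)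
  qed (use fc M.M.zero_closed in auto)
qed

lemma left_module_hom_inj:
  assumes M: "left_module R M" and N: "left_module R N" and f: "f \<in> left_module_hom R M N"
    and ker: "\<And>m. m \<in> carrier M \<Longrightarrow> f m = \<zero>\<^bsub>N\<^esub> \<Longrightarrow> m = \<zero>\<^bsub>M\<^esub>"
  shows "inj_on f (carrier M)"
proof (rule inj_onI)
  interpret M: left_module R M by (rule M)
  interpret N: left_module R N by (rule N)
  fix m n assume mn: "m \<in> carrier M" "n \<in> carrier M" "f m = f n"
  have fc: "f m \<in> carrier N" if "m \<in> carrier M" for m using f that by (auto simp: left_module_hom_def)
  have add: "f (m \<oplus>\<^bsub>M\<^esub> n) = f m \<oplus>\<^bsub>N\<^esub> f n" if "m \<in> carrier M" "n \<in> carrier M" for m n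
    using f that by (auto simp: left_module_hom_def)
  have "f (m \<ominus>\<^bsub>M\<^esub> n) \<oplus>\<^bsub>N\<^esub> f n = f m"
    using mn by (simp add: add[symmetric] M.M.minus_eq M.M.a_assoc M.M.l_neg)
  then have "f (m \<ominus>\<^bsub>M\<^esub> n) \<oplus>\<^bsub>N\<^esub> f n = f n" using mn by simp
  then have "f (m \<ominus>\<^bsub>M\<^esub> n) = \<zero>\<^bsub>N\<^esub>" using mn fc by simp
  then have "m \<ominus>\<^bsub>M\<^esub> n = \<zero>\<^bsub>M\<^esub>" using mn by (intro ker) auto
  then show "m = n" using mn(1,2) by (rule M.M.minus_eq_zeroD)
qed

lemma left_modules_isomorphic_sym:
  assumes "left_modules_isomorphic R M N" shows "left_modules_isomorphic R N M"
proof -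
  from assms obtain f where M: "left_module R M" and N: "left_module R N"
    and f: "f \<in> left_module_hom R M N" and bij: "bij_betw f (carrier M) (carrier N)"
    unfolding left_modules_isomorphic_def by blast
  interpret M: left_module R M by (rule M)
  let ?g = "inv_into (carrier M) f"
  have inj: "inj_on f (carrier M)" and im: "f ` carrier M = carrier N"
    using bij by (auto simp: bij_betw_def)
  have g: "?g n \<in> carrier M" "f (?g n) = n" if "n \<in> carrier N" for n
    using that im by (auto simp: inv_into_into f_inv_into_f)
  have add: "f (m \<oplus>\<^bsub>M\<^esub> m') = f m \<oplus>\<^bsub>N\<^esub> f m'" if "m \<in> carrier M" "m' \<in> carrier M" for m m'
    using f that by (auto simp: left_module_hom_def)
  have smult: "f (a \<odot>\<^bsub>M\<^esub> m) = a \<odot>\<^bsub>N\<^esub> f m" if "a \<in> carrier R" "m \<in> carrier M" for a m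
    using f that by (auto simp: left_module_hom_def)
  have "?g \<in> left_module_hom R N M"
    unfolding left_module_hom_def
  proof (intro CollectI conjI ballI Pi_I)
    fix m n assume mn: "m \<in> carrier N" "n \<in> carrier N"
    have "?g (f (?g m \<oplus>\<^bsub>M\<^esub> ?g n)) = ?g m \<oplus>\<^bsub>M\<^esub> ?g n"
      using g mn inj by (intro inv_into_f_f) auto
    then show "?g (m \<oplus>\<^bsub>N\<^esub> n) = ?g m \<oplus>\<^bsub>M\<^esub> ?g n" using add g mn by simp
  next
    fix a n assume an: "a \<in> carrier R" "n \<in> carrier N"
    have "?g (f (a \<odot>\<^bsub>M\<^esub> ?g n)) = a \<odot>\<^bsub>M\<^esub> ?g n"
      using g an inj by (intro inv_into_f_f) (auto intro: M.smult_closed)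
    then show "?g (a \<odot>\<^bsub>N\<^esub> n) = a \<odot>\<^bsub>M\<^esub> ?g n" using smult g an by simp
  qed (use g in auto)
  then show ?thesis
    unfolding left_modules_isomorphic_def using M N bij_betw_inv_into[OF bij] by blast
qed

lemma restrict_scalars_left_module:
  assumes "left_module R M" "ring S" and h: "h \<in> ring_hom S R"
  shows "left_module S (restrict_scalars h M)"
proof -
  interpret L: left_module R M by fact
  interpret S: ring S by fact
  have "abelian_group (restrict_scalars h M)"
  proof (rule abelian_groupI, goal_cases)
    case (6 m)
    then show ?case
      by (intro bexI[of _ "\<ominus>\<^bsub>M\<^esub> m"]) (auto simp: restrict_scalars_def L.M.l_neg)
  qed (auto simp: restrict_scalars_def L.M.a_ac)
  moreover have "left_module_axioms S (restrict_scalars h M)"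
    using h unfolding left_module_axioms_def
    by (auto simp: restrict_scalars_def ring_hom_closed ring_hom_add ring_hom_mult ring_hom_one
        L.smult_closed L.smult_l_distr L.smult_r_distr L.smult_assoc1 L.smult_one)
  ultimately show ?thesis by (simp add: left_module_def S.ring_axioms)
qed

lemma regular_left_module:
  assumes "ring R" shows "left_module R (regular_left_module R)"
proof -
  interpret R: ring R by fact
  have "abelian_group (regular_left_module R)"
  proof (rule abelian_groupI, goal_cases)
    case (6 m)
    then show ?case
      by (intro bexI[of _ "\<ominus>\<^bsub>R\<^esub> m"]) (auto simp: regular_left_module_def R.l_neg)
  qed (auto simp: regular_left_module_def R.a_ac)
  moreover have "left_module_axioms R (regular_left_module R)"
    unfolding left_module_axioms_def
    by (auto simp: regular_left_module_def R.l_distr R.r_distr R.m_assoc)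
  ultimately show ?thesis by (simp add: left_module_def R.ring_axioms)
qed

locale left_submodule = left_module R M + H: submodule H R M
  for R :: "('r, 'p) ring_scheme" and M :: "('r, 'm) module" and H :: "'m set"
begin

sublocale H: abelian_subgroup H M
  by (intro abelian_subgroupI3 additive_subgroup.intro H.subgroup_axioms M.abelian_group_axioms)

lemma coset_eq_iff:
  assumes "m \<in> carrier M" "n \<in> carrier M"
  shows "H +>\<^bsub>M\<^esub> m = H +>\<^bsub>M\<^esub> n \<longleftrightarrow> m \<ominus>\<^bsub>M\<^esub> n \<in> H"
  using assms H.a_rcos_module[OF assms(2,1)] H.a_rcos_self
  by (metis H.a_repr_independence' M.minus_eq)

lemma quotient_carrier: "carrier (quotient_module M H) = (\<lambda>m. H +>\<^bsub>M\<^esub> m) ` carrier M"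
  by (auto simp: quotient_module_def A_RCOSETS_def')

lemma quotient_zero: "\<zero>\<^bsub>quotient_module M H\<^esub> = H"
  by (simp add: quotient_module_def)

lemma quotient_add:
  assumes "m \<in> carrier M" "n \<in> carrier M"
  shows "(H +>\<^bsub>M\<^esub> m) \<oplus>\<^bsub>quotient_module M H\<^esub> (H +>\<^bsub>M\<^esub> n) = H +>\<^bsub>M\<^esub> (m \<oplus>\<^bsub>M\<^esub> n)"
  using assms by (simp add: quotient_module_def H.a_rcos_sum)

lemma quotient_smult:
  assumes a: "a \<in> carrier R" and m: "m \<in> carrier M"
  shows "a \<odot>\<^bsub>quotient_module M H\<^esub> (H +>\<^bsub>M\<^esub> m) = H +>\<^bsub>M\<^esub> (a \<odot>\<^bsub>M\<^esub> m)"
proof -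
  have "H +>\<^bsub>M\<^esub> (a \<odot>\<^bsub>M\<^esub> n) = H +>\<^bsub>M\<^esub> (a \<odot>\<^bsub>M\<^esub> m)" if n: "n \<in> H +>\<^bsub>M\<^esub> m" for n
  proof -
    obtain l where l: "l \<in> H" "n = l \<oplus>\<^bsub>M\<^esub> m" using n unfolding a_r_coset_def' by blast
    have lc: "l \<in> carrier M" using l(1) by (rule H.a_Hcarr)
    have "a \<odot>\<^bsub>M\<^esub> n \<ominus>\<^bsub>M\<^esub> a \<odot>\<^bsub>M\<^esub> m = a \<odot>\<^bsub>M\<^esub> l"
      using a m lc by (simp add: l(2) smult_r_distr smult_closed M.minus_eq M.a_assoc M.r_neg)
    then show ?thesis
      using a m l lc by (subst coset_eq_iff) (auto simp: smult_closed)
  qed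
  moreover have "m \<in> H +>\<^bsub>M\<^esub> m" using m by (rule H.a_rcos_self)
  ultimately have "(\<lambda>n. H +>\<^bsub>M\<^esub> (a \<odot>\<^bsub>M\<^esub> n)) ` (H +>\<^bsub>M\<^esub> m) = {H +>\<^bsub>M\<^esub> (a \<odot>\<^bsub>M\<^esub> m)}" by blast
  then show ?thesis by (simp add: quotient_module_def)
qed

lemma quotient_left_module: "left_module R (quotient_module M H)"
proof -
  let ?Q = "quotient_module M H"
  have z: "\<zero>\<^bsub>?Q\<^esub> = H +>\<^bsub>M\<^esub> \<zero>\<^bsub>M\<^esub>"
    by (simp add: quotient_zero H.a_subset)
  have "abelian_group ?Q"
  proof (rule abelian_groupI, goal_cases)
    case (6 m)
    then obtain n where "n \<in> carrier M" "m = H +>\<^bsub>M\<^esub> n" by (auto simp: quotient_carrier)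
    then show ?case
      by (intro bexI[of _ "H +>\<^bsub>M\<^esub> (\<ominus>\<^bsub>M\<^esub> n)"])
         (auto simp: z quotient_carrier quotient_add M.l_neg)
  qed (auto simp: z quotient_carrier quotient_add M.a_ac)
  moreover have "left_module_axioms R ?Q"
    unfolding left_module_axioms_def
    by (auto simp: quotient_carrier quotient_add quotient_smult smult_closed smult_l_distr
        smult_r_distr smult_assoc1 smult_one)
  ultimately show ?thesis by (simp add: left_module_def R.ring_axioms)
qed

end

text \<open>
  The definition of a primitive ideal asks for a simple module whose elements are sets of ring
  elements. A nonzero vector \<open>m\<^sub>0\<close> generates \<open>M\<close>, so \<open>m \<mapsto> {a. a m\<^sub>0 = m}\<close> is injective, and the module
  structure of \<open>M\<close> can be moved along this map to such sets.
\<close>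

lemma left_primitive_ideal_annihilator:
  assumes "simple_left_module R M"
  shows "left_primitive_ideal R (module_annihilator R M)"
proof -
  interpret left_module R M using assms by (simp add: simple_left_module_def)
  have simple: "H = {\<zero>\<^bsub>M\<^esub>} \<or> H = carrier M" if "submodule H R M" for H
    using assms that by (simp add: simple_left_module_def)
  obtain m0 where m0: "m0 \<in> carrier M" "m0 \<noteq> \<zero>\<^bsub>M\<^esub>"
    using assms M.zero_closed unfolding simple_left_module_def by blast
  have "submodule ((\<lambda>a. a \<odot>\<^bsub>M\<^esub> m0) ` carrier R) R M"
  proof (rule submoduleI)
    show "m \<oplus>\<^bsub>M\<^esub> n \<in> (\<lambda>a. a \<odot>\<^bsub>M\<^esub> m0) ` carrier R"
      if mn: "m \<in> (\<lambda>a. a \<odot>\<^bsub>M\<^esub> m0) ` carrier R" "n \<in> (\<lambda>a. a \<odot>\<^bsub>M\<^esub> m0) ` carrier R" for m n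
    proof -
      obtain a b where "a \<in> carrier R" "b \<in> carrier R" "m = a \<odot>\<^bsub>M\<^esub> m0" "n = b \<odot>\<^bsub>M\<^esub> m0"
        using mn by blast
      then show ?thesis using m0(1)
        by (intro image_eqI[of _ _ "a \<oplus>\<^bsub>R\<^esub> b"]) (auto simp: smult_l_distr)
    qed
    show "a \<odot>\<^bsub>M\<^esub> m \<in> (\<lambda>a. a \<odot>\<^bsub>M\<^esub> m0) ` carrier R"
      if a: "a \<in> carrier R" and m: "m \<in> (\<lambda>a. a \<odot>\<^bsub>M\<^esub> m0) ` carrier R" for a m
    proof -
      obtain b where "b \<in> carrier R" "m = b \<odot>\<^bsub>M\<^esub> m0"
        using m by blast
      then show ?thesis using a m0(1)
        by (intro image_eqI[of _ _ "a \<otimes>\<^bsub>R\<^esub> b"]) (auto simp: smult_assoc1)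
    qed
  qed (use m0 smult_closed in auto)
  moreover have "m0 \<in> (\<lambda>a. a \<odot>\<^bsub>M\<^esub> m0) ` carrier R"
    using smult_one[OF m0(1)] by (metis R.one_closed image_eqI)
  ultimately have cyclic: "carrier M = (\<lambda>a. a \<odot>\<^bsub>M\<^esub> m0) ` carrier R"
    using simple m0(2) by blast
  \<comment> \<open>The fibres of the surjection \<open>R \<rightarrow> M\<close>, \<open>a \<mapsto> a m0\<close> are the elements of the copy of \<open>M\<close>.\<close>
  define \<phi> where "\<phi> m = {a \<in> carrier R. a \<odot>\<^bsub>M\<^esub> m0 = m}" for m
  have inj: "inj_on \<phi> (carrier M)"
  proof (rule inj_onI)
    fix m n assume "m \<in> carrier M" "\<phi> m = \<phi> n"
    moreover from this obtain a where "a \<in> \<phi> m" unfolding cyclic \<phi>_def by blast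
    ultimately show "m = n" unfolding \<phi>_def by blast
  qed
  define \<psi> where "\<psi> = inv_into (carrier M) \<phi>"
  have [simp]: "\<psi> (\<phi> m) = m" if "m \<in> carrier M" for m
    unfolding \<psi>_def using inj that by (rule inv_into_f_f)
  have [simp]: "\<phi> m = \<phi> n \<longleftrightarrow> m = n" if "m \<in> carrier M" "n \<in> carrier M" for m n
    using inj that by (auto simp: inj_on_eq_iff)
  define N where "N = \<lparr>carrier = \<phi> ` carrier M, monoid.mult = (\<lambda>_ B. B), one = \<phi> \<zero>\<^bsub>M\<^esub>,
      ring.zero = \<phi> \<zero>\<^bsub>M\<^esub>, ring.add = (\<lambda>A B. \<phi> (\<psi> A \<oplus>\<^bsub>M\<^esub> \<psi> B)),
      module.smult = (\<lambda>a A. \<phi> (a \<odot>\<^bsub>M\<^esub> \<psi> A))\<rparr>"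
  have "abelian_group N"
  proof (rule abelian_groupI, goal_cases)
    case (6 A)
    then obtain m where "m \<in> carrier M" "A = \<phi> m" by (auto simp: N_def)
    then show ?case
      by (intro bexI[of _ "\<phi> (\<ominus>\<^bsub>M\<^esub> m)"]) (auto simp: N_def M.l_neg)
  qed (auto simp: N_def M.a_ac)
  moreover have "left_module_axioms R N"
    unfolding left_module_axioms_def
    by (auto simp: N_def smult_closed smult_l_distr smult_r_distr smult_assoc1 smult_one)
  ultimately have N: "left_module R N" by (simp add: left_module_def R.ring_axioms)
  have "H = {\<zero>\<^bsub>N\<^esub>} \<or> H = carrier N" if H: "submodule H R N" for H
  proof -
    interpret H: left_submodule R N H using N H by (simp add: left_submodule_def)
    have Hc: "H \<subseteq> \<phi> ` carrier M" using H.H.a_subset by (simp add: N_def)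
    have "submodule {m \<in> carrier M. \<phi> m \<in> H} R M"
    proof (rule submoduleI)
      show "{m \<in> carrier M. \<phi> m \<in> H} \<noteq> {}"
        using H.H.zero_closed M.zero_closed by (auto simp: N_def)
      show "m \<oplus>\<^bsub>M\<^esub> n \<in> {m \<in> carrier M. \<phi> m \<in> H}"
        if "m \<in> {m \<in> carrier M. \<phi> m \<in> H}" "n \<in> {m \<in> carrier M. \<phi> m \<in> H}" for m n
        using that H.H.a_closed[of "\<phi> m" "\<phi> n"] by (auto simp: N_def)
      show "a \<odot>\<^bsub>M\<^esub> m \<in> {m \<in> carrier M. \<phi> m \<in> H}"
        if "a \<in> carrier R" "m \<in> {m \<in> carrier M. \<phi> m \<in> H}" for a m
        using that H.H.smult_closed[of a "\<phi> m"] by (auto simp: N_def smult_closed)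
    qed auto
    then have "{m \<in> carrier M. \<phi> m \<in> H} = {\<zero>\<^bsub>M\<^esub>} \<or> {m \<in> carrier M. \<phi> m \<in> H} = carrier M"
      by (rule simple)
    moreover have "H = \<phi> ` {m \<in> carrier M. \<phi> m \<in> H}" using Hc by blast
    ultimately show ?thesis by (auto simp: N_def)
  qed
  moreover have "carrier N \<noteq> {\<zero>\<^bsub>N\<^esub>}"
  proof
    assume "carrier N = {\<zero>\<^bsub>N\<^esub>}"
    moreover have "\<phi> m0 \<in> carrier N" using m0 by (simp add: N_def)
    ultimately have "\<phi> m0 = \<phi> \<zero>\<^bsub>M\<^esub>" by (simp add: N_def)
    then show False using m0 by simp
  qed
  ultimately have "simple_left_module R N" using N by (simp add: simple_left_module_def)
  moreover have "module_annihilator R M = module_annihilator R N"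
    by (auto simp: module_annihilator_def N_def smult_closed)
  ultimately show ?thesis unfolding left_primitive_ideal_def by blast
qed

section \<open>Induction along a ring homomorphism\<close>

locale induction_along = R: ring R + N: left_module S N
  for R :: "'r ring" and S :: "'s ring" and h :: "'s \<Rightarrow> 'r" and N :: "('s, 'm) module" +
  assumes h: "h \<in> ring_hom S R"
begin

abbreviation "F \<equiv> free_Abelian_group (carrier R \<times> carrier N)"
abbreviation "H \<equiv> generate F (tensor_relations R S h N)"
abbreviation "coset p \<equiv> H #>\<^bsub>F\<^esub> p"
abbreviation "act a \<equiv> frag_extend (\<lambda>(b, n). frag_of (a \<otimes>\<^bsub>R\<^esub> b, n))"
abbreviation "Ind \<equiv> induced_module R S h N"

definition tensor where "tensor a n = coset (frag_of (a, n))"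

lemma h_closed [simp]: "s \<in> carrier S \<Longrightarrow> h s \<in> carrier R"
  using h by (rule ring_hom_closed)

lemma keys_frag_ofs:
  "p \<in> {frag_of x, frag_of x - frag_of y, frag_of x - frag_of y - frag_of z}
   \<Longrightarrow> {x, y, z} \<subseteq> A \<Longrightarrow> Poly_Mapping.keys p \<subseteq> A"
  using keys_diff[of "frag_of x" "frag_of y"] keys_diff[of "frag_of x - frag_of y" "frag_of z"]
  by fastforce

lemma relation_cases:
  assumes "r \<in> tensor_relations R S h N"
  obtains (left) a b n where "r = frag_of (a \<oplus>\<^bsub>R\<^esub> b, n) - frag_of (a, n) - frag_of (b, n)"
      "a \<in> carrier R" "b \<in> carrier R" "n \<in> carrier N"
    | (right) a n n' where "r = frag_of (a, n \<oplus>\<^bsub>N\<^esub> n') - frag_of (a, n) - frag_of (a, n')"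
      "a \<in> carrier R" "n \<in> carrier N" "n' \<in> carrier N"
    | (balanced) a s n where "r = frag_of (a \<otimes>\<^bsub>R\<^esub> h s, n) - frag_of (a, s \<odot>\<^bsub>N\<^esub> n)"
      "a \<in> carrier R" "s \<in> carrier S" "n \<in> carrier N"
  using assms unfolding tensor_relations_def
  apply (elim UnE CollectE exE conjE) 
  subgoal premises p for a b n using p(4-) p(1) by simp
  subgoal premises p using p(4-) p(2) by simp
  subgoal premises p using p(4-) p(3) by simp
  done

lemma relations_carrier: "tensor_relations R S h N \<subseteq> carrier F"
proof
  fix r assume "r \<in> tensor_relations R S h N"
  then show "r \<in> carrier F"
  proof (cases rule: relation_cases)
    case (left a b n)
    then show ?thesis
      using keys_frag_ofs[of r "(a \<oplus>\<^bsub>R\<^esub> b, n)" "(a, n)" "(b, n)" "carrier R \<times> carrier N"] by simp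
  next
    case (right a n n')
    then show ?thesis
      using keys_frag_ofs[of r "(a, n \<oplus>\<^bsub>N\<^esub> n')" "(a, n)" "(a, n')" "carrier R \<times> carrier N"] by simp
  next
    case (balanced a s n)
    then show ?thesis
      using keys_frag_ofs[of r "(a \<otimes>\<^bsub>R\<^esub> h s, n)" "(a, s \<odot>\<^bsub>N\<^esub> n)" "(a, s \<odot>\<^bsub>N\<^esub> n)" "carrier R \<times> carrier N"]
        N.smult_closed[of s n] by simp
  qed
qed

lemma F_induct [consumes 1, case_names zero diff pair]:
  assumes "p \<in> carrier F" "P 0"
    and "\<And>p q. p \<in> carrier F \<Longrightarrow> q \<in> carrier F \<Longrightarrow> P p \<Longrightarrow> P q \<Longrightarrow> P (p - q)"
    and "\<And>a n. a \<in> carrier R \<Longrightarrow> n \<in> carrier N \<Longrightarrow> P (frag_of (a, n))"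
  shows "P p"
  using assms(1) unfolding carrier_free_Abelian_group_iff
  by (rule free_Abelian_group_induct) (use assms in auto)

sublocale F: comm_group F
  by (rule abelian_free_Abelian_group)

lemma H_subgroup: "subgroup H F"
  using relations_carrier by (rule F.generate_is_subgroup)

sublocale H: subgroup H F by (rule H_subgroup)

sublocale H: normal H F
  using H_subgroup by (rule F.subgroup_imp_normal)

lemma H_add: "p \<in> H \<Longrightarrow> q \<in> H \<Longrightarrow> p + q \<in> H"
  using H.m_closed by simp

lemma H_minus: assumes p: "p \<in> H" shows "- p \<in> H"
proof -
  have "Poly_Mapping.keys p \<subseteq> carrier R \<times> carrier N" using H.mem_carrier[OF p] by simp
  then have "inv\<^bsub>F\<^esub> p = - p" by (rule inv_free_Abelian_group)
  then show ?thesis using H.m_inv_closed[OF p] by simp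
qed

lemma coset_eqI:
  assumes "p \<in> carrier F" "q \<in> carrier F" "p - q \<in> H" shows "coset p = coset q"
proof (rule F.repr_independence[symmetric])
  show "p \<in> coset q"
    using assms by (auto simp: r_coset_def intro!: bexI[of _ "p - q"])
qed (use assms H_subgroup in auto)

lemma coset_eqD:
  assumes "p \<in> carrier F" "q \<in> carrier F" "coset p = coset q" shows "p - q \<in> H"
proof -
  have "p \<in> coset q" using F.rcos_self[OF assms(1) H_subgroup] assms(3) by simp
  then show ?thesis by (auto simp: r_coset_def)
qed

lemma act_carrier:
  assumes a: "a \<in> carrier R" and p: "p \<in> carrier F" shows "act a p \<in> carrier F"
proof -
  have "Poly_Mapping.keys p \<subseteq> carrier R \<times> carrier N" using p by simp
  then show ?thesis
    using a keys_frag_extend[of "\<lambda>(b, n). frag_of (a \<otimes>\<^bsub>R\<^esub> b, n)" p] by fastforce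
qed

lemma relation_in_H: "r \<in> tensor_relations R S h N \<Longrightarrow> r \<in> H"
  by (rule generate.incl)

text \<open>
  Left multiplication maps the generators of the relation subgroup to generators, which is why \<open>R\<close>
  acts on the quotient.
\<close>

lemma act_relation:
  assumes a: "a \<in> carrier R" and r: "r \<in> tensor_relations R S h N"
  shows "act a r \<in> tensor_relations R S h N"
proof -
  from r show ?thesis
  proof (cases rule: relation_cases)
    case (left b c n)
    then have "act a r = frag_of (a \<otimes>\<^bsub>R\<^esub> b \<oplus>\<^bsub>R\<^esub> a \<otimes>\<^bsub>R\<^esub> c, n) - frag_of (a \<otimes>\<^bsub>R\<^esub> b, n) - frag_of (a \<otimes>\<^bsub>R\<^esub> c, n)"
      using a by (simp add: frag_extend_diff R.r_distr)
    moreover have "a \<otimes>\<^bsub>R\<^esub> b \<in> carrier R" "a \<otimes>\<^bsub>R\<^esub> c \<in> carrier R" using left a by auto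
    ultimately show ?thesis using left unfolding tensor_relations_def by blast
  next
    case (right b n n')
    then have "act a r = frag_of (a \<otimes>\<^bsub>R\<^esub> b, n \<oplus>\<^bsub>N\<^esub> n') - frag_of (a \<otimes>\<^bsub>R\<^esub> b, n) - frag_of (a \<otimes>\<^bsub>R\<^esub> b, n')"
      by (simp add: frag_extend_diff)
    moreover have "a \<otimes>\<^bsub>R\<^esub> b \<in> carrier R" using right a by auto
    ultimately show ?thesis using right unfolding tensor_relations_def by blast
  next
    case (balanced b s n)
    then have "act a r = frag_of ((a \<otimes>\<^bsub>R\<^esub> b) \<otimes>\<^bsub>R\<^esub> h s, n) - frag_of (a \<otimes>\<^bsub>R\<^esub> b, s \<odot>\<^bsub>N\<^esub> n)"
      using a by (simp add: frag_extend_diff R.m_assoc)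
    moreover have "a \<otimes>\<^bsub>R\<^esub> b \<in> carrier R" using balanced a by auto
    ultimately show ?thesis using balanced unfolding tensor_relations_def by blast
  qed
qed

lemma act_H:
  assumes a: "a \<in> carrier R" and p: "p \<in> H" shows "act a p \<in> H"
  using p
proof (induction p rule: generate.induct)
  case one
  then show ?case using H.one_closed by simp
next
  case (incl r)
  then show ?case using act_relation[OF a] relation_in_H by blast
next
  case (inv r)
  then have "inv\<^bsub>F\<^esub> r = - r"
    using relations_carrier unfolding subset_eq carrier_free_Abelian_group_iff
    by (intro inv_free_Abelian_group) blast
  then show ?case using act_relation[OF a inv] relation_in_H H_minus by (simp add: frag_extend_minus)
next
  case (eng p q)
  then show ?case using H_add by (simp add: frag_extend_add)
qed

lemma Ind_carrier: "carrier Ind = (\<lambda>p. coset p) ` carrier F"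
  by (simp add: induced_module_def Let_def carrier_FactGroup)

lemma Ind_zero: "\<zero>\<^bsub>Ind\<^esub> = coset 0"
  using F.coset_mult_one[OF H.subset] by (simp add: induced_module_def Let_def)

lemma Ind_add:
  assumes "p \<in> carrier F" "q \<in> carrier F"
  shows "(coset p) \<oplus>\<^bsub>Ind\<^esub> (coset q) = coset (p + q)"
  using H.rcos_sum[OF assms] by (simp add: induced_module_def Let_def)

lemma Ind_smult:
  assumes a: "a \<in> carrier R" and p: "p \<in> carrier F"
  shows "a \<odot>\<^bsub>Ind\<^esub> (coset p) = coset (act a p)"
proof -
  have "coset (act a q) = coset (act a p)" if q: "q \<in> coset p" for q
  proof -
    obtain l where l: "l \<in> H" "q = l + p" using q unfolding r_coset_def by auto
    have lc: "l \<in> carrier F" using l(1) H.subset by blast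
    show ?thesis
      using a p l lc act_H[OF a l(1)] act_carrier[OF a p] act_carrier[OF a lc] F.m_closed
      by (intro coset_eqI) (auto simp: frag_extend_add simp del: carrier_free_Abelian_group_iff)
  qed
  moreover have "p \<in> coset p" using p H_subgroup by (rule F.rcos_self)
  ultimately have "(\<lambda>q. coset (act a q)) ` (coset p) = {coset (act a p)}" by blast
  then show ?thesis by (simp add: induced_module_def Let_def)
qed

lemma act_one: 
  assumes "p \<in> carrier F" shows "act \<one>\<^bsub>R\<^esub> p = p"
using assms by (induction p rule: F_induct) (auto simp: frag_extend_diff)

lemma act_mult: 
  assumes "p \<in> carrier F" "a \<in> carrier R" "b \<in> carrier R" shows "act (a \<otimes>\<^bsub>R\<^esub> b) p = act a (act b p)"
using assms by (induction p rule: F_induct) (auto simp: frag_extend_diff R.m_assoc)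

lemma act_add: 
  assumes "p \<in> carrier F" "a \<in> carrier R" "b \<in> carrier R"
  shows "act (a \<oplus>\<^bsub>R\<^esub> b) p - (act a p + act b p) \<in> H"
proof -
  show ?thesis
    using assms(1)
  proof (induction p rule: F_induct)
    case zero
    then show ?case using H.one_closed by simp
  next
    case (diff p q)
    have "act (a \<oplus>\<^bsub>R\<^esub> b) (p - q) - (act a (p - q) + act b (p - q)) =
       (act (a \<oplus>\<^bsub>R\<^esub> b) p - (act a p + act b p)) + - (act (a \<oplus>\<^bsub>R\<^esub> b) q - (act a q + act b q))"
      by (simp add: frag_extend_diff)
    then show ?case using H_add[OF diff(3) H_minus[OF diff(4)]] by simp
  next
    case x: (pair c n)
    have "frag_of (a \<otimes>\<^bsub>R\<^esub> c \<oplus>\<^bsub>R\<^esub> b \<otimes>\<^bsub>R\<^esub> c, n) - frag_of (a \<otimes>\<^bsub>R\<^esub> c, n) - frag_of (b \<otimes>\<^bsub>R\<^esub> c, n)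
        \<in> tensor_relations R S h N"
      using assms x R.m_closed unfolding tensor_relations_def by blast
    then show ?case
      using assms x relation_in_H by (simp add: R.l_distr diff_diff_eq)
  qed
qed

lemma left_module_Ind: "left_module R Ind"
proof -
  note [simp del] = carrier_free_Abelian_group_iff
  have F0: "0 \<in> carrier F" using F.one_closed by simp
  have F_add: "p + q \<in> carrier F" if "p \<in> carrier F" "q \<in> carrier F" for p q
    using F.m_closed[OF that] by simp
  have F_minus: "- p \<in> carrier F" if "p \<in> carrier F" for p
    using that by (simp add: carrier_free_Abelian_group_iff)
  note closed = F0 F_add F_minus act_carrier
  have "abelian_group Ind"
  proof (rule abelian_groupI, goal_cases)
    case (6 C)
    then obtain p where "p \<in> carrier F" "C = coset p" by (auto simp: Ind_carrier)
    then show ?case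
      by (intro bexI[of _ "coset (- p)"]) (auto simp: Ind_carrier Ind_zero Ind_add closed)
  qed (auto simp: Ind_carrier Ind_zero Ind_add closed algebra_simps)
  moreover have "left_module_axioms R Ind"
    unfolding left_module_axioms_def
  proof (intro conjI allI impI, goal_cases)
    case (2 a b C)
    then obtain p where p: "p \<in> carrier F" "C = coset p" by (auto simp: Ind_carrier)
    then show ?case
      using 2 act_add[OF p(1) 2(1,2)] by (simp add: Ind_smult Ind_add closed) (intro coset_eqI, auto simp: closed)
  qed (auto simp: Ind_carrier Ind_smult Ind_add closed act_mult act_one frag_extend_add)
  ultimately show ?thesis by (simp add: left_module_def R.ring_axioms)
qed

lemma tensor_closed: "a \<in> carrier R \<Longrightarrow> n \<in> carrier N \<Longrightarrow> tensor a n \<in> carrier Ind"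
  unfolding tensor_def Ind_carrier by simp

lemma tensor_balanced:
  assumes "a \<in> carrier R" "s \<in> carrier S" "n \<in> carrier N"
  shows "tensor (a \<otimes>\<^bsub>R\<^esub> h s) n = tensor a (s \<odot>\<^bsub>N\<^esub> n)"
proof -
  have "frag_of (a \<otimes>\<^bsub>R\<^esub> h s, n) - frag_of (a, s \<odot>\<^bsub>N\<^esub> n) \<in> tensor_relations R S h N"
    using assms unfolding tensor_relations_def by blast
  then show ?thesis
    unfolding tensor_def using assms by (intro coset_eqI relation_in_H) (auto intro: N.smult_closed)
qed

lemma tensor_smult:
  assumes "a \<in> carrier R" "b \<in> carrier R" "n \<in> carrier N"
  shows "a \<odot>\<^bsub>Ind\<^esub> tensor b n = tensor (a \<otimes>\<^bsub>R\<^esub> b) n"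
  using assms unfolding tensor_def by (subst Ind_smult) auto

text \<open>
  Balancing moves the coefficient of \<open>n = s n\<^sub>0\<close> to the left factor: \<open>a \<otimes> s n\<^sub>0 = (a h(s)) \<otimes> n\<^sub>0\<close>.
\<close>

lemma cyclic_Ind:
  assumes n0: "n0 \<in> carrier N" and cyclic: "\<And>n. n \<in> carrier N \<Longrightarrow> \<exists>s\<in>carrier S. n = s \<odot>\<^bsub>N\<^esub> n0"
    and C: "C \<in> carrier Ind"
  shows "\<exists>a\<in>carrier R. C = a \<odot>\<^bsub>Ind\<^esub> tensor \<one>\<^bsub>R\<^esub> n0"
proof -
  interpret I: left_module R Ind by (rule left_module_Ind)
  have t: "tensor \<one>\<^bsub>R\<^esub> n0 \<in> carrier Ind" using n0 by (simp add: tensor_closed)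
  obtain p where p: "p \<in> carrier F" "C = coset p" using C by (auto simp: Ind_carrier)
  from p(1) have "\<exists>a\<in>carrier R. coset p = a \<odot>\<^bsub>Ind\<^esub> tensor \<one>\<^bsub>R\<^esub> n0"
  proof (induction p rule: F_induct)
    case zero
    then show ?case using t I.smult_l_zero by (auto simp: Ind_zero intro!: bexI[of _ "\<zero>\<^bsub>R\<^esub>"])
  next
    case (diff p q)
    then obtain a b where ab: "a \<in> carrier R" "b \<in> carrier R"
      "coset p = a \<odot>\<^bsub>Ind\<^esub> tensor \<one>\<^bsub>R\<^esub> n0" "coset q = b \<odot>\<^bsub>Ind\<^esub> tensor \<one>\<^bsub>R\<^esub> n0"
      by blast
    have pq: "p - q \<in> carrier F" using diff keys_diff[of p q] by auto
    have "(coset (p - q)) \<oplus>\<^bsub>Ind\<^esub> (coset q) = coset p"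
      using diff pq by (subst Ind_add) auto
    moreover have "coset (p - q) \<in> carrier Ind" "coset q \<in> carrier Ind" "coset p \<in> carrier Ind"
      using diff pq by (auto simp: Ind_carrier)
    ultimately have "coset (p - q) = (coset p) \<ominus>\<^bsub>Ind\<^esub> (coset q)"
      by (metis I.M.a_assoc I.M.minus_eq I.M.r_neg I.M.r_zero I.M.a_inv_closed)
    also have "\<dots> = (a \<ominus>\<^bsub>R\<^esub> b) \<odot>\<^bsub>Ind\<^esub> tensor \<one>\<^bsub>R\<^esub> n0"
      using ab t by (simp add: I.M.minus_eq R.minus_eq I.smult_l_distr I.smult_l_minus)
    finally show ?case using ab by blast
  next
    case x: (pair a n)
    obtain s where s: "s \<in> carrier S" "n = s \<odot>\<^bsub>N\<^esub> n0" using cyclic[OF x(2)] by blast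
    have "coset (frag_of (a, n)) = tensor a n" by (simp add: tensor_def)
    also have "\<dots> = (a \<otimes>\<^bsub>R\<^esub> h s) \<odot>\<^bsub>Ind\<^esub> tensor \<one>\<^bsub>R\<^esub> n0"
      using s x n0 by (simp add: tensor_balanced tensor_smult)
    finally show ?case using s x by (intro bexI[of _ "a \<otimes>\<^bsub>R\<^esub> h s"]) simp_all
  qed
  then show ?thesis using p by simp
qed

text \<open>
  The universal property of \<open>R \<otimes>\<^bsub>S\<^esub> N\<close>: a map that is linear over \<open>S\<close> extends, because the additive map
  with \<open>(a, n) \<mapsto> a \<phi>(n)\<close> on the free abelian group kills the three families of relations.
\<close>

lemma induced_hom:
  assumes P: "left_module R P" and \<phi>: "\<phi> \<in> carrier N \<rightarrow> carrier P"
    and add: "\<And>n n'. n \<in> carrier N \<Longrightarrow> n' \<in> carrier N \<Longrightarrow> \<phi> (n \<oplus>\<^bsub>N\<^esub> n') = \<phi> n \<oplus>\<^bsub>P\<^esub> \<phi> n'"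
    and smult: "\<And>s n. s \<in> carrier S \<Longrightarrow> n \<in> carrier N \<Longrightarrow> \<phi> (s \<odot>\<^bsub>N\<^esub> n) = h s \<odot>\<^bsub>P\<^esub> \<phi> n"
  obtains \<Phi> where "\<Phi> \<in> left_module_hom R Ind P"
    "\<And>a n. a \<in> carrier R \<Longrightarrow> n \<in> carrier N \<Longrightarrow> \<Phi> (tensor a n) = a \<odot>\<^bsub>P\<^esub> \<phi> n"
proof -
  interpret P: left_module R P by (rule P)
  have \<phi>c [simp]: "\<phi> n \<in> carrier P" if "n \<in> carrier N" for n using \<phi> that by blast
  obtain g where g: "g \<in> hom F (add_monoid P)"
    and g_of: "\<And>x. x \<in> carrier R \<times> carrier N \<Longrightarrow> g (frag_of x) = (\<lambda>(a, n). a \<odot>\<^bsub>P\<^esub> \<phi> n) x"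
  proof (rule comm_group.free_Abelian_group_universal[OF P.M.a_comm_group])
    show "(\<lambda>(a, n). a \<odot>\<^bsub>P\<^esub> \<phi> n) ` (carrier R \<times> carrier N) \<subseteq> carrier (add_monoid P)"
      by (auto intro: P.smult_closed)
  qed auto
  interpret g: group_hom F "add_monoid P" g
    using g by (simp add: group_hom_def group_hom_axioms_def P.M.a_group)
  have gc: "g p \<in> carrier P" if "p \<in> carrier F" for p using g.hom_closed[OF that] by simp
  have g_add: "g (p + q) = g p \<oplus>\<^bsub>P\<^esub> g q" if "p \<in> carrier F" "q \<in> carrier F" for p q
    using g.hom_mult[OF that] by simp
  have g_diff: "g (p - q) = g p \<ominus>\<^bsub>P\<^esub> g q" if "p \<in> carrier F" "q \<in> carrier F" for p q
  proof -
    have "p - q \<in> carrier F" using that keys_diff[of p q] by auto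
    then have "g (p - q) \<oplus>\<^bsub>P\<^esub> g q = g p" using g_add[of "p - q" q] that by simp
    then show ?thesis using gc that \<open>p - q \<in> carrier F\<close>
      by (metis P.M.a_assoc P.M.minus_eq P.M.r_neg P.M.r_zero P.M.a_inv_closed)
  qed
  have "tensor_relations R S h N \<subseteq> kernel F (add_monoid P) g"
  proof
    fix r assume r: "r \<in> tensor_relations R S h N"
    have fo: "frag_of (a, n) \<in> carrier F" if "a \<in> carrier R" "n \<in> carrier N" for a n
      using that by simp
    have fd: "p - q \<in> carrier F" if "p \<in> carrier F" "q \<in> carrier F" for p q
      using that keys_diff[of p q] by auto
    note closed = fo fd N.smult_closed P.smult_closed
    from r have "g r = \<zero>\<^bsub>P\<^esub>"
    proof (cases rule: relation_cases)
      case (left a b n)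
      then have "g r = a \<odot>\<^bsub>P\<^esub> \<phi> n \<oplus>\<^bsub>P\<^esub> b \<odot>\<^bsub>P\<^esub> \<phi> n \<ominus>\<^bsub>P\<^esub> a \<odot>\<^bsub>P\<^esub> \<phi> n \<ominus>\<^bsub>P\<^esub> b \<odot>\<^bsub>P\<^esub> \<phi> n"
        by (simp add: g_diff closed g_of P.smult_l_distr
            del: carrier_free_Abelian_group_iff frag_of_in_free_Abelian_group)
      then show ?thesis using left by (simp add: P.M.add_minus_minus closed)
    next
      case (right a n n')
      then have "g r = a \<odot>\<^bsub>P\<^esub> \<phi> n \<oplus>\<^bsub>P\<^esub> a \<odot>\<^bsub>P\<^esub> \<phi> n' \<ominus>\<^bsub>P\<^esub> a \<odot>\<^bsub>P\<^esub> \<phi> n \<ominus>\<^bsub>P\<^esub> a \<odot>\<^bsub>P\<^esub> \<phi> n'"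
        by (simp add: g_diff closed g_of add P.smult_r_distr
            del: carrier_free_Abelian_group_iff frag_of_in_free_Abelian_group)
      then show ?thesis using right by (simp add: P.M.add_minus_minus closed)
    next
      case (balanced a s n)
      then have "g r = a \<odot>\<^bsub>P\<^esub> (h s \<odot>\<^bsub>P\<^esub> \<phi> n) \<ominus>\<^bsub>P\<^esub> a \<odot>\<^bsub>P\<^esub> (h s \<odot>\<^bsub>P\<^esub> \<phi> n)"
        by (simp add: g_diff closed g_of smult P.smult_assoc1
            del: carrier_free_Abelian_group_iff frag_of_in_free_Abelian_group)
      then show ?thesis using balanced by (simp add: closed P.M.minus_eq P.M.r_neg)
    qed
    then show "r \<in> kernel F (add_monoid P) g"
      using subsetD[OF relations_carrier r] by (simp add: kernel_def)
  qed
  then have "H \<subseteq> kernel F (add_monoid P) g"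
    by (rule F.generate_subgroup_incl) (rule g.subgroup_kernel)
  then have gH: "g p = \<zero>\<^bsub>P\<^esub>" if "p \<in> H" for p using that by (auto simp: kernel_def)
  obtain \<Phi> where \<Phi>: "\<Phi> \<in> hom (F Mod H) (add_monoid P)"
    and \<Phi>_coset: "\<And>p. p \<in> carrier F \<Longrightarrow> \<Phi> (coset p) = g p"
  proof (rule FactGroup_universal[OF g H.normal_axioms])
    fix p q assume pq: "p \<in> carrier F" "q \<in> carrier F" "coset p = coset q"
    have "g (p - q) = \<zero>\<^bsub>P\<^esub>" using coset_eqD[OF pq] by (rule gH)
    then have "g p \<ominus>\<^bsub>P\<^esub> g q = \<zero>\<^bsub>P\<^esub>" using g_diff[OF pq(1,2)] by simp
    then show "g p = g q" using gc[OF pq(1)] gc[OF pq(2)] by (rule P.M.minus_eq_zeroD)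
  qed auto
  have g_act: "g (act a p) = a \<odot>\<^bsub>P\<^esub> g p" if a: "a \<in> carrier R" and p: "p \<in> carrier F" for a p
  proof -
    show ?thesis
      using p
    proof (induction p rule: F_induct)
      case zero
      then show ?case using a g.hom_one by (simp add: P.smult_r_zero)
    next
      case (diff p q)
      then show ?case
        using a gc act_carrier[OF a, of p] act_carrier[OF a, of q]
        by (simp add: frag_extend_diff g_diff P.M.minus_eq P.smult_r_distr P.smult_r_minus)
    next
      case (pair b n)
      then show ?case using a g_of by (auto simp: P.smult_assoc1)
    qed
  qed
  have "\<Phi> \<in> left_module_hom R Ind P"
    unfolding left_module_hom_def
    using act_carrier F.m_closed
    by (auto simp: Ind_carrier \<Phi>_coset gc Ind_add g_add Ind_smult g_act
       simp del: carrier_free_Abelian_group_iff)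
  moreover have "\<Phi> (tensor a n) = a \<odot>\<^bsub>P\<^esub> \<phi> n" if "a \<in> carrier R" "n \<in> carrier N" for a n
    using that g_of by (simp add: tensor_def \<Phi>_coset)
  ultimately show thesis by (rule that)
qed

end

section \<open>Presented algebras and enveloping algebras\<close>

lemma carrier_free_algebra: "p \<in> carrier (free_algebra B) \<longleftrightarrow> Poly_Mapping.keys p \<subseteq> lists B"
  by (simp add: free_algebra_def)

lemma free_algebra_ops:
  "monoid.mult (free_algebra B) = (*)" "ring.add (free_algebra B) = (+)"
  "\<one>\<^bsub>free_algebra B\<^esub> = 1" "\<zero>\<^bsub>free_algebra B\<^esub> = 0"
  by (simp_all add: free_algebra_def)

lemma free_algebra_closed:
  "fconst c \<in> carrier (free_algebra B)" "g \<in> B \<Longrightarrow> fgen g \<in> carrier (free_algebra B)"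
  "p \<in> carrier (free_algebra B) \<Longrightarrow> q \<in> carrier (free_algebra B) \<Longrightarrow> p + q \<in> carrier (free_algebra B)"
  "p \<in> carrier (free_algebra B) \<Longrightarrow> q \<in> carrier (free_algebra B) \<Longrightarrow> p - q \<in> carrier (free_algebra B)"
  "p \<in> carrier (free_algebra B) \<Longrightarrow> q \<in> carrier (free_algebra B) \<Longrightarrow> p * q \<in> carrier (free_algebra B)"
  using keys_add[of p q] keys_diff[of p q] keys_mult_lists[of p B q]
  by (auto simp: carrier_free_algebra)

lemma fconst_mult: "fconst c * Poly_Mapping.single w d = Poly_Mapping.single w (c * d)"
  "Poly_Mapping.single w d * fconst c = Poly_Mapping.single w (d * c)"
  by (simp_all add: mult_single plus_list_def)

text \<open>
  Words are built one letter at a time on the left, so closure under left multiplication by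
  generators is enough.
\<close>

lemma free_algebra_induct [consumes 1, case_names const add gen]:
  assumes "p \<in> carrier (free_algebra B)" and const: "\<And>c. P (fconst c)"
    and add: "\<And>p q. p \<in> carrier (free_algebra B) \<Longrightarrow> q \<in> carrier (free_algebra B) \<Longrightarrow>
      P p \<Longrightarrow> P q \<Longrightarrow> P (p + q)"
    and gen: "\<And>g p. g \<in> B \<Longrightarrow> p \<in> carrier (free_algebra B) \<Longrightarrow> P p \<Longrightarrow> P (fgen g * p)"
  shows "P p"
proof -
  have word: "P (Poly_Mapping.single w c)" if "w \<in> lists B" for w c
    using that
  proof (induction w)
    case Nil
    then show ?case by (rule const)
  next
    case (Cons g w)
    have "fgen g * Poly_Mapping.single w c = Poly_Mapping.single (g # w) c"
      by (simp add: mult_single plus_list_def)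
    moreover have "P (fgen g * Poly_Mapping.single w c)"
      using Cons by (intro gen) (auto simp: carrier_free_algebra)
    ultimately show ?case by simp
  qed
  have "Poly_Mapping.keys p \<subseteq> lists B" using assms(1) by (simp add: carrier_free_algebra)
  then show ?thesis
  proof (induction p rule: update_induct)
    case const
    then show ?case using word[of "[]" 0] by simp
  next
    case (update f a b)
    have eq: "Poly_Mapping.update a b f = f + Poly_Mapping.single a b"
      using update.hyps by (intro poly_mapping_eqI)
        (auto simp: lookup_update lookup_add lookup_single in_keys_iff when_def)
    have k: "Poly_Mapping.keys f \<subseteq> lists B" "a \<in> lists B"
      using update by (auto simp: keys_update simp del: in_lists_conv_set)
    then show ?case unfolding eq
      using update.IH k word[of a b]
      by (intro add) (auto simp: carrier_free_algebra simp del: in_lists_conv_set)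
  qed
qed

lemma free_algebra_hom_diff:
  assumes h: "h \<in> ring_hom (free_algebra B) S" and "ring S"
    and p: "p \<in> carrier (free_algebra B)" "q \<in> carrier (free_algebra B)"
  shows "h (p - q) = h p \<ominus>\<^bsub>S\<^esub> h q"
proof -
  interpret S: ring S by fact
  note pq = free_algebra_closed(4)[OF p]
  have c: "h p \<in> carrier S" "h q \<in> carrier S" "h (p - q) \<in> carrier S"
    using h p pq by (auto intro: ring_hom_closed)
  have "h p = h ((p - q) \<oplus>\<^bsub>free_algebra B\<^esub> q)" by (simp add: free_algebra_ops)
  also have "\<dots> = h (p - q) \<oplus>\<^bsub>S\<^esub> h q" by (rule ring_hom_add[OF h pq p(2)])
  finally have "h p \<ominus>\<^bsub>S\<^esub> h q = (h (p - q) \<oplus>\<^bsub>S\<^esub> h q) \<ominus>\<^bsub>S\<^esub> h q" by simp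
  also have "\<dots> = h (p - q)" using c by (simp add: S.minus_eq S.a_assoc S.r_neg)
  finally show ?thesis by simp
qed

locale presentation =
  fixes B :: "'x set" and rels :: "('x list \<Rightarrow>\<^sub>0 'k::field) set"
  assumes rels_closed: "rels \<subseteq> carrier (free_algebra B)"
begin

abbreviation "FB \<equiv> carrier (free_algebra B :: ('x list \<Rightarrow>\<^sub>0 'k) ring)"
abbreviation "A \<equiv> presented_algebra B rels"
abbreviation "cls \<equiv> presented_class B rels"

sublocale F: ring "free_algebra B :: ('x list \<Rightarrow>\<^sub>0 'k) ring" by (rule ring_free_algebra)

lemma rels_ideal: "ideal (Idl\<^bsub>free_algebra B\<^esub> rels) (free_algebra B)"
  by (rule F.genideal_ideal[OF rels_closed])

sublocale A: ring "A" unfolding presented_algebra_def by (rule ideal.quotient_is_ring[OF rels_ideal])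

lemma cls_hom: "cls \<in> ring_hom (free_algebra B) A"
  using ideal.rcos_ring_hom[OF rels_ideal] unfolding presented_algebra_def presented_class_def[abs_def] .

lemma cls_closed: "p \<in> FB \<Longrightarrow> cls p \<in> carrier A"
  by (rule ring_hom_closed[OF cls_hom])

lemma cls_add: "p \<in> FB \<Longrightarrow> q \<in> FB \<Longrightarrow> cls (p + q) = cls p \<oplus>\<^bsub>A\<^esub> cls q"
  using ring_hom_add[OF cls_hom] by (simp add: free_algebra_ops)

lemma cls_mult: "p \<in> FB \<Longrightarrow> q \<in> FB \<Longrightarrow> cls (p * q) = cls p \<otimes>\<^bsub>A\<^esub> cls q"
  using ring_hom_mult[OF cls_hom] by (simp add: free_algebra_ops)

lemma cls_one: "cls 1 = \<one>\<^bsub>A\<^esub>"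
  using ring_hom_one[OF cls_hom] by (simp add: free_algebra_ops)

lemma carrier_A: "carrier A = cls ` FB"
  unfolding presented_algebra_def presented_class_def FactRing_def partial_object.simps A_RCOSETS_def' by blast

lemma cls_eqI:
  assumes p: "p \<in> FB" "q \<in> FB"
    and "p - q \<in> Idl\<^bsub>free_algebra B\<^esub> rels"
  shows "cls p = cls q"
proof -
  interpret I: ideal "Idl\<^bsub>free_algebra B\<^esub> rels" "free_algebra B" by (rule rels_ideal)
  have "p \<in> Idl\<^bsub>free_algebra B\<^esub> rels +>\<^bsub>free_algebra B\<^esub> q"
    using assms(3) unfolding a_r_coset_def' by (auto simp: free_algebra_ops intro!: bexI[of _ "p - q"])
  then show ?thesis unfolding presented_class_def
    by (rule I.a_repr_independence'[symmetric]) (rule p(2))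
qed

lemma rels_in_ideal: "r \<in> rels \<Longrightarrow> r \<in> Idl\<^bsub>free_algebra B\<^esub> rels"
  using F.genideal_self[OF rels_closed] by blast

text \<open>
  All statements about the action of a presented algebra are reduced by this rule to constants and
  generators.
\<close>

lemma A_induct [consumes 1, case_names const add gen]:
  assumes "u \<in> carrier A" and const: "\<And>c. P (cls (fconst c))"
    and add: "\<And>u v. u \<in> carrier A \<Longrightarrow> v \<in> carrier A \<Longrightarrow> P u \<Longrightarrow> P v \<Longrightarrow> P (u \<oplus>\<^bsub>A\<^esub> v)"
    and gen: "\<And>g u. g \<in> B \<Longrightarrow> u \<in> carrier A \<Longrightarrow> P u \<Longrightarrow> P (cls (fgen g) \<otimes>\<^bsub>A\<^esub> u)"
  shows "P u"
proof -
  obtain p where p: "p \<in> FB" "u = cls p" using assms(1) carrier_A by blast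
  from p(1) have "P (cls p)"
    by (induction p rule: free_algebra_induct)
       (auto simp: cls_add cls_mult free_algebra_closed cls_closed const add gen)
  then show ?thesis using p(2) by simp
qed

lemma const_hom: "(\<lambda>c. cls (fconst c)) \<in> ring_hom ring_of_type_algebra A"
proof (rule ring_hom_memI)
  fix c d
  show "cls (fconst (c \<otimes>\<^bsub>ring_of_type_algebra\<^esub> d)) = cls (fconst c) \<otimes>\<^bsub>A\<^esub> cls (fconst d)"
    by (simp add: cls_mult[symmetric] free_algebra_closed fconst_mult ring_of_type_algebra_def)
  show "cls (fconst (c \<oplus>\<^bsub>ring_of_type_algebra\<^esub> d)) = cls (fconst c) \<oplus>\<^bsub>A\<^esub> cls (fconst d)"
    by (simp add: cls_add[symmetric] free_algebra_closed single_add ring_of_type_algebra_def)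
next
  show "cls (fconst \<one>\<^bsub>ring_of_type_algebra\<^esub>) = \<one>\<^bsub>A\<^esub>"
    using cls_one by (simp only: one_eq_fconst ring_of_type_algebra_def monoid.simps)
qed (auto intro: cls_closed free_algebra_closed)

lemma const_central:
  "g \<in> B \<Longrightarrow> cls (fconst c) \<otimes>\<^bsub>A\<^esub> cls (fgen g) = cls (fgen g) \<otimes>\<^bsub>A\<^esub> cls (fconst c)"
  by (simp add: cls_mult[symmetric] free_algebra_closed fconst_mult mult.commute)

lemma submodule_presentedI:
  assumes "left_module A M" "H \<subseteq> carrier M" "H \<noteq> {}"
    and add: "\<And>m n. m \<in> H \<Longrightarrow> n \<in> H \<Longrightarrow> m \<oplus>\<^bsub>M\<^esub> n \<in> H"
    and const: "\<And>c m. m \<in> H \<Longrightarrow> cls (fconst c) \<odot>\<^bsub>M\<^esub> m \<in> H"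
    and gen: "\<And>g m. g \<in> B \<Longrightarrow> m \<in> H \<Longrightarrow> cls (fgen g) \<odot>\<^bsub>M\<^esub> m \<in> H"
  shows "submodule H A M"
proof -
  interpret M: left_module A M by fact
  show ?thesis
  proof (rule M.submoduleI)
    fix u m assume u: "u \<in> carrier A" and m: "m \<in> H"
    have mc: "m \<in> carrier M" using m assms by blast
    from u show "u \<odot>\<^bsub>M\<^esub> m \<in> H"
      by (induction u rule: A_induct)
         (simp_all add: const m M.smult_l_distr mc M.smult_assoc1 add gen cls_closed free_algebra_closed)
  qed (use assms in auto)
qed

lemma hom_presentedI:
  assumes M: "left_module A M" and N: "left_module A N" and f: "f \<in> carrier M \<rightarrow> carrier N"
    and add: "\<And>m n. m \<in> carrier M \<Longrightarrow> n \<in> carrier M \<Longrightarrow> f (m \<oplus>\<^bsub>M\<^esub> n) = f m \<oplus>\<^bsub>N\<^esub> f n"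
    and const: "\<And>c m. m \<in> carrier M \<Longrightarrow> f (cls (fconst c) \<odot>\<^bsub>M\<^esub> m) = cls (fconst c) \<odot>\<^bsub>N\<^esub> f m"
    and gen: "\<And>g m. g \<in> B \<Longrightarrow> m \<in> carrier M \<Longrightarrow> f (cls (fgen g) \<odot>\<^bsub>M\<^esub> m) = cls (fgen g) \<odot>\<^bsub>N\<^esub> f m"
  shows "f \<in> left_module_hom A M N"
proof -
  interpret M: left_module A M by fact
  interpret N: left_module A N by fact
  have fc: "f m \<in> carrier N" if "m \<in> carrier M" for m using f that by blast
  have "f (u \<odot>\<^bsub>M\<^esub> m) = u \<odot>\<^bsub>N\<^esub> f m" if u: "u \<in> carrier A" and m: "m \<in> carrier M" for u m
    using u
    by (induction u rule: A_induct)
       (simp_all add: const gen m fc add M.smult_l_distr N.smult_l_distr M.smult_assoc1 N.smult_assoc1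
         M.smult_closed cls_closed free_algebra_closed)
  then show ?thesis using f add by (auto simp: left_module_hom_def)
qed

end

locale enveloping =
  fixes scl :: "'k::field \<Rightarrow> 'l::ab_group_add \<Rightarrow> 'l" and br :: "'l \<Rightarrow> 'l \<Rightarrow> 'l" and L :: "'l set"
  assumes L_add: "f \<in> L \<Longrightarrow> g \<in> L \<Longrightarrow> f + g \<in> L"
    and L_scl: "f \<in> L \<Longrightarrow> scl c f \<in> L"
    and L_br: "f \<in> L \<Longrightarrow> g \<in> L \<Longrightarrow> br f g \<in> L"
begin

sublocale presentation L "env_relations scl br L :: ('l list \<Rightarrow>\<^sub>0 'k) set"
  by unfold_locales
     (auto simp: env_relations_def intro!: free_algebra_closed L_add L_scl L_br)

lemma cls_gen_add:
  assumes "f \<in> L" "g \<in> L" shows "cls (fgen (f + g)) = cls (fgen f) \<oplus>\<^bsub>A\<^esub> cls (fgen g)"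
proof -
  have "fgen (f + g) - fgen f - fgen g \<in> env_relations scl br L"
    using assms by (auto simp: env_relations_def)
  then have "cls (fgen (f + g)) = cls (fgen f + fgen g)"
    using assms by (intro cls_eqI free_algebra_closed L_add) (auto dest: rels_in_ideal simp: diff_diff_eq)
  then show ?thesis using assms by (simp add: cls_add free_algebra_closed)
qed

lemma cls_gen_scl:
  assumes "f \<in> L" shows "cls (fgen (scl c f)) = cls (fconst c) \<otimes>\<^bsub>A\<^esub> cls (fgen f)"
proof -
  have "fgen (scl c f) - fconst c * fgen f \<in> env_relations scl br L"
    using assms by (auto simp: env_relations_def)
  then have "cls (fgen (scl c f)) = cls (fconst c * fgen f)"
    using assms by (intro cls_eqI free_algebra_closed L_scl) (auto dest: rels_in_ideal)
  then show ?thesis using assms by (simp add: cls_mult free_algebra_closed)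
qed

lemma cls_gen_br:
  assumes "f \<in> L" "g \<in> L"
  shows "cls (fgen f) \<otimes>\<^bsub>A\<^esub> cls (fgen g) = cls (fgen g) \<otimes>\<^bsub>A\<^esub> cls (fgen f) \<oplus>\<^bsub>A\<^esub> cls (fgen (br f g))"
proof -
  have "fgen f * fgen g - fgen g * fgen f - fgen (br f g) \<in> env_relations scl br L"
    using assms by (auto simp: env_relations_def)
  then have "cls (fgen f * fgen g) = cls (fgen g * fgen f + fgen (br f g))"
    using assms by (intro cls_eqI free_algebra_closed L_br) (auto dest: rels_in_ideal simp: diff_diff_eq)
  then show ?thesis using assms by (simp add: cls_mult cls_add free_algebra_closed L_br)
qed

text \<open>
  The universal property of the enveloping algebra of \<open>L\<close>.
\<close>

lemma env_lift:
  fixes S :: "'s ring" and \<eta> :: "'k \<Rightarrow> 's"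
  assumes S: "ring S" and \<eta>: "\<eta> \<in> ring_hom ring_of_type_algebra S"
    and central: "\<And>c g. g \<in> L \<Longrightarrow> \<eta> c \<otimes>\<^bsub>S\<^esub> \<phi> g = \<phi> g \<otimes>\<^bsub>S\<^esub> \<eta> c"
    and \<phi>: "\<And>g. g \<in> L \<Longrightarrow> \<phi> g \<in> carrier S"
    and add: "\<And>f g. f \<in> L \<Longrightarrow> g \<in> L \<Longrightarrow> \<phi> (f + g) = \<phi> f \<oplus>\<^bsub>S\<^esub> \<phi> g"
    and scl: "\<And>c f. f \<in> L \<Longrightarrow> \<phi> (scl c f) = \<eta> c \<otimes>\<^bsub>S\<^esub> \<phi> f"
    and br: "\<And>f g. f \<in> L \<Longrightarrow> g \<in> L \<Longrightarrow> \<phi> f \<otimes>\<^bsub>S\<^esub> \<phi> g = \<phi> g \<otimes>\<^bsub>S\<^esub> \<phi> f \<oplus>\<^bsub>S\<^esub> \<phi> (br f g)"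
  shows env_lift_hom: "presented_lift S \<eta> \<phi> \<in> ring_hom A S"
    and env_lift_const: "presented_lift S \<eta> \<phi> (cls (fconst c)) = \<eta> c"
    and env_lift_gen: "f \<in> L \<Longrightarrow> presented_lift S \<eta> \<phi> (cls (fgen f)) = \<phi> f"
proof -
  interpret S: ring S by (rule S)
  note fl = free_lift_hom[OF S \<eta> central \<phi>]
  note diff = free_algebra_hom_diff[OF fl(1) S]
  have mult: "free_lift S \<eta> \<phi> (p * q) = free_lift S \<eta> \<phi> p \<otimes>\<^bsub>S\<^esub> free_lift S \<eta> \<phi> q"
    if "p \<in> carrier (free_algebra L)" "q \<in> carrier (free_algebra L)" for p q
    using ring_hom_mult[OF fl(1) that] by (simp add: free_algebra_ops)
  have \<eta>c: "\<eta> c \<in> carrier S" for c using \<eta> by (auto simp: ring_hom_def ring_of_type_algebra_def)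
  have kill: "free_lift S \<eta> \<phi> r = \<zero>\<^bsub>S\<^esub>" if "r \<in> env_relations scl br L" for r
    using that unfolding env_relations_def
  proof (elim UnE CollectE exE conjE)
    fix f g assume r: "r = fgen (f + g) - fgen f - fgen g" "f \<in> L" "g \<in> L"
    then show ?thesis by (simp add: diff free_algebra_closed L_add fl(3) add S.add_minus_minus \<phi>)
  next
    fix c f assume r: "r = fgen (scl c f) - fconst c * fgen f" "f \<in> L"
    then show ?thesis
      by (simp add: diff mult free_algebra_closed L_scl fl(2,3) scl \<phi> \<eta>c S.minus_eq S.r_neg)
  next
    fix f g assume r: "r = fgen f * fgen g - fgen g * fgen f - fgen (br f g)" "f \<in> L" "g \<in> L"
    then show ?thesis
      by (simp add: diff mult free_algebra_closed L_br fl(3) \<phi> br[OF r(2,3)] S.add_minus_minus)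
  qed
  note pl = presented_lift_hom[OF S \<eta> central \<phi> rels_closed kill]
  show "presented_lift S \<eta> \<phi> \<in> ring_hom A S" by (rule pl(1))
  show "presented_lift S \<eta> \<phi> (cls (fconst c)) = \<eta> c"
    by (simp add: pl(2) free_algebra_closed fl(2))
  show "presented_lift S \<eta> \<phi> (cls (fgen f)) = \<phi> f" if "f \<in> L"
    using that by (simp add: pl(2) free_algebra_closed fl(3))
qed

end

section \<open>Laurent polynomials\<close>

abbreviation lmonom :: "'k::field \<Rightarrow> int \<Rightarrow> 'k fls" where
  "lmonom c n \<equiv> fls_shift (-n) (fls_const c)"

lemma laurent_add: "f \<in> laurent_polys \<Longrightarrow> g \<in> laurent_polys \<Longrightarrow> f + g \<in> laurent_polys"
  unfolding laurent_polys_def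
  by (auto intro: finite_subset[of _ "{n. f $$ n \<noteq> 0} \<union> {n. g $$ n \<noteq> 0}"])

lemma laurent_uminus: "f \<in> laurent_polys \<Longrightarrow> - f \<in> laurent_polys"
  unfolding laurent_polys_def by simp

lemma laurent_diff: "f \<in> laurent_polys \<Longrightarrow> g \<in> laurent_polys \<Longrightarrow> f - g \<in> laurent_polys"
  using laurent_add[OF _ laurent_uminus] by fastforce

lemma laurent_lmonom: "lmonom c n \<in> laurent_polys"
  unfolding laurent_polys_def by (auto intro: finite_subset[of _ "{n}"])

lemma laurent_const: "fls_const c \<in> laurent_polys"
  using laurent_lmonom[where c=c and n=0] by simp

lemma laurent_0: "0 \<in> laurent_polys" and laurent_1: "1 \<in> laurent_polys"
  using laurent_const[of 0] laurent_const[of 1] by auto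

lemma laurent_X: "fls_X \<in> laurent_polys"
  using laurent_lmonom[where c=1 and n=1] by (simp add: fls_X_conv_shift_1)

lemma laurent_X_inv: "fls_X_inv \<in> laurent_polys"
  using laurent_lmonom[where c=1 and n="-1"] by (simp add: fls_X_inv_conv_shift_1)

lemma laurent_sum: "(\<And>i. i \<in> A \<Longrightarrow> f i \<in> laurent_polys) \<Longrightarrow> sum f A \<in> laurent_polys"
  by (induction A rule: infinite_finite_induct) (auto intro: laurent_0 laurent_add)

lemma laurent_decomp:
  assumes "f \<in> laurent_polys"
  shows "f = (\<Sum>n\<in>{n. f $$ n \<noteq> 0}. lmonom (f $$ n) n)"
proof (rule fls_eqI)
  fix m
  have "(\<Sum>n\<in>{n. f $$ n \<noteq> 0}. lmonom (f $$ n) n $$ m) = (\<Sum>n\<in>{n. f $$ n \<noteq> 0}. if n = m then f $$ n else 0)"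
    by (intro sum.cong) auto
  also have "\<dots> = f $$ m" using assms by (subst sum.delta) (auto simp: laurent_polys_def)
  finally show "f $$ m = (\<Sum>n\<in>{n. f $$ n \<noteq> 0}. lmonom (f $$ n) n) $$ m" by (simp add: fls_nth_sum)
qed

lemma laurent_induct [consumes 1, case_names monom add]:
  assumes "f \<in> laurent_polys" and monom: "\<And>c n. P (lmonom c n)"
    and add: "\<And>f g. f \<in> laurent_polys \<Longrightarrow> g \<in> laurent_polys \<Longrightarrow> P f \<Longrightarrow> P g \<Longrightarrow> P (f + g)"
  shows "P f"
proof -
  have "P (\<Sum>n\<in>A. lmonom (f $$ n) n)" if "finite A" for A
    using that
  proof (induction A)
    case empty
    then show ?case using monom[where c=0 and n=0] by simp
  next
    case (insert n A)
    then show ?case by (auto intro!: add laurent_sum monom laurent_lmonom)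
  qed
  then show ?thesis
    using laurent_decomp[OF assms(1)] assms(1) unfolding laurent_polys_def by fastforce
qed

lemma lmonom_mult: "lmonom c n * f = fls_const c * fls_shift (-n) f"
  by (simp add: fls_shifted_times_simps)

lemma laurent_mult:
  assumes "f \<in> laurent_polys" and g: "g \<in> laurent_polys" shows "f * g \<in> laurent_polys"
  using assms(1)
proof (induction f rule: laurent_induct)
  case (monom c n)
  have "finite ((\<lambda>i. i + n) ` {i. g $$ i \<noteq> 0})" using g by (simp add: laurent_polys_def)
  moreover have "{i. (lmonom c n * g) $$ i \<noteq> 0} \<subseteq> (\<lambda>i. i + n) ` {i. g $$ i \<noteq> 0}"
    unfolding lmonom_mult by (auto simp: image_iff intro!: exI[of _ "_ - n"])
  ultimately show ?case unfolding laurent_polys_def by (auto dest: finite_subset)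
qed (simp add: distrib_right laurent_add)

lemma laurent_power: "f \<in> laurent_polys \<Longrightarrow> f ^ n \<in> laurent_polys"
  by (induction n) (auto intro: laurent_1 laurent_mult)

lemma laurent_of_nat: "of_nat n \<in> laurent_polys"
  by (simp add: fls_of_nat laurent_const)

lemma laurent_deriv: assumes "f \<in> laurent_polys" shows "fls_deriv f \<in> laurent_polys"
proof -
  have "finite ((\<lambda>i. i - 1) ` {i. f $$ i \<noteq> 0})" using assms by (simp add: laurent_polys_def)
  moreover have "{i. fls_deriv f $$ i \<noteq> 0} \<subseteq> (\<lambda>i. i - 1) ` {i. f $$ i \<noteq> 0}"
    by (auto simp: image_iff intro!: exI[of _ "_ + 1"])
  ultimately show ?thesis unfolding laurent_polys_def by (auto dest: finite_subset)
qed

lemmas laurent_closed = laurent_add laurent_uminus laurent_diff laurent_const laurent_0 laurent_1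
  laurent_X laurent_X_inv laurent_mult laurent_power laurent_of_nat laurent_deriv

lemma laurent_eval_superset:
  assumes "finite A" "{n. f $$ n \<noteq> 0} \<subseteq> A"
  shows "laurent_eval f x = (\<Sum>n\<in>A. f $$ n * x powi n)"
  unfolding laurent_eval_def using assms by (intro sum.mono_neutral_left) auto

lemma laurent_eval_add:
  assumes "f \<in> laurent_polys" "g \<in> laurent_polys"
  shows "laurent_eval (f + g) x = laurent_eval f x + laurent_eval g x"
proof -
  let ?A = "{n. f $$ n \<noteq> 0} \<union> {n. g $$ n \<noteq> 0}"
  have "finite ?A" using assms by (simp add: laurent_polys_def)
  then show ?thesis
    by (subst (1 2 3) laurent_eval_superset[of ?A]) (auto simp: sum.distrib distrib_right)
qed

lemma laurent_eval_lmonom: "laurent_eval (lmonom c n) x = c * x powi n"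
  by (subst laurent_eval_superset[of "{n}"]) auto

lemma laurent_eval_const: "laurent_eval (fls_const c) x = c"
  using laurent_eval_lmonom[where c=c and n=0 and x=x] by simp

lemma laurent_eval_X: "laurent_eval fls_X x = x"
  using laurent_eval_lmonom[where c=1 and n=1 and x=x] by (simp add: fls_X_conv_shift_1)

lemma laurent_eval_mult:
  assumes x: "x \<noteq> 0" and f: "f \<in> laurent_polys" and g: "g \<in> laurent_polys"
  shows "laurent_eval (f * g) x = laurent_eval f x * laurent_eval g x"
  using f
proof (induction f rule: laurent_induct)
  case (monom c n)
  show ?case using g
  proof (induction g rule: laurent_induct)
    case (monom d m)
    have "lmonom c n * lmonom d m = lmonom (c * d) (n + m)"
      by (simp add: lmonom_mult fls_shifted_times_simps)
    then show ?case using x by (simp only: laurent_eval_lmonom) (simp add: power_int_add)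
  qed (simp add: distrib_left laurent_eval_add laurent_mult laurent_lmonom)
qed (simp add: distrib_right laurent_eval_add laurent_mult g)

lemma laurent_eval_uminus: "laurent_eval (- f) x = - laurent_eval f x"
  by (simp add: laurent_eval_def sum_negf)

lemma laurent_eval_diff:
  assumes "f \<in> laurent_polys" "g \<in> laurent_polys"
  shows "laurent_eval (f - g) x = laurent_eval f x - laurent_eval g x"
  using laurent_eval_add[OF assms(1) laurent_uminus[OF assms(2)]] by (simp add: laurent_eval_uminus)

lemma laurent_eval_power:
  "x \<noteq> 0 \<Longrightarrow> f \<in> laurent_polys \<Longrightarrow> laurent_eval (f ^ n) x = laurent_eval f x ^ n"
  using laurent_eval_const[of 1 x] by (induction n) (auto simp: laurent_eval_mult laurent_power)

lemma laurent_eval_of_nat: "laurent_eval (of_nat n) x = of_nat n"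
  by (simp add: fls_of_nat laurent_eval_const)

lemmas laurent_eval_simps = laurent_eval_add laurent_eval_diff laurent_eval_uminus laurent_eval_const
  laurent_eval_X laurent_eval_mult laurent_eval_power laurent_eval_of_nat

lemma X_minus_const_nonzero: "fls_X - fls_const x \<noteq> (0 :: 'k::field fls)"
proof
  assume "fls_X - fls_const x = 0"
  then have "(fls_X - fls_const x) $$ 1 = 0" by simp
  then show False by simp
qed

text \<open>
  Division with remainder by \<open>t - x\<close>. The Laurent polynomials that have such a decomposition form a
  subring; it contains the constants, \<open>t\<close> and \<open>t\<inverse>\<close>, hence everything. Evaluation at \<open>x\<close> identifies the
  remainder.
\<close>

lemma laurent_factor:
  assumes x: "x \<noteq> 0" and f: "f \<in> laurent_polys"
  obtains g where "g \<in> laurent_polys" "f = fls_const (laurent_eval f x) + (fls_X - fls_const x) * g"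
proof -
  define Q where "Q f \<longleftrightarrow> (\<exists>c. \<exists>g\<in>laurent_polys. f = fls_const c + (fls_X - fls_const x) * g)" for f
  have Q_const: "Q (fls_const c)" for c
    unfolding Q_def by (intro exI[of _ c] bexI[of _ 0]) (auto intro: laurent_0)
  have Q_add: "Q (f + g)" if "Q f" "Q g" for f g
  proof -
    from that obtain c d f' g' where "f' \<in> laurent_polys" "g' \<in> laurent_polys"
      "f = fls_const c + (fls_X - fls_const x) * f'" "g = fls_const d + (fls_X - fls_const x) * g'"
      unfolding Q_def by blast
    then show ?thesis unfolding Q_def
      by (intro exI[of _ "c + d"] bexI[of _ "f' + g'"])
         (simp_all add: laurent_add distrib_left flip: fls_plus_const)
  qed
  have Q_mult: "Q (f * g)" if "Q f" "Q g" for f g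
  proof -
    from that obtain c d f' g' where *: "f' \<in> laurent_polys" "g' \<in> laurent_polys"
      "f = fls_const c + (fls_X - fls_const x) * f'" "g = fls_const d + (fls_X - fls_const x) * g'"
      unfolding Q_def by blast
    have "f * g = fls_const (c * d) +
       (fls_X - fls_const x) * (fls_const c * g' + fls_const d * f' + (fls_X - fls_const x) * f' * g')"
      by (simp add: * algebra_simps flip: fls_const_mult_const)
    then show ?thesis unfolding Q_def
      using * by (intro exI[of _ "c * d"] bexI) (assumption, auto intro!: laurent_closed)
  qed
  have Q_X: "Q fls_X" unfolding Q_def
    by (intro exI[of _ x] bexI[of _ 1]) (auto intro: laurent_1)
  have "fls_X * fls_X_inv = (1 :: 'a fls)" by (simp add: fls_X_times_conv_shift)
  then have "fls_X_inv = fls_const (1 / x) + (fls_X - fls_const x) * (- (fls_const (1 / x) * fls_X_inv))"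
    using x by (simp add: algebra_simps fls_const_mult_const[symmetric] flip: mult.assoc)
  then have Q_X_inv: "Q fls_X_inv" unfolding Q_def by (blast intro: laurent_closed)
  have Q_X_power: "Q (fls_X ^ n)" "Q (fls_X_inv ^ n)" for n
    using Q_const[of 1] by (induction n) (auto intro: Q_mult Q_X Q_X_inv)
  have Q_lmonom: "Q (lmonom c n)" for c n
  proof (cases "n \<ge> 0")
    case True
    then have "lmonom c n = fls_const c * fls_X ^ nat n"
      by (simp add: fls_X_power_times_conv_shift)
    then show ?thesis by (simp only:) (intro Q_mult Q_const Q_X_power)
  next
    case False
    then have "lmonom c n = fls_const c * fls_X_inv ^ nat (- n)"
      by (simp add: fls_X_inv_power_times_conv_shift)
    then show ?thesis by (simp only:) (intro Q_mult Q_const Q_X_power)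
  qed
  have "Q f" using f by (induction f rule: laurent_induct) (auto intro: Q_lmonom Q_add)
  then obtain c g where g: "g \<in> laurent_polys" "f = fls_const c + (fls_X - fls_const x) * g"
    unfolding Q_def by blast
  then have "laurent_eval f x = c"
    using x by (simp add: laurent_eval_simps laurent_closed)
  then show thesis using g that by blast
qed

section \<open>Poles\<close>

abbreviation lin :: "'k::field \<Rightarrow> 'k fls" where "lin x \<equiv> fls_X - fls_const x"

abbreviation "localised \<equiv> localised_laurent_polys"

definition pole :: "'k::field \<Rightarrow> nat \<Rightarrow> 'k fls" where
  "pole x n = inverse (lin x ^ Suc n)"

lemma laurent_lin: "lin x \<in> laurent_polys"
  by (intro laurent_closed)

lemma eval_lin: "laurent_eval (lin x) x = 0"
  by (simp add: laurent_eval_simps laurent_closed)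

lemma eval_lin_power_mult:
  assumes "x \<noteq> 0" "f \<in> laurent_polys" shows "laurent_eval (lin x ^ Suc n * f) x = 0"
  using assms laurent_eval_mult[OF assms(1) laurent_power[OF laurent_lin] assms(2)]
    laurent_eval_power[OF assms(1) laurent_lin, of x "Suc n"]
  by (simp add: eval_lin del: power_Suc)

lemma lin_power_pole: "lin x ^ Suc n * pole x n = 1" "lin x * pole x (Suc n) = pole x n"
  "lin x * pole x 0 = 1"
proof -
  define u where "u = lin x"
  have "u \<noteq> 0" using X_minus_const_nonzero[of x] by (simp add: u_def)
  then show "lin x ^ Suc n * pole x n = 1" "lin x * pole x (Suc n) = pole x n" "lin x * pole x 0 = 1"
    unfolding pole_def u_def[symmetric] by (simp_all add: field_simps)
qed

lemma deriv_pole: "fls_deriv (pole x n) = - of_nat (Suc n) * pole x (Suc n)"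
proof -
  have nz: "lin x \<noteq> 0" by (rule X_minus_const_nonzero)
  have "fls_deriv (pole x n) = - (of_nat (Suc n) * lin x ^ n) * (inverse (lin x ^ Suc n))\<^sup>2"
    unfolding pole_def by (simp add: fls_inverse_deriv fls_deriv_power del: power_Suc of_nat_Suc)
  also have "\<dots> = - of_nat (Suc n) * (lin x ^ n * (inverse (lin x ^ Suc n))\<^sup>2)"
    by (simp only: mult.assoc mult_minus_left)
  also have "lin x ^ n * (inverse (lin x ^ Suc n))\<^sup>2 = pole x (Suc n)"
  proof -
    have "u ^ n * (inverse (u ^ Suc n))\<^sup>2 = inverse (u ^ Suc (Suc n))" if "u \<noteq> 0" for u :: "'a fls"
      using that by (simp add: field_simps power2_eq_square)
    then show ?thesis using nz unfolding pole_def by blast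
  qed
  finally show ?thesis .
qed

lemma localised_iff: "r \<in> localised x \<longleftrightarrow> (\<exists>m. lin x ^ m * r \<in> laurent_polys)"
proof
  assume "r \<in> localised x"
  then obtain f m where f: "f \<in> laurent_polys" "r = f / lin x ^ m"
    unfolding localised_laurent_polys_def by blast
  then have "lin x ^ m * r = f" using X_minus_const_nonzero[of x] by simp
  then show "\<exists>m. lin x ^ m * r \<in> laurent_polys" using f by blast
next
  assume "\<exists>m. lin x ^ m * r \<in> laurent_polys"
  then obtain m where "lin x ^ m * r \<in> laurent_polys" by blast
  moreover have "r = (lin x ^ m * r) / lin x ^ m" using X_minus_const_nonzero[of x] by simp
  ultimately show "r \<in> localised x" unfolding localised_laurent_polys_def by blast
qed

lemma localised_laurent: "f \<in> laurent_polys \<Longrightarrow> f \<in> localised x"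
  unfolding localised_iff by (intro exI[of _ 0]) simp

lemma localised_pole: "pole x n \<in> localised x"
  unfolding localised_iff using lin_power_pole(1)[of x n] by (metis laurent_1)

lemma localised_add:
  assumes "r \<in> localised x" "s \<in> localised x"
  shows "r + s \<in> localised x"
proof -
  obtain m n where mn: "lin x ^ m * r \<in> laurent_polys" "lin x ^ n * s \<in> laurent_polys"
    using assms unfolding localised_iff by blast
  have "lin x ^ n * (lin x ^ m * r) + lin x ^ m * (lin x ^ n * s) \<in> laurent_polys"
    by (intro laurent_add laurent_mult[OF laurent_power[OF laurent_lin]] mn)
  moreover have "lin x ^ n * (lin x ^ m * r) + lin x ^ m * (lin x ^ n * s) = lin x ^ (m + n) * (r + s)"
    by (simp add: power_add algebra_simps)
  ultimately show ?thesis unfolding localised_iff by metis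
qed

lemma localised_mult:
  assumes "f \<in> laurent_polys" "r \<in> localised x"
  shows "f * r \<in> localised x"
proof -
  obtain m where m: "lin x ^ m * r \<in> laurent_polys"
    using assms unfolding localised_iff by blast
  have "f * (lin x ^ m * r) \<in> laurent_polys"
    using assms(1) m by (rule laurent_mult)
  then show ?thesis unfolding localised_iff by (auto simp: mult.left_commute)
qed

lemma localised_deriv:
  assumes "r \<in> localised x"
  shows "fls_deriv r \<in> localised x"
proof -
  obtain m where m: "lin x ^ m * r \<in> laurent_polys"
    using assms unfolding localised_iff by blast
  have "fls_deriv (lin x ^ Suc m * r) = lin x ^ Suc m * fls_deriv r + of_nat (Suc m) * (lin x ^ m * r)"
    by (simp add: fls_deriv_power del: of_nat_Suc power_Suc)
  then have "lin x ^ Suc m * fls_deriv r = fls_deriv (lin x * (lin x ^ m * r)) - of_nat (Suc m) * (lin x ^ m * r)"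
    by (simp add: algebra_simps)
  also have "\<dots> \<in> laurent_polys" by (intro laurent_closed m)
  finally show ?thesis unfolding localised_iff by blast
qed

lemma localised_uminus:
  "r \<in> localised x \<Longrightarrow> - r \<in> localised x"
  using localised_mult[OF laurent_uminus[OF laurent_1], of r x] by simp

text \<open>
  With \<open>n + 1\<close> the least power of \<open>t - x\<close> that clears the denominator of \<open>r\<close>, the numerator cannot vanish
  at \<open>x\<close>, as it would be divisible by \<open>t - x\<close> otherwise.
\<close>

lemma localised_leading_pole:
  assumes x: "x \<noteq> 0" and r: "r \<in> localised x" "r \<notin> laurent_polys"
  obtains n g where "g \<in> laurent_polys" "laurent_eval g x \<noteq> 0" "r = g * pole x n"
proof -
  define m where "m = (LEAST m. lin x ^ m * r \<in> laurent_polys)"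
  have m: "lin x ^ m * r \<in> laurent_polys"
    unfolding m_def using r(1) by (auto simp: localised_iff intro: LeastI)
  have least: "\<not> lin x ^ n * r \<in> laurent_polys" if "n < m" for n
    using that unfolding m_def by (rule not_less_Least)
  have "m \<noteq> 0" using m r(2) by (intro notI) simp
  then obtain n where n: "m = Suc n" by (cases m) auto
  have "laurent_eval (lin x ^ m * r) x \<noteq> 0"
  proof
    assume 0: "laurent_eval (lin x ^ m * r) x = 0"
    obtain g where g: "g \<in> laurent_polys" "lin x ^ m * r = fls_const 0 + lin x * g"
      using laurent_factor[OF x m] unfolding 0 by blast
    then have "lin x * (lin x ^ n * r) = lin x * g" by (simp add: n mult.assoc)
    then have "lin x ^ n * r = g" using X_minus_const_nonzero[of x] by simp
    then show False using least[of n] g(1) n by simp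
  qed
  moreover have "r = lin x ^ m * r * pole x n"
    using lin_power_pole(1)[of x n] by (simp add: n mult.commute mult.left_commute)
  ultimately show thesis using m that by blast
qed

lemma pole_not_laurent:
  assumes x: "x \<noteq> 0" and l: "fls_const c * pole x n \<in> laurent_polys" shows "c = 0"
proof -
  have "laurent_eval (lin x ^ Suc n * (fls_const c * pole x n)) x = 0"
    using x l by (rule eval_lin_power_mult)
  moreover have "lin x ^ Suc n * (fls_const c * pole x n) = fls_const c"
    using lin_power_pole(1)[of x n] by (simp add: mult.left_commute del: power_Suc)
  ultimately have "laurent_eval (fls_const c) x = 0" by (simp only:)
  then show ?thesis by (simp add: laurent_eval_const)
qed

text \<open>
  In characteristic zero differentiation turns a pole of order \<open>n + 1\<close> into one of order \<open>n + 2 \<ge> 2\<close>,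
  and a simple pole cannot cancel it. This one fact gives injectivity of \<open>d/dt\<close> on principal parts,
  uniqueness of residues, and linear independence of the derivatives of a simple pole.
\<close>

lemma deriv_plus_simple_pole:
  fixes x :: "'k::field_char_0"
  assumes x: "x \<noteq> 0" and s: "s \<in> localised x"
    and l: "fls_deriv s + fls_const c * pole x 0 \<in> laurent_polys"
  shows "s \<in> laurent_polys" "c = 0"
proof -
  show "s \<in> laurent_polys"
  proof (rule ccontr)
    assume "s \<notin> laurent_polys"
    then obtain n g where g: "g \<in> laurent_polys" "laurent_eval g x \<noteq> 0" "s = g * pole x n"
      using localised_leading_pole[OF x s] by blast
    let ?l = "fls_deriv s + fls_const c * pole x 0"
    have 1: "lin x ^ Suc (Suc n) * pole x n = lin x"
      using lin_power_pole(1)[of x n] by (simp add: mult.assoc)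
    have 2: "lin x ^ Suc (Suc n) * pole x (Suc n) = 1" by (rule lin_power_pole(1))
    have 3: "lin x ^ Suc (Suc n) * pole x 0 = lin x ^ Suc n"
      using lin_power_pole(3)[of x] by (simp add: mult.assoc mult.left_commute)
    have "lin x ^ Suc (Suc n) * ?l =
        fls_deriv g * (lin x ^ Suc (Suc n) * pole x n)
        - of_nat (Suc n) * g * (lin x ^ Suc (Suc n) * pole x (Suc n))
        + fls_const c * (lin x ^ Suc (Suc n) * pole x 0)"
      by (simp add: g(3) deriv_pole algebra_simps del: power_Suc of_nat_Suc)
    also have "\<dots> = fls_deriv g * lin x - of_nat (Suc n) * g + fls_const c * lin x ^ Suc n"
      by (simp only: 1 2 3 mult_1_right)
    finally have eq: "lin x ^ Suc (Suc n) * ?l = \<dots>" .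
    have "laurent_eval (lin x ^ Suc (Suc n) * ?l) x = 0"
      using x l by (rule eval_lin_power_mult)
    moreover have "laurent_eval (fls_deriv g * lin x - of_nat (Suc n) * g + fls_const c * lin x ^ Suc n) x
       = - of_nat (Suc n) * laurent_eval g x"
      using x g(1) by (simp add: laurent_eval_add laurent_eval_diff laurent_eval_mult laurent_eval_power
        laurent_eval_of_nat eval_lin laurent_closed laurent_lin del: of_nat_Suc power_Suc)
    ultimately show False using g(2) unfolding eq by (simp del: of_nat_Suc)
  qed
  then show "c = 0" using laurent_diff[OF l laurent_deriv[OF \<open>s \<in> laurent_polys\<close>]] pole_not_laurent[OF x]
    by (simp add: add.commute)
qed

text \<open>
  Partial fractions: modulo Laurent polynomials, every element is a sum of multiples of poles.
\<close>

lemma localised_induct [consumes 2, case_names laurent add pole]: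
  assumes x: "x \<noteq> 0" and r: "r \<in> localised x"
    and laurent: "\<And>f. f \<in> laurent_polys \<Longrightarrow> P f"
    and add: "\<And>r s. r \<in> localised x \<Longrightarrow> s \<in> localised x \<Longrightarrow>
       P r \<Longrightarrow> P s \<Longrightarrow> P (r + s)"
    and pole: "\<And>c n. P (fls_const c * pole x n)"
  shows "P r"
proof -
  have *: "P (f * pole x n)" if "f \<in> laurent_polys" for f n
    using that
  proof (induction n arbitrary: f)
    case 0
    obtain g where g: "g \<in> laurent_polys" "f = fls_const (laurent_eval f x) + lin x * g"
      using laurent_factor[OF x 0] by blast
    have "f * pole x 0 = fls_const (laurent_eval f x) * pole x 0 + g * (lin x * pole x 0)"
      by (subst g(2)) (simp add: algebra_simps)
    also have "\<dots> = fls_const (laurent_eval f x) * pole x 0 + g" by (simp only: lin_power_pole mult_1_right)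
    finally show ?case
      using add[OF localised_mult[OF laurent_const localised_pole] localised_laurent[OF g(1)] pole laurent[OF g(1)]]
      by simp
  next
    case (Suc n)
    obtain g where g: "g \<in> laurent_polys" "f = fls_const (laurent_eval f x) + lin x * g"
      using laurent_factor[OF x Suc.prems] by blast
    have "f * pole x (Suc n) = fls_const (laurent_eval f x) * pole x (Suc n) + g * (lin x * pole x (Suc n))"
      by (subst g(2)) (simp add: algebra_simps)
    also have "\<dots> = fls_const (laurent_eval f x) * pole x (Suc n) + g * pole x n" by (simp only: lin_power_pole)
    finally show ?case
      using add[OF localised_mult[OF laurent_const localised_pole] localised_mult[OF g(1) localised_pole]
          pole Suc.IH[OF g(1)]]
      by simp
  qed
  show ?thesis
  proof (cases "r \<in> laurent_polys")
    case False
    then show ?thesis using localised_leading_pole[OF x r] * by metis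
  qed (rule laurent)
qed

text \<open>
  Every pole of order at least two is a derivative, so only a simple pole is left over.
\<close>

lemma localised_antiderivative:
  fixes x :: "'k::field_char_0"
  assumes x: "x \<noteq> 0" and r: "r \<in> localised x"
  obtains s c where "s \<in> localised x"
    "r - (fls_deriv s + fls_const c * pole x 0) \<in> laurent_polys"
proof -
  have "\<exists>s\<in>localised x. \<exists>c. r - (fls_deriv s + fls_const c * pole x 0) \<in> laurent_polys"
    using x r
  proof (induction r rule: localised_induct)
    case (laurent f)
    then show ?case by (intro bexI[of _ 0] exI[of _ 0]) (auto intro: localised_laurent laurent_0)
  next
    case (add r r')
    then obtain s s' c c' where "s \<in> localised x" "s' \<in> localised x"
      "r - (fls_deriv s + fls_const c * pole x 0) \<in> laurent_polys"
      "r' - (fls_deriv s' + fls_const c' * pole x 0) \<in> laurent_polys" by blast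
    then show ?case
      using laurent_add[of "r - (fls_deriv s + fls_const c * pole x 0)" "r' - (fls_deriv s' + fls_const c' * pole x 0)"]
      by (intro bexI[of _ "s + s'"] exI[of _ "c + c'"])
         (auto simp: algebra_simps intro: localised_add simp flip: fls_plus_const)
  next
    case (pole c n)
    show ?case
    proof (cases n)
      case 0
      then show ?thesis by (intro bexI[of _ 0] exI[of _ c]) (auto intro: localised_laurent laurent_0)
    next
      case (Suc m)
      let ?c = "- (c / of_nat (Suc m))"
      have "fls_deriv (fls_const ?c * pole x m) = fls_const ?c * - of_nat (Suc m) * pole x (Suc m)"
        by (simp add: fls_deriv_mult_const_left deriv_pole del: of_nat_Suc)
      also have "fls_const ?c * - of_nat (Suc m) = fls_const c"
        by (simp add: fls_of_nat del: of_nat_Suc)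
      finally have eq: "fls_deriv (fls_const ?c * pole x m) = fls_const c * pole x (Suc m)" .
      have "fls_const ?c * pole x m \<in> localised x"
        by (intro localised_mult laurent_const localised_pole)
      then show ?thesis
        unfolding Suc by (intro bexI[of _ "fls_const ?c * pole x m"] exI[of _ 0]) (simp_all only: eq, simp add: laurent_0)
    qed
  qed
  then show thesis using that by blast
qed

text \<open>
  The Laurent polynomials divisible by all powers of \<open>t - x\<close> are stable under multiplication by \<open>t\<close> and
  under \<open>d/dt\<close>, hence under \<open>t d/dt - k\<close>. If \<open>k\<close> is an exponent of \<open>f\<close>, this operator kills that monomial
  and creates no new one. By induction on the support, \<open>f\<close> is a single monomial, which is nonzero
  at \<open>x\<close>.
\<close>

lemma laurent_zero_of_infinite_order:
  fixes x :: "'k::field_char_0"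
  assumes x: "x \<noteq> 0" and f: "f \<in> laurent_polys" and "\<And>n. f * pole x n \<in> laurent_polys"
  shows "f = 0"
proof -
  have "finite {n. f $$ n \<noteq> 0}" using f by (simp add: laurent_polys_def)
  then show ?thesis using assms(2,3)
  proof (induction "{n. f $$ n \<noteq> 0}" arbitrary: f rule: finite_psubset_induct)
    case psubset
    show ?case
    proof (rule ccontr)
      assume "f \<noteq> 0"
      then obtain k where k: "f $$ k \<noteq> 0" by (metis fls_eqI fls_zero_nth)
      define g where "g = fls_X * fls_deriv f - of_int k * f"
      have g_nth: "g $$ n = of_int (n - k) * f $$ n" for n
        by (simp add: g_def fls_X_times_conv_shift fls_of_int algebra_simps)
      have g_laurent: "g \<in> laurent_polys"
        unfolding g_def by (auto intro!: laurent_closed psubset.prems simp: fls_of_int)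
      have "g = 0"
      proof (rule psubset.hyps(2)[OF _ g_laurent])
        show "{n. g $$ n \<noteq> 0} \<subset> {n. f $$ n \<noteq> 0}" using k by (auto simp: g_nth)
        fix n
        have "fls_deriv f * pole x n = fls_deriv (f * pole x n) + of_nat (Suc n) * (f * pole x (Suc n))"
          by (simp add: deriv_pole algebra_simps del: of_nat_Suc)
        also have "\<dots> \<in> laurent_polys" by (intro laurent_closed psubset.prems)
        finally have "fls_X * (fls_deriv f * pole x n) - fls_const (of_int k) * (f * pole x n) \<in> laurent_polys"
          using laurent_diff[OF laurent_mult[OF laurent_X] laurent_mult[OF laurent_const psubset.prems(2)]] by blast
        then show "g * pole x n \<in> laurent_polys" by (simp add: g_def algebra_simps fls_of_int)
      qed
      then have "of_int (n - k) * f $$ n = 0" for n using g_nth[of n] by simp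
      then have "f $$ n = 0" if "n \<noteq> k" for n using that by (metis mult_eq_0_iff of_int_eq_0_iff right_minus_eq)
      then have "f = lmonom (f $$ k) k" by (intro fls_eqI) auto
      then have "laurent_eval f x \<noteq> 0" using k x by (metis laurent_eval_lmonom mult_eq_0_iff power_int_eq_0_iff)
      moreover have "laurent_eval (lin x ^ Suc 0 * (f * pole x 0)) x = 0"
        using x psubset.prems(2) by (rule eval_lin_power_mult)
      moreover have "lin x ^ Suc 0 * (f * pole x 0) = f"
        using lin_power_pole(3)[of x] by (simp add: mult.left_commute)
      ultimately show False by (simp only: not_True_eq_False simp_thms)
    qed
  qed
qed

section \<open>The localised Weyl algebra acts faithfully\<close>

type_synonym 'k weyl_word_poly = "weyl_gen list \<Rightarrow>\<^sub>0 'k"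

interpretation Weyl: presentation UNIV "weyl_relations :: (('k::field) weyl_word_poly) set"
  by unfold_locales (auto simp: carrier_free_algebra)

lemmas weyl_fold = weyl_algebra_def[symmetric] weyl_class_def[symmetric]

abbreviation "weyl_ideal \<equiv> Idl\<^bsub>free_algebra UNIV\<^esub> (weyl_relations :: (('k::field) weyl_word_poly) set)"

lemma weyl_free_carrier [simp]: "p \<in> carrier (free_algebra (UNIV :: weyl_gen set))"
  by (simp add: carrier_free_algebra)

lemma weyl_ideal_add: "p \<in> weyl_ideal \<Longrightarrow> q \<in> weyl_ideal \<Longrightarrow> p + q \<in> weyl_ideal"
  using additive_subgroup.a_closed[OF ideal.axioms(1)[OF Weyl.rels_ideal]] by (simp add: free_algebra_ops)

lemma weyl_ideal_mult_l: "p \<in> weyl_ideal \<Longrightarrow> q * p \<in> weyl_ideal"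
  using ideal.I_l_closed[OF Weyl.rels_ideal, of p q] by (simp add: free_algebra_ops)

lemma weyl_ideal_mult_r: "p \<in> weyl_ideal \<Longrightarrow> p * q \<in> weyl_ideal"
  using ideal.I_r_closed[OF Weyl.rels_ideal, of p q] by (simp add: free_algebra_ops)

lemma weyl_ideal_uminus: "p \<in> weyl_ideal \<Longrightarrow> - p \<in> weyl_ideal"
  using weyl_ideal_mult_l[of p "- 1"] by simp

lemma weyl_ideal_diff: "p \<in> weyl_ideal \<Longrightarrow> q \<in> weyl_ideal \<Longrightarrow> p - q \<in> weyl_ideal"
  using weyl_ideal_add[OF _ weyl_ideal_uminus, of p q] by simp

lemma weyl_ideal_0: "0 \<in> weyl_ideal"
  using additive_subgroup.zero_closed[OF ideal.axioms(1)[OF Weyl.rels_ideal]] by (simp add: free_algebra_ops)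

abbreviation "gt \<equiv> fgen Gen_t :: ('k::field) weyl_word_poly"
abbreviation "gu \<equiv> fgen Gen_tinv :: ('k::field) weyl_word_poly"
abbreviation "gd \<equiv> fgen Gen_d :: ('k::field) weyl_word_poly"
abbreviation "tpow n \<equiv> Poly_Mapping.single (t_power_word n) 1 :: ('k::field) weyl_word_poly"

lemma weyl_ideal_relations:
  "gt * gu - 1 \<in> weyl_ideal" "gu * gt - 1 \<in> weyl_ideal" "gd * gt - gt * gd - 1 \<in> weyl_ideal"
  by (rule Weyl.rels_in_ideal, simp add: weyl_relations_def)+

text \<open>
  The commutation rule \<open>\<partial> t\<inverse> = t\<inverse> \<partial> - t\<inverse> t\<inverse>\<close> follows from the three defining relations: conjugate
  \<open>\<partial> t = t \<partial> + 1\<close> by \<open>t\<inverse>\<close>.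
\<close>

lemma weyl_ideal_d_tinv: "gd * gu - gu * gd + gu * gu \<in> weyl_ideal"
proof -
  have "gd * gu - gu * gd + gu * gu =
    gu * gd * (gt * gu - 1) - (gu * gt - 1) * (gd * gu) - gu * (gd * gt - gt * gd - 1) * gu"
    by (simp add: algebra_simps)
  also have "\<dots> \<in> weyl_ideal"
    by (intro weyl_ideal_diff weyl_ideal_mult_l weyl_ideal_mult_r weyl_ideal_relations)
  finally show ?thesis .
qed

lemma t_tpow: "(gt * tpow n - tpow (n + 1) :: ('k::field) weyl_word_poly) \<in> weyl_ideal"
proof (cases "n \<ge> 0")
  case True
  then have "gt * tpow n = (tpow (n + 1) :: 'k weyl_word_poly)"
    by (simp add: mult_single plus_list_def t_power_word_def nat_add_distrib)
  then show ?thesis by (simp add: weyl_ideal_0)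
next
  case False
  then have "nat (- n) = Suc (nat (- (n + 1)))" by simp
  then have "t_power_word n = Gen_tinv # t_power_word (n + 1)"
    using False by (auto simp: t_power_word_def)
  then have "gt * tpow n - tpow (n + 1) = (gt * gu - 1) * (tpow (n + 1) :: 'k weyl_word_poly)"
    by (simp add: algebra_simps mult_single plus_list_def)
  then show ?thesis using weyl_ideal_mult_r[OF weyl_ideal_relations(1)] by simp
qed

lemma tinv_tpow: "(gu * tpow n - tpow (n - 1) :: ('k::field) weyl_word_poly) \<in> weyl_ideal"
proof (cases "n \<le> 0")
  case True
  then have "nat (- (n - 1)) = Suc (nat (- n))" by simp
  then have "gu * tpow n = (tpow (n - 1) :: 'k weyl_word_poly)"
    using True by (auto simp: mult_single plus_list_def t_power_word_def)
  then show ?thesis by (simp add: weyl_ideal_0)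
next
  case False
  then have "nat n = Suc (nat (n - 1))" by simp
  then have "t_power_word n = Gen_t # t_power_word (n - 1)"
    using False by (auto simp: t_power_word_def)
  then have "gu * tpow n - tpow (n - 1) = (gu * gt - 1) * (tpow (n - 1) :: 'k weyl_word_poly)"
    by (simp add: algebra_simps mult_single plus_list_def)
  then show ?thesis using weyl_ideal_mult_r[OF weyl_ideal_relations(2)] by simp
qed

lemma fconst_central: "fconst c * p = p * (fconst c :: 'x list \<Rightarrow>\<^sub>0 'k::field)"
proof -
  have "p \<in> carrier (free_algebra UNIV)" by (simp add: carrier_free_algebra)
  then show ?thesis
  proof (induction p rule: free_algebra_induct)
    case (const d)
    then show ?case by (simp add: fconst_mult mult.commute)
  next
    case (add p q)
    then show ?case by (simp add: distrib_left distrib_right)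
  next
    case (gen g p)
    have "fconst c * (fgen g * p) = fgen g * (fconst c * p)"
      by (simp add: mult.assoc[symmetric] fconst_mult)
    then show ?case using gen by (simp add: mult.assoc)
  qed
qed

lemma fconst_left_commute: "p * (fconst c * q) = (fconst c :: 'x list \<Rightarrow>\<^sub>0 'k::field) * (p * q)"
  by (simp add: mult.assoc[symmetric] fconst_central[symmetric])

lemma d_tpow:
  "(gd * tpow n - tpow n * gd - fconst (of_int n) * tpow (n - 1) :: ('k::field) weyl_word_poly) \<in> weyl_ideal"
proof (induction n rule: int_induct[where k = 0])
  case base
  have "tpow 0 = (1 :: 'k weyl_word_poly)" by (simp add: t_power_word_def one_eq_fconst)
  then show ?case by (simp add: weyl_ideal_0)
next
  case (step1 n)
  define c :: "'k weyl_word_poly" where "c = fconst (of_int n)"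
  have c1: "fconst (of_int (n + 1)) = c + (1 :: 'k weyl_word_poly)"
    by (simp add: c_def single_add one_eq_fconst)
  have tn: "tpow (n + 1) = gt * (tpow n :: 'k weyl_word_poly)"
    using step1 by (simp add: mult_single plus_list_def t_power_word_def nat_add_distrib)
  have ct: "c * gt = gt * c" unfolding c_def by (rule fconst_central)
  have "gd * tpow (n + 1) - tpow (n + 1) * gd - fconst (of_int (n + 1)) * tpow (n + 1 - 1) =
      (gd * gt - gt * gd - 1) * tpow n + gt * (gd * tpow n - tpow n * gd - c * tpow (n - 1))
      + c * (gt * tpow (n - 1) - tpow n)"
    unfolding c1 tn by (simp add: algebra_simps) (simp add: mult.assoc[symmetric] ct)
  also have "\<dots> \<in> weyl_ideal"
    using step1 t_tpow[of "n - 1"] unfolding c_def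
    by (intro weyl_ideal_add weyl_ideal_mult_l[of "_ - _"] weyl_ideal_mult_r[OF weyl_ideal_relations(3)]) auto
  finally show ?case .
next
  case (step2 n)
  define c :: "'k weyl_word_poly" where "c = fconst (of_int n)"
  have c1: "fconst (of_int (n - 1)) = c - (1 :: 'k weyl_word_poly)"
    by (simp add: c_def single_diff one_eq_fconst)
  have "nat (- (n - 1)) = Suc (nat (- n))" using step2 by simp
  then have tn: "tpow (n - 1) = gu * (tpow n :: 'k weyl_word_poly)"
    using step2 by (auto simp: mult_single plus_list_def t_power_word_def)
  have ct: "c * gu = gu * c" unfolding c_def by (rule fconst_central)
  have ct': "c * (gu * q) = gu * (c * q)" for q by (simp only: ct mult.assoc[symmetric])
  have eq: "gd * tpow (n - 1) - tpow (n - 1) * gd - fconst (of_int (n - 1)) * tpow (n - 1 - 1) =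
      (gd * gu - gu * gd + gu * gu) * tpow n + gu * (gd * tpow n - tpow n * gd - c * tpow (n - 1))
      + c * (gu * tpow (n - 1) - tpow (n - 1 - 1))
      - (gu * (gu * tpow n - tpow (n - 1)) + (gu * tpow (n - 1) - tpow (n - 1 - 1)))"
    unfolding c1 tn by (simp add: algebra_simps ct ct')
  have IH: "gu * (gd * tpow n - tpow n * gd - c * tpow (n - 1)) \<in> weyl_ideal"
    using step2 unfolding c_def by (intro weyl_ideal_mult_l) auto
  show ?case unfolding eq
    by (rule weyl_ideal_diff[OF
          weyl_ideal_add[OF weyl_ideal_add[OF weyl_ideal_mult_r[OF weyl_ideal_d_tinv] IH] weyl_ideal_mult_l[OF tinv_tpow]]
          weyl_ideal_add[OF weyl_ideal_mult_l[OF tinv_tpow] tinv_tpow]])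
qed

lemma laurent_word_superset:
  assumes "finite A" "{n. f $$ n \<noteq> 0} \<subseteq> A"
  shows "laurent_word f = (\<Sum>n\<in>A. Poly_Mapping.single (t_power_word n) (f $$ n))"
  unfolding laurent_word_def using assms by (intro sum.mono_neutral_left) auto

lemma laurent_word_add:
  assumes "f \<in> laurent_polys" "g \<in> laurent_polys"
  shows "laurent_word (f + g) = laurent_word f + laurent_word g"
proof -
  let ?A = "{n. f $$ n \<noteq> 0} \<union> {n. g $$ n \<noteq> 0}"
  have "finite ?A" using assms by (simp add: laurent_polys_def)
  then show ?thesis
    by (subst (1 2 3) laurent_word_superset[of ?A]) (auto simp: sum.distrib single_add)
qed

lemma laurent_word_0: "laurent_word 0 = 0"
  by (simp add: laurent_word_def)

lemma laurent_word_lmonom: "laurent_word (lmonom c n) = fconst c * tpow n"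
  by (subst laurent_word_superset[of "{n}"]) (auto simp: mult_single plus_list_def)

lemma t_laurent_word:
  assumes "f \<in> laurent_polys" shows "gt * laurent_word f - laurent_word (fls_X * f) \<in> weyl_ideal"
  using assms
proof (induction f rule: laurent_induct)
  case (monom c n)
  have "fls_X * lmonom c n = lmonom c (n + 1)"
    by (simp add: fls_X_times_conv_shift add.commute)
  then have "gt * laurent_word (lmonom c n) - laurent_word (fls_X * lmonom c n)
      = fconst c * (gt * tpow n - tpow (n + 1) :: 'a weyl_word_poly)"
    by (simp only: laurent_word_lmonom right_diff_distrib fconst_left_commute)
  then show ?case using weyl_ideal_mult_l[OF t_tpow] by metis
next
  case (add f g)
  then show ?case
    using weyl_ideal_add[OF add(3,4)]
    by (simp add: distrib_left laurent_word_add laurent_closed algebra_simps)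
qed

lemma tinv_laurent_word:
  assumes "f \<in> laurent_polys" shows "gu * laurent_word f - laurent_word (fls_X_inv * f) \<in> weyl_ideal"
  using assms
proof (induction f rule: laurent_induct)
  case (monom c n)
  have "fls_X_inv * lmonom c n = lmonom c (n - 1)"
    by (simp add: fls_X_inv_times_conv_shift)
  then have "gu * laurent_word (lmonom c n) - laurent_word (fls_X_inv * lmonom c n)
      = fconst c * (gu * tpow n - tpow (n - 1) :: 'a weyl_word_poly)"
    by (simp only: laurent_word_lmonom right_diff_distrib fconst_left_commute)
  then show ?case using weyl_ideal_mult_l[OF tinv_tpow] by metis
next
  case (add f g)
  then show ?case
    using weyl_ideal_add[OF add(3,4)]
    by (simp add: distrib_left laurent_word_add laurent_closed algebra_simps)
qed

lemma d_laurent_word: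
  assumes "f \<in> laurent_polys"
  shows "gd * laurent_word f - laurent_word f * gd - laurent_word (fls_deriv f) \<in> weyl_ideal"
  using assms
proof (induction f rule: laurent_induct)
  case (monom c n)
  have "fls_deriv (lmonom c n) = lmonom (c * of_int n) (n - 1)"
  proof (rule fls_eqI)
    fix m
    show "fls_deriv (lmonom c n) $$ m = lmonom (c * of_int n) (n - 1) $$ m"
      by (cases "m = n - 1") auto
  qed
  then have "laurent_word (fls_deriv (lmonom c n)) = fconst (c * of_int n) * tpow (n - 1)"
    by (simp only: laurent_word_lmonom)
  then have "gd * laurent_word (lmonom c n) - laurent_word (lmonom c n) * gd - laurent_word (fls_deriv (lmonom c n))
      = fconst c * (gd * tpow n - tpow n * gd - fconst (of_int n) * tpow (n - 1))"
    by (simp only: laurent_word_lmonom right_diff_distrib fconst_left_commute[of gd] mult.assoc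
          fconst_mult(1)[of c "[]" "of_int n", symmetric])
  then show ?case using weyl_ideal_mult_l[OF d_tpow] by metis
next
  case (add f g)
  then show ?case
    using weyl_ideal_add[OF add(3,4)]
    by (simp add: laurent_word_add laurent_closed algebra_simps)
qed

abbreviation "normal_sum n f \<equiv> \<Sum>i<n::nat. laurent_word (f i) * gd ^ i"

text \<open>
  Modulo the relations, every element can be written with the derivatives on the right, as
  \<open>\<Sum> f\<^sub>i \<partial>\<^sup>i\<close> with Laurent polynomials \<open>f\<^sub>i\<close>. Existence of this form suffices: uniqueness comes out of the
  faithfulness of the action below.
\<close>

definition weyl_normal_form :: "(('k::field) weyl_word_poly) \<Rightarrow> bool" where
  "weyl_normal_form p \<longleftrightarrow> (\<exists>n f. (\<forall>i. f i \<in> laurent_polys) \<and>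
     p - (normal_sum n f) \<in> weyl_ideal)"

lemma normal_form_cong:
  assumes "weyl_normal_form q" "p - q \<in> weyl_ideal" shows "weyl_normal_form p"
proof -
  obtain n f where "\<forall>i. f i \<in> laurent_polys" "q - (normal_sum n f) \<in> weyl_ideal"
    using assms(1) unfolding weyl_normal_form_def by blast
  moreover from this have "p - (normal_sum n f) \<in> weyl_ideal"
    using weyl_ideal_add[OF assms(2)] by fastforce
  ultimately show ?thesis unfolding weyl_normal_form_def by blast
qed

lemma normal_form_term:
  assumes "f \<in> laurent_polys" shows "weyl_normal_form (laurent_word f * gd ^ i)"
proof -
  have "(\<Sum>j<Suc i. laurent_word (if j = i then f else 0) * gd ^ j) = laurent_word f * gd ^ i"
    by (simp add: laurent_word_0)
  then have "laurent_word f * gd ^ i - (\<Sum>j<Suc i. laurent_word (if j = i then f else 0) * gd ^ j) \<in> weyl_ideal"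
    by (simp only: diff_self weyl_ideal_0)
  then show ?thesis unfolding weyl_normal_form_def using assms laurent_0
    by (intro exI[of _ "Suc i"] exI[of _ "\<lambda>j. if j = i then f else 0"]) auto
qed

lemma normal_form_add:
  assumes "weyl_normal_form p" "weyl_normal_form q" shows "weyl_normal_form (p + q)"
proof -
  obtain n f where f: "\<And>i. f i \<in> laurent_polys" "p - (normal_sum n f) \<in> weyl_ideal"
    using assms(1) unfolding weyl_normal_form_def by blast
  obtain m g where g: "\<And>i. g i \<in> laurent_polys" "q - (normal_sum m g) \<in> weyl_ideal"
    using assms(2) unfolding weyl_normal_form_def by blast
  define h where "h i = (if i < n then f i else 0) + (if i < m then g i else 0)" for i
  have h: "h i \<in> laurent_polys" for i using f g laurent_0 by (auto simp: h_def laurent_add)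
  have "(normal_sum (max n m) h)
     = (\<Sum>i<max n m. laurent_word (if i < n then f i else 0) * gd ^ i)
     + (\<Sum>i<max n m. laurent_word (if i < m then g i else 0) * gd ^ i)"
    unfolding h_def using f g laurent_0
    by (subst sum.distrib[symmetric], intro sum.cong refl) (simp add: laurent_word_add laurent_word_0 distrib_right)
  also have "(\<Sum>i<max n m. laurent_word (if i < n then f i else 0) * gd ^ i) = (normal_sum n f)"
    by (intro sum.mono_neutral_cong_right) (auto simp: laurent_word_0)
  also have "(\<Sum>i<max n m. laurent_word (if i < m then g i else 0) * gd ^ i) = (normal_sum m g)"
    by (intro sum.mono_neutral_cong_right) (auto simp: laurent_word_0)
  finally have "p + q - (normal_sum (max n m) h) =
    (p - (normal_sum n f)) + (q - (normal_sum m g))"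
    by simp
  then show ?thesis unfolding weyl_normal_form_def using h weyl_ideal_add[OF f(2) g(2)] by metis
qed

lemma normal_form_sum:
  "(\<And>i. i < n \<Longrightarrow> weyl_normal_form (p i)) \<Longrightarrow> weyl_normal_form (\<Sum>i<n::nat. p i)"
proof (induction n)
  case 0
  then show ?case using normal_form_term[OF laurent_0, of 0] by (simp add: laurent_word_0)
qed (simp add: normal_form_add)

lemma normal_form_gen:
  assumes f: "f \<in> laurent_polys" shows "weyl_normal_form (fgen g * (laurent_word f * gd ^ i))"
proof (cases g)
  case Gen_t
  have "gt * (laurent_word f * gd ^ i) -  laurent_word (fls_X * f) * gd ^ i =
     (gt * laurent_word f - laurent_word (fls_X * f)) * gd ^ i" by (simp add: algebra_simps)
  then show ?thesis unfolding Gen_t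
    using weyl_ideal_mult_r[OF t_laurent_word[OF f], of "gd ^ i"]
    by (intro normal_form_cong[OF normal_form_term[OF laurent_mult[OF laurent_X f], of i]]) metis
next
  case Gen_tinv
  have "gu * (laurent_word f * gd ^ i) - laurent_word (fls_X_inv * f) * gd ^ i =
     (gu * laurent_word f - laurent_word (fls_X_inv * f)) * gd ^ i" by (simp add: algebra_simps)
  then show ?thesis unfolding Gen_tinv
    using weyl_ideal_mult_r[OF tinv_laurent_word[OF f], of "gd ^ i"]
    by (intro normal_form_cong[OF normal_form_term[OF laurent_mult[OF laurent_X_inv f], of i]]) metis
next
  case Gen_d
  have "gd * (laurent_word f * gd ^ i) - (laurent_word f * gd ^ Suc i + laurent_word (fls_deriv f) * gd ^ i) =
     (gd * laurent_word f - laurent_word f * gd - laurent_word (fls_deriv f)) * gd ^ i"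
    by (simp add: algebra_simps)
  then show ?thesis unfolding Gen_d
    using weyl_ideal_mult_r[OF d_laurent_word[OF f], of "gd ^ i"]
    by (intro normal_form_cong[OF normal_form_add[OF normal_form_term[OF f, of "Suc i"] normal_form_term[OF laurent_deriv[OF f], of i]]])
       metis
qed

lemma weyl_normal_form: "weyl_normal_form p"
proof -
  have "p \<in> carrier (free_algebra UNIV)" by simp
  then show ?thesis
  proof (induction p rule: free_algebra_induct)
    case (const c)
    have "laurent_word (fls_const c) = fconst c"
      using laurent_word_lmonom[where c = c and n = 0] by (simp add: t_power_word_def mult_single plus_list_def)
    then show ?case using normal_form_term[OF laurent_const[of c], of 0] by simp
  next
    case (add p q)
    then show ?case by (intro normal_form_add)
  next
    case (gen g p)
    obtain n f where f: "\<And>i. f i \<in> laurent_polys" "p - (normal_sum n f) \<in> weyl_ideal"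
      using gen unfolding weyl_normal_form_def by blast
    show ?case
    proof (rule normal_form_cong)
      show "weyl_normal_form (\<Sum>i<n. fgen g * (laurent_word (f i) * gd ^ i))"
        by (intro normal_form_sum normal_form_gen f)
      show "fgen g * p - (\<Sum>i<n. fgen g * (laurent_word (f i) * gd ^ i)) \<in> weyl_ideal"
        using weyl_ideal_mult_l[OF f(2), of "fgen g"] by (simp add: right_diff_distrib sum_distrib_left)
    qed
  qed
qed

lemma weyl_action_hom_aux:
  fixes \<eta> :: "'k::field \<Rightarrow> 'k fls \<Rightarrow> 'k fls"
  defines "\<eta> \<equiv> \<lambda>c r. fls_const c * r"
  defines "S \<equiv> additive_endomorphism_ring :: ('k fls \<Rightarrow> 'k fls) ring"
  shows "weyl_action \<in> ring_hom weyl_algebra S"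
    and "weyl_action (weyl_class (fconst c)) = \<eta> c"
    and "weyl_action (weyl_class (fgen g)) = (weyl_gen_action g :: 'k fls \<Rightarrow> 'k fls)"
proof -
  let ?F = "free_lift S \<eta> weyl_gen_action"
  have S: "ring S" unfolding S_def by (rule ring_additive_endomorphism_ring)
  have \<eta>: "\<eta> \<in> ring_hom ring_of_type_algebra S"
    unfolding ring_hom_def S_def \<eta>_def
    by (auto simp: additive_endomorphism_ring_def ring_of_type_algebra_def additive_def distrib_left
      distrib_right fun_eq_iff mult.assoc simp flip: fls_plus_const fls_const_mult_const)
  have central: "\<eta> c \<otimes>\<^bsub>S\<^esub> weyl_gen_action g = weyl_gen_action g \<otimes>\<^bsub>S\<^esub> \<eta> c"
    if "g \<in> UNIV" for c g
    by (cases g) (auto simp: S_def \<eta>_def additive_endomorphism_ring_def fun_eq_iff fls_deriv_mult_const_left)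
  have gen: "weyl_gen_action g \<in> carrier S" if "g \<in> UNIV" for g
    by (cases g) (auto simp: S_def additive_endomorphism_ring_def additive_def distrib_left)
  note fl = free_lift_hom[where B = "UNIV :: weyl_gen set" and \<eta> = \<eta> and \<phi> = weyl_gen_action, OF S \<eta> central gen]
  have add: "?F (p + q) v = ?F p v + ?F q v" for p q v
    using ring_hom_add[OF fl(1), of p q] by (simp add: free_algebra_ops S_def additive_endomorphism_ring_def)
  have mult: "?F (p * q) v = ?F p (?F q v)" for p q v
    using ring_hom_mult[OF fl(1), of p q] by (simp add: free_algebra_ops S_def additive_endomorphism_ring_def)
  have one: "?F 1 v = v" for v
    using ring_hom_one[OF fl(1)] by (simp add: free_algebra_ops S_def additive_endomorphism_ring_def)
  have diff: "?F (p - q) v = ?F p v - ?F q v" for p q v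
    using add[of "p - q" q v] by simp
  have X: "fls_X * fls_X_inv = (1 :: 'k fls)" by (simp add: fls_X_times_conv_shift)
  have kill: "?F r = \<zero>\<^bsub>S\<^esub>" if "r \<in> weyl_relations" for r
  proof -
    have "?F r v = 0" for v
      using that X unfolding weyl_relations_def
      by (auto simp: diff mult one fl(3) mult.assoc[symmetric] mult.commute[of fls_X_inv])
    then show ?thesis by (simp add: S_def additive_endomorphism_ring_def fun_eq_iff)
  qed
  note pl = presented_lift_hom[where \<phi> = weyl_gen_action, OF S \<eta> central gen Weyl.rels_closed kill]
  have eq: "weyl_action = presented_lift S \<eta> weyl_gen_action"
    by (simp add: weyl_action_def S_def \<eta>_def)
  show "weyl_action \<in> ring_hom weyl_algebra S" unfolding eq weyl_algebra_def by (rule pl(1))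
  show "weyl_action (weyl_class (fconst c)) = \<eta> c"
    unfolding eq weyl_class_def using pl(2) fl(2) by simp
  show "weyl_action (weyl_class (fgen g)) = (weyl_gen_action g :: 'k fls \<Rightarrow> 'k fls)"
    unfolding eq weyl_class_def using pl(2) fl(3) by simp
qed

lemma weyl_action_hom: "weyl_action \<in> ring_hom weyl_algebra additive_endomorphism_ring"
  and weyl_action_const: "weyl_action (weyl_class (fconst c)) r = fls_const c * r"
  and weyl_action_gen: "weyl_action (weyl_class (fgen g)) r = weyl_gen_action g r"
  using weyl_action_hom_aux by (auto simp: fun_eq_iff)

lemma weyl_action_add:
  "u \<in> carrier weyl_algebra \<Longrightarrow> v \<in> carrier weyl_algebra \<Longrightarrow>
   weyl_action (u \<oplus>\<^bsub>weyl_algebra\<^esub> v) r = weyl_action u r + weyl_action v r"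
  by (simp add: ring_hom_add[OF weyl_action_hom]) (simp add: additive_endomorphism_ring_def)

lemma weyl_action_mult:
  "u \<in> carrier weyl_algebra \<Longrightarrow> v \<in> carrier weyl_algebra \<Longrightarrow>
   weyl_action (u \<otimes>\<^bsub>weyl_algebra\<^esub> v) r = weyl_action u (weyl_action v r)"
  by (simp add: ring_hom_mult[OF weyl_action_hom]) (simp add: additive_endomorphism_ring_def)

lemma weyl_action_add_right:
  assumes "u \<in> carrier weyl_algebra"
  shows "weyl_action u (r + s) = weyl_action u r + weyl_action u s"
  using ring_hom_closed[OF weyl_action_hom assms] by (simp add: additive_endomorphism_ring_def additive_def)

lemma weyl_class_closed: "weyl_class p \<in> carrier weyl_algebra"
  using Weyl.cls_closed[of p] by (simp add: weyl_fold)

lemma weyl_class_add: "weyl_class (p + q) = weyl_class p \<oplus>\<^bsub>weyl_algebra\<^esub> weyl_class q"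
  using Weyl.cls_add[of p q] by (simp add: weyl_fold)

lemma ring_weyl_algebra: "ring weyl_algebra"
  using Weyl.A.ring_axioms by (simp add: weyl_fold)

lemma weyl_class_0: "weyl_class (0 :: ('k::field) weyl_word_poly) = \<zero>\<^bsub>weyl_algebra\<^esub>"
proof -
  interpret A: ring "weyl_algebra :: ('k weyl_word_poly) set ring" by (rule ring_weyl_algebra)
  have "weyl_class 0 \<oplus>\<^bsub>weyl_algebra\<^esub> weyl_class 0 = weyl_class (0 :: 'k weyl_word_poly)"
    using weyl_class_add[of 0 0, symmetric] by simp
  then show ?thesis using weyl_class_closed[of "0 :: 'k weyl_word_poly"] by simp
qed

lemma weyl_class_mult: "weyl_class (p * q) = weyl_class p \<otimes>\<^bsub>weyl_algebra\<^esub> weyl_class q"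
  using Weyl.cls_mult[of p q] by (simp add: weyl_fold)

lemma weyl_class_eqI: "p - q \<in> weyl_ideal \<Longrightarrow> weyl_class p = weyl_class q"
  using Weyl.cls_eqI[of p q] by (simp add: weyl_fold)

abbreviation weyl_op :: "(('k::field) weyl_word_poly) \<Rightarrow> 'k fls \<Rightarrow> 'k fls" where
  "weyl_op p \<equiv> weyl_action (weyl_class p)"

lemma weyl_op_add: "weyl_op (p + q) r = weyl_op p r + weyl_op q r"
  by (simp add: weyl_class_add weyl_action_add weyl_class_closed)

lemma weyl_op_mult: "weyl_op (p * q) r = weyl_op p (weyl_op q r)"
  by (simp add: weyl_class_mult weyl_action_mult weyl_class_closed)

lemma weyl_op_0: "weyl_op 0 r = 0"
  using weyl_op_add[of 0 0 r] by (metis add_0 add_cancel_right_left)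

lemma weyl_op_1: "weyl_op 1 r = r"
  by (simp only: one_eq_fconst weyl_action_const) simp

lemma weyl_op_sum: "weyl_op (\<Sum>i\<in>A. p i) r = (\<Sum>i\<in>A. weyl_op (p i) r)"
  by (induction A rule: infinite_finite_induct) (simp_all add: weyl_op_0 weyl_op_add)

lemma weyl_op_laurent_word:
  assumes "f \<in> laurent_polys" shows "weyl_op (laurent_word f) r = f * r"
  using assms
proof (induction f arbitrary: r rule: laurent_induct)
  case (monom c n)
  have "weyl_op (gt ^ m) r = fls_X ^ m * r" "weyl_op (gu ^ m) r = fls_X_inv ^ m * r"
    for m and r :: "'a fls"
    by (induction m) (simp_all add: weyl_op_1 weyl_op_mult weyl_action_gen mult.assoc)
  moreover have "Poly_Mapping.single (replicate m g) 1 = (fgen g :: _ \<Rightarrow>\<^sub>0 'a) ^ m" for m and g :: weyl_gen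
  proof (induction m)
    case 0
    show ?case by (simp only: replicate_0 power_0 one_eq_fconst)
  next
    case (Suc m)
    have "fgen g * (Poly_Mapping.single (replicate m g) 1 :: _ \<Rightarrow>\<^sub>0 'a) = Poly_Mapping.single (replicate (Suc m) g) 1"
      by (simp add: mult_single plus_list_def)
    then show ?case using Suc by simp
  qed
  ultimately have "weyl_op (tpow n) r = fls_X_intpow n * r"
    by (simp add: t_power_word_def fls_X_power_conv_shift_1 fls_X_inv_power_conv_shift_1)
  then show ?case
    by (simp add: laurent_word_lmonom weyl_op_mult weyl_action_const lmonom_mult fls_X_intpow_times_conv_shift)
next
  case (add f g)
  then show ?case by (simp add: laurent_word_add weyl_op_add distrib_right)
qed

lemma weyl_op_d_power: "weyl_op (gd ^ i) r = (fls_deriv ^^ i) r"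
  by (induction i) (simp_all add: weyl_op_1 weyl_op_mult weyl_action_gen)

lemma deriv_power_X_mult:
  "(fls_deriv ^^ i) (fls_X * r) = fls_X * (fls_deriv ^^ i) r + of_nat i * (fls_deriv ^^ (i - 1)) r"
proof (induction i)
  case (Suc i)
  have "fls_deriv (of_nat i * (fls_deriv ^^ (i - 1)) r) = of_nat i * (fls_deriv ^^ i) r"
    by (cases i) (simp_all del: of_nat_Suc)
  then show ?case by (simp add: Suc algebra_simps)
qed simp

text \<open>
  The commutator of \<open>\<Sum> f\<^sub>i D\<^sup>i\<close> with multiplication by \<open>t\<close> is \<open>\<Sum> i f\<^sub>i D\<^bsup>i-1\<^esup>\<close>, an operator of lower order
  that also has no poles in its values. By induction all \<open>i f\<^sub>i\<close> vanish, and \<open>f\<^sub>0\<close> is then divisible by all powers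
  of \<open>t - x\<close>.
\<close>

lemma differential_operator_vanishes:
  fixes x :: "'k::field_char_0"
  assumes x: "x \<noteq> 0" and "\<And>i. f i \<in> laurent_polys"
    and "\<And>r. r \<in> localised x \<Longrightarrow> (\<Sum>i<n. f i * (fls_deriv ^^ i) r) \<in> laurent_polys"
    and "i < n"
  shows "f i = 0"
  using assms(2-)
proof (induction n arbitrary: f i)
  case (Suc n)
  have shifted: "of_nat (Suc i) * f (Suc i) = 0" if "i < n" for i
  proof (rule Suc.IH[OF _ _ that])
    show "of_nat (Suc i) * f (Suc i) \<in> laurent_polys" for i
      by (intro laurent_mult laurent_of_nat Suc.prems)
    fix r assume r: "r \<in> localised x"
    let ?P = "\<lambda>r. \<Sum>i<Suc n. f i * (fls_deriv ^^ i) r"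
    have "?P (fls_X * r) - fls_X * ?P r = (\<Sum>i<Suc n. of_nat i * f i * (fls_deriv ^^ (i - 1)) r)"
      unfolding sum_distrib_left sum_subtractf[symmetric]
      by (intro sum.cong refl) (simp add: deriv_power_X_mult algebra_simps)
    also have "\<dots> = (\<Sum>i<n. of_nat (Suc i) * f (Suc i) * (fls_deriv ^^ i) r)"
      by (subst sum.lessThan_Suc_shift) simp
    finally have "\<dots> = ?P (fls_X * r) - fls_X * ?P r" by simp
    also have "\<dots> \<in> laurent_polys"
      by (intro laurent_diff laurent_mult[OF laurent_X] Suc.prems localised_mult[OF laurent_X] r)
    finally show "(\<Sum>i<n. of_nat (Suc i) * f (Suc i) * (fls_deriv ^^ i) r) \<in> laurent_polys" .
  qed
  then have higher: "f (Suc i) = 0" if "i < n" for i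
    using that by (auto simp del: of_nat_Suc)
  have "f 0 * pole x m \<in> laurent_polys" for m
    using Suc.prems(2)[OF localised_pole, of m] by (subst (asm) sum.lessThan_Suc_shift) (simp add: higher)
  then have "f 0 = 0" by (rule laurent_zero_of_infinite_order[OF x Suc.prems(1)])
  then show ?case using higher Suc.prems(3) by (cases i) auto
qed simp

text \<open>
  The case \<open>k = 0\<close> says that the Weyl algebra acts faithfully on principal parts at \<open>x\<close>; the case \<open>k = 1\<close>
  adds that right multiplication by \<open>\<partial>\<close> is injective. Composition with \<open>\<partial>\<^sup>k\<close> merely shifts the coefficients
  of a normal form.
\<close>

lemma weyl_action_faithful_deriv:
  fixes x :: "'k::field_char_0"
  assumes x: "x \<noteq> 0" and u: "u \<in> carrier weyl_algebra"
    and "\<And>r. r \<in> localised x \<Longrightarrow> weyl_action u ((fls_deriv ^^ k) r) \<in> laurent_polys"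
  shows "u = \<zero>\<^bsub>weyl_algebra\<^esub>"
proof -
  obtain p where p: "u = weyl_class p" using u Weyl.carrier_A by (auto simp: weyl_fold)
  obtain n f where f: "\<And>i. f i \<in> laurent_polys"
    and "p - (normal_sum n f) \<in> weyl_ideal"
    using weyl_normal_form[of p] unfolding weyl_normal_form_def by blast
  then have u_eq: "u = weyl_class (normal_sum n f)"
    unfolding p by (intro weyl_class_eqI)
  define g where "g i = (if i < k then 0 else f (i - k))" for i
  have g: "g i \<in> laurent_polys" for i by (simp add: g_def f laurent_0)
  have "weyl_action u ((fls_deriv ^^ k) r) = (\<Sum>i<n. f i * (fls_deriv ^^ (i + k)) r)" for r
    by (simp add: u_eq weyl_op_sum weyl_op_mult weyl_op_laurent_word[OF f] weyl_op_d_power funpow_add)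
  also have "(\<Sum>i<n. f i * (fls_deriv ^^ (i + k)) r) = (\<Sum>i<n + k. g i * (fls_deriv ^^ i) r)" for r
    by (rule sum.reindex_bij_witness_not_neutral[where i = "\<lambda>i. i - k" and j = "\<lambda>i. i + k"
          and S' = "{}" and T' = "{..<k}"]) (auto simp: g_def)
  finally have "(\<Sum>i<n + k. g i * (fls_deriv ^^ i) r) \<in> laurent_polys" if "r \<in> localised x" for r
    using assms(3)[OF that] by simp
  then have "g (i + k) = 0" if "i < n" for i
    using that by (intro differential_operator_vanishes[OF x g]) auto
  then have "f i = 0" if "i < n" for i using that by (simp add: g_def)
  then have "u = weyl_class 0" unfolding u_eq by (simp add: laurent_word_0)
  then show ?thesis by (simp add: weyl_class_0)
qed

lemmas weyl_action_faithful = weyl_action_faithful_deriv[where k = 0, simplified]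

lemma weyl_action_injective:
  fixes u v :: "('k::field_char_0 weyl_word_poly) set"
  assumes "u \<in> carrier weyl_algebra" "v \<in> carrier weyl_algebra"
    and "\<And>r. weyl_action u r = weyl_action v r"
  shows "u = v"
proof -
  interpret A: ring "weyl_algebra :: ('k weyl_word_poly) set ring" by (rule ring_weyl_algebra)
  have "weyl_action (u \<ominus>\<^bsub>weyl_algebra\<^esub> v) r + weyl_action v r = weyl_action u r" for r
    using assms(1,2) by (simp add: weyl_action_add[symmetric] A.minus_eq A.a_assoc A.l_neg)
  then have "weyl_action (u \<ominus>\<^bsub>weyl_algebra\<^esub> v) r = 0" for r using assms(3) by simp
  then have "u \<ominus>\<^bsub>weyl_algebra\<^esub> v = \<zero>\<^bsub>weyl_algebra\<^esub>"
    using weyl_action_faithful[of 1 "u \<ominus>\<^bsub>weyl_algebra\<^esub> v"] assms(1,2) by (simp add: laurent_0)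
  then show ?thesis using assms(1,2) by simp
qed

section \<open>The Witt algebra acting on principal parts\<close>

interpretation Witt: enveloping witt_scale witt_bracket "laurent_polys :: 'k::field fls set"
  by unfold_locales (auto simp: witt_bracket_def intro!: laurent_closed)

lemma U_W_eq: "U_W = presented_algebra laurent_polys (env_relations witt_scale witt_bracket laurent_polys)"
  by (simp add: U_W_def env_algebra_def)

lemmas U_W_fold = U_W_eq[symmetric] U_W_class_def[symmetric]

lemma ring_U_W: "ring U_W"
  unfolding U_W_eq by (rule Witt.A.ring_axioms)

lemma weyl_action_witt:
  assumes "f \<in> laurent_polys"
  shows "weyl_action (witt_to_weyl \<gamma> f) r = f * fls_deriv r + fls_const \<gamma> * (fls_deriv f * r)"
  using assms
  by (simp add: witt_to_weyl_def weyl_op_add weyl_op_mult weyl_op_laurent_word laurent_deriv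
      weyl_action_gen weyl_action_const)

lemma weyl_const_hom: "(\<lambda>c. weyl_class (fconst c)) \<in> ring_hom ring_of_type_algebra weyl_algebra"
  using Weyl.const_hom by (simp add: weyl_fold)

text \<open>
  The relations of \<open>U(W)\<close> have to be verified in the Weyl algebra; since that algebra acts faithfully
  on functions, they can be verified for differential operators.
\<close>

lemma weyl_pi_lift:
  fixes \<gamma> :: "'k::field_char_0"
  shows weyl_pi_hom: "weyl_pi \<gamma> \<in> ring_hom U_W weyl_algebra"
    and weyl_pi_const: "weyl_pi \<gamma> (U_W_class (fconst c)) = weyl_class (fconst c)"
    and weyl_pi_gen: "f \<in> laurent_polys \<Longrightarrow> weyl_pi \<gamma> (U_W_class (fgen f)) = witt_to_weyl \<gamma> f"
proof -
  interpret A: ring "weyl_algebra :: ('k weyl_word_poly) set ring" by (rule ring_weyl_algebra)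
  let ?A = "weyl_algebra :: ('k weyl_word_poly) set ring"
  let ?\<eta> = "\<lambda>c. weyl_class (fconst c) :: ('k weyl_word_poly) set"
  let ?\<phi> = "witt_to_weyl \<gamma>"
  have \<phi>: "?\<phi> f \<in> carrier weyl_algebra" for f
    unfolding witt_to_weyl_def by (rule weyl_class_closed)
  have \<eta>: "?\<eta> c \<in> carrier weyl_algebra" for c by (rule weyl_class_closed)
  have central: "?\<eta> c \<otimes>\<^bsub>?A\<^esub> ?\<phi> f = ?\<phi> f \<otimes>\<^bsub>?A\<^esub> ?\<eta> c" for c f
    unfolding witt_to_weyl_def weyl_class_mult[symmetric] by (simp only: fconst_central)
  note act = weyl_action_add weyl_action_mult weyl_action_witt weyl_action_const laurent_closed \<phi> \<eta>
    fls_deriv_mult_const_left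
  have br_laurent: "witt_bracket f g \<in> laurent_polys" if "f \<in> laurent_polys" "g \<in> laurent_polys" for f g :: "'k fls"
    using that by (rule Witt.L_br)
  have add: "?\<phi> (f + g) = ?\<phi> f \<oplus>\<^bsub>?A\<^esub> ?\<phi> g"
    if "f \<in> laurent_polys" "g \<in> laurent_polys" for f g
    using that by (intro weyl_action_injective \<phi> A.a_closed) (simp add: act algebra_simps)
  have scl: "?\<phi> (fls_const c * f) = ?\<eta> c \<otimes>\<^bsub>?A\<^esub> ?\<phi> f" if "f \<in> laurent_polys" for c f
    using that by (intro weyl_action_injective \<phi> \<eta> A.m_closed) (simp add: act algebra_simps)
  have br: "?\<phi> f \<otimes>\<^bsub>?A\<^esub> ?\<phi> g =
      ?\<phi> g \<otimes>\<^bsub>?A\<^esub> ?\<phi> f \<oplus>\<^bsub>?A\<^esub> ?\<phi> (witt_bracket f g)"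
    if "f \<in> laurent_polys" "g \<in> laurent_polys" for f g
  proof (rule weyl_action_injective)
    fix r
    show "weyl_action (?\<phi> f \<otimes>\<^bsub>?A\<^esub> ?\<phi> g) r =
      weyl_action (?\<phi> g \<otimes>\<^bsub>?A\<^esub> ?\<phi> f \<oplus>\<^bsub>?A\<^esub> ?\<phi> (witt_bracket f g)) r"
      using that br_laurent[OF that] by (simp add: act) (simp add: witt_bracket_def algebra_simps)
  qed (intro \<phi> A.m_closed A.a_closed)+
  note lift = Witt.env_lift[where \<eta> = ?\<eta> and \<phi> = ?\<phi>, OF ring_weyl_algebra weyl_const_hom central \<phi> add scl br]
  show "weyl_pi \<gamma> \<in> ring_hom U_W weyl_algebra" unfolding weyl_pi_def U_W_eq by (rule lift(1))
  show "weyl_pi \<gamma> (U_W_class (fconst c)) = weyl_class (fconst c)"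
    unfolding weyl_pi_def U_W_class_def by (rule lift(2))
  show "weyl_pi \<gamma> (U_W_class (fgen f)) = witt_to_weyl \<gamma> f" if "f \<in> laurent_polys"
    unfolding weyl_pi_def U_W_class_def using lift(3)[of f] that by blast
qed

abbreviation "uconst c \<equiv> U_W_class (fconst c)"
abbreviation "ugen f \<equiv> U_W_class (fgen f)"

definition witt_op :: "'k::field \<Rightarrow> ('k fls list \<Rightarrow>\<^sub>0 'k) set \<Rightarrow> 'k fls \<Rightarrow> 'k fls" where
  "witt_op \<gamma> u = weyl_action (weyl_pi \<gamma> u)"

context
  fixes \<gamma> :: "'k::field_char_0"
begin

lemma weyl_pi_closed: "u \<in> carrier U_W \<Longrightarrow> weyl_pi \<gamma> u \<in> carrier weyl_algebra"
  by (rule ring_hom_closed[OF weyl_pi_hom])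

lemma witt_op_const: "witt_op \<gamma> (uconst c) r = fls_const c * r"
  by (simp add: witt_op_def weyl_pi_const weyl_action_const)

lemma witt_op_gen:
  "f \<in> laurent_polys \<Longrightarrow> witt_op \<gamma> (ugen f) r = f * fls_deriv r + fls_const \<gamma> * (fls_deriv f * r)"
  by (simp add: witt_op_def weyl_pi_gen weyl_action_witt)

lemma witt_op_add:
  "u \<in> carrier U_W \<Longrightarrow> v \<in> carrier U_W \<Longrightarrow> witt_op \<gamma> (u \<oplus>\<^bsub>U_W\<^esub> v) r = witt_op \<gamma> u r + witt_op \<gamma> v r"
  by (simp add: witt_op_def ring_hom_add[OF weyl_pi_hom] weyl_action_add weyl_pi_closed)

lemma witt_op_mult:
  "u \<in> carrier U_W \<Longrightarrow> v \<in> carrier U_W \<Longrightarrow> witt_op \<gamma> (u \<otimes>\<^bsub>U_W\<^esub> v) r = witt_op \<gamma> u (witt_op \<gamma> v r)"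
  by (simp add: witt_op_def ring_hom_mult[OF weyl_pi_hom] weyl_action_mult weyl_pi_closed)

end

lemma weyl_gen_action_closed:
  "r \<in> laurent_polys \<Longrightarrow> weyl_gen_action g r \<in> laurent_polys"
  "r \<in> localised x \<Longrightarrow> weyl_gen_action g r \<in> localised x"
  by (cases g; auto intro!: laurent_closed localised_mult localised_deriv)+

lemma weyl_action_closed:
  assumes u: "u \<in> carrier weyl_algebra"
  shows weyl_action_laurent: "r \<in> laurent_polys \<Longrightarrow> weyl_action u r \<in> laurent_polys"
    and weyl_action_localised: "r \<in> localised x \<Longrightarrow> weyl_action u r \<in> localised x"
proof -
  have gen: "weyl_class (fgen g) \<in> carrier weyl_algebra" for g by (rule weyl_class_closed)
  have "\<forall>r. (r \<in> laurent_polys \<longrightarrow> weyl_action u r \<in> laurent_polys) \<and>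
     (r \<in> localised x \<longrightarrow> weyl_action u r \<in> localised x)"
    using u unfolding weyl_algebra_def
  proof (induction u rule: Weyl.A_induct)
    case (const c)
    then show ?case
      by (simp add: weyl_fold weyl_action_const laurent_closed localised_mult)
  next
    case (add u v)
    then show ?case
      by (simp add: weyl_fold weyl_action_add laurent_add localised_add)
  next
    case (gen g u)
    then show ?case
      by (simp add: weyl_fold weyl_class_closed weyl_action_mult weyl_action_gen weyl_gen_action_closed)
  qed
  then show "r \<in> laurent_polys \<Longrightarrow> weyl_action u r \<in> laurent_polys"
    and "r \<in> localised x \<Longrightarrow> weyl_action u r \<in> localised x"
    by blast+
qed

lemma localised_left_submodule:
  fixes x :: "'k::field"
  shows "left_submodule weyl_algebra (localised_module x) laurent_polys"
proof -
  interpret A: ring "weyl_algebra :: ('k weyl_word_poly) set ring" by (rule ring_weyl_algebra)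
  have one: "\<one>\<^bsub>weyl_algebra\<^esub> = weyl_class (1 :: 'k weyl_word_poly)"
    by (simp add: Weyl.cls_one[unfolded weyl_fold])
  have "abelian_group (localised_module x)"
  proof (rule abelian_groupI, goal_cases)
    case (6 r)
    then show ?case
      by (intro bexI[of _ "- r"]) (auto simp: localised_module_def localised_uminus)
  qed (auto simp: localised_module_def algebra_simps localised_add localised_laurent laurent_0)
  moreover have "left_module_axioms weyl_algebra (localised_module x)"
    unfolding left_module_axioms_def
    by (auto simp: localised_module_def weyl_action_localised weyl_action_add weyl_action_add_right
        weyl_action_mult one weyl_op_1)
  ultimately have M: "left_module weyl_algebra (localised_module x)"
    by (simp add: left_module_def A.ring_axioms)
  then have "submodule laurent_polys weyl_algebra (localised_module x)"
    by (rule left_module.submoduleI)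
       (auto simp: localised_module_def localised_laurent laurent_add weyl_action_laurent intro: laurent_0)
  with M show ?thesis by (simp add: left_submodule_def)
qed

definition principal_part :: "'k::field \<Rightarrow> 'k fls \<Rightarrow> 'k fls set" where
  "principal_part x r = laurent_polys +>\<^bsub>localised_module x\<^esub> r"

lemma principal_part_eq: "principal_part x r = {l + r | l. l \<in> laurent_polys}"
  by (auto simp: principal_part_def a_r_coset_def' localised_module_def)

text \<open>
  Principal parts are the elements of \<open>N\<^sub>x\<close>, for all \<open>\<gamma>\<close>; only the action of \<open>U(W)\<close> on them depends
  on \<open>\<gamma>\<close>.
\<close>

lemma principal_part_eq_iff:
  "principal_part x r = principal_part x s \<longleftrightarrow> r - s \<in> laurent_polys"
proof
  assume "principal_part x r = principal_part x s"
  moreover have "0 + r \<in> principal_part x r" unfolding principal_part_eq using laurent_0 by blast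
  ultimately show "r - s \<in> laurent_polys" unfolding principal_part_eq by auto
next
  assume rs: "r - s \<in> laurent_polys"
  have "l + r = (l + (r - s)) + s" "l + s = (l - (r - s)) + r" for l by simp_all
  then show "principal_part x r = principal_part x s"
    unfolding principal_part_eq using laurent_add[OF _ rs] laurent_diff[OF _ rs] by blast
qed

lemma principal_part_zero_iff: "principal_part x r = principal_part x 0 \<longleftrightarrow> r \<in> laurent_polys"
  using principal_part_eq_iff[of x r 0] by simp

lemma the_elem_principal_part:
  assumes "\<And>l. l \<in> laurent_polys \<Longrightarrow> h (l + r) = h r"
  shows "the_elem (h ` principal_part x r) = h r"
proof -
  have "h ` principal_part x r = {h r}"
    unfolding principal_part_eq using assms laurent_0 by (auto simp: image_iff)
  then show ?thesis by simp
qed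

context
  fixes x \<gamma> :: "'k::field_char_0"
begin

interpretation L: left_submodule weyl_algebra "localised_module x" laurent_polys
  by (rule localised_left_submodule)

lemma N_left_module: "left_module U_W (N_module x \<gamma>)"
  unfolding N_module_def N_weyl_def
  by (rule restrict_scalars_left_module[OF L.quotient_left_module ring_U_W weyl_pi_hom])

lemma N_carrier: "carrier (N_module x \<gamma>) = principal_part x ` localised x"
  using L.quotient_carrier
  by (simp add: N_module_def N_weyl_def restrict_scalars_def principal_part_def[abs_def] localised_module_def)

lemma N_zero: "\<zero>\<^bsub>N_module x \<gamma>\<^esub> = principal_part x 0"
  using L.quotient_zero by (simp add: N_module_def N_weyl_def restrict_scalars_def principal_part_eq)

lemma N_add:
  "r \<in> localised x \<Longrightarrow> s \<in> localised x \<Longrightarrow>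
   principal_part x r \<oplus>\<^bsub>N_module x \<gamma>\<^esub> principal_part x s = principal_part x (r + s)"
  using L.quotient_add[of r s]
  by (simp add: N_module_def N_weyl_def restrict_scalars_def principal_part_def localised_module_def)

lemma N_smult:
  "u \<in> carrier U_W \<Longrightarrow> r \<in> localised x \<Longrightarrow>
   u \<odot>\<^bsub>N_module x \<gamma>\<^esub> principal_part x r = principal_part x (witt_op \<gamma> u r)"
  using L.quotient_smult[OF weyl_pi_closed[of u \<gamma>], of r]
  by (simp add: N_module_def N_weyl_def restrict_scalars_def principal_part_def localised_module_def witt_op_def)

lemma witt_op_localised:
  "u \<in> carrier U_W \<Longrightarrow> r \<in> localised x \<Longrightarrow> witt_op \<gamma> u r \<in> localised x"
  by (simp add: witt_op_def weyl_action_localised weyl_pi_closed)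

lemma U_W_const_closed: "uconst c \<in> carrier U_W"
  using Witt.cls_closed[OF free_algebra_closed(1)] by (simp add: U_W_fold)

lemma U_W_gen_closed: "f \<in> laurent_polys \<Longrightarrow> ugen f \<in> carrier U_W"
  using Witt.cls_closed[OF free_algebra_closed(2)] by (simp add: U_W_fold)

lemma N_const:
  "r \<in> localised x \<Longrightarrow>
   uconst c \<odot>\<^bsub>N_module x \<gamma>\<^esub> principal_part x r = principal_part x (fls_const c * r)"
  by (simp add: N_smult U_W_const_closed witt_op_const)

lemma N_gen:
  "f \<in> laurent_polys \<Longrightarrow> r \<in> localised x \<Longrightarrow>
   ugen f \<odot>\<^bsub>N_module x \<gamma>\<^esub> principal_part x r =
   principal_part x (f * fls_deriv r + fls_const \<gamma> * (fls_deriv f * r))"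
  by (simp add: N_smult U_W_gen_closed witt_op_gen)

lemma N_annihilator:
  assumes x: "x \<noteq> 0"
  shows "module_annihilator U_W (N_module x \<gamma>) = a_kernel U_W weyl_algebra (weyl_pi \<gamma>)"
proof -
  have "(\<forall>m\<in>carrier (N_module x \<gamma>). u \<odot>\<^bsub>N_module x \<gamma>\<^esub> m = \<zero>\<^bsub>N_module x \<gamma>\<^esub>)
      \<longleftrightarrow> weyl_pi \<gamma> u = \<zero>\<^bsub>weyl_algebra\<^esub>" if u: "u \<in> carrier U_W" for u
  proof -
    have "(\<forall>m\<in>carrier (N_module x \<gamma>). u \<odot>\<^bsub>N_module x \<gamma>\<^esub> m = \<zero>\<^bsub>N_module x \<gamma>\<^esub>)
      \<longleftrightarrow> (\<forall>r\<in>localised x. weyl_action (weyl_pi \<gamma> u) r \<in> laurent_polys)"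
      using u by (simp add: N_carrier N_zero N_smult principal_part_zero_iff witt_op_def)
    also have "\<dots> \<longleftrightarrow> weyl_pi \<gamma> u = \<zero>\<^bsub>weyl_algebra\<^esub>"
      using weyl_action_faithful[OF x weyl_pi_closed[OF u]]
      by (auto simp: weyl_class_0[symmetric] weyl_op_0 laurent_0)
    finally show ?thesis .
  qed
  then show ?thesis by (auto simp: module_annihilator_def a_kernel_def')
qed

end

section \<open>Simplicity\<close>

text \<open>
  Differentiation produces all poles from the simple one, up to nonzero factors.
\<close>

lemma N_generated_by_simple_pole:
  fixes x \<gamma> :: "'k::field_char_0"
  assumes x: "x \<noteq> 0" and H: "submodule H U_W (N_module x \<gamma>)" and pole: "principal_part x (pole x 0) \<in> H"
  shows "H = carrier (N_module x \<gamma>)"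
proof -
  let ?N = "N_module x \<gamma>"
  interpret H: left_submodule U_W ?N H
    using H by (simp add: left_submodule_def N_left_module)
  have smult: "u \<odot>\<^bsub>?N\<^esub> m \<in> H" if "u \<in> carrier U_W" "m \<in> H" for u m
    using that by (rule H.H.smult_closed)
  have poles: "principal_part x (pole x n) \<in> H" for n
  proof (induction n)
    case (Suc n)
    have "uconst (- 1 / of_nat (Suc n)) \<odot>\<^bsub>?N\<^esub>
        (ugen 1 \<odot>\<^bsub>?N\<^esub> principal_part x (pole x n)) \<in> H"
      by (intro smult U_W_const_closed U_W_gen_closed laurent_1 Suc)
    also have "ugen 1 \<odot>\<^bsub>?N\<^esub> principal_part x (pole x n) =
        principal_part x (fls_deriv (pole x n))"
      by (simp add: N_gen laurent_1 localised_pole)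
    also have "uconst (- 1 / of_nat (Suc n)) \<odot>\<^bsub>?N\<^esub> \<dots> =
        principal_part x (fls_const (- 1 / of_nat (Suc n)) * fls_deriv (pole x n))"
      by (intro N_const localised_deriv localised_pole)
    also have "fls_const (- 1 / of_nat (Suc n)) * fls_deriv (pole x n) =
        (fls_const (- 1 / of_nat (Suc n)) * - of_nat (Suc n)) * pole x (Suc n)"
      by (simp only: deriv_pole mult.assoc)
    also have "fls_const (- 1 / of_nat (Suc n)) * - of_nat (Suc n) = (1 :: 'k fls)"
      by (simp add: fls_of_nat del: of_nat_Suc)
    finally show ?case by simp
  qed (rule pole)
  have "principal_part x r \<in> H" if "r \<in> localised x" for r
    using x that
  proof (induction r rule: localised_induct)
    case (laurent f)
    then have "principal_part x f = \<zero>\<^bsub>?N\<^esub>" by (simp add: N_zero principal_part_zero_iff)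
    then show ?case using H.H.zero_closed by simp
  next
    case (add r s)
    then show ?case using H.H.a_closed[of "principal_part x r" "principal_part x s"] by (simp add: N_add)
  next
    case (pole c n)
    have "uconst c \<odot>\<^bsub>?N\<^esub> principal_part x (pole x n) \<in> H"
      by (intro smult U_W_const_closed poles)
    then show ?case by (simp add: N_const localised_pole)
  qed
  then show ?thesis using H.H.a_subset by (auto simp: N_carrier)
qed

lemma simple_pole_nonzero:
  "x \<noteq> 0 \<Longrightarrow> principal_part x (pole x 0) \<noteq> principal_part x 0"
  using pole_not_laurent[of x 1 0] by (auto simp: principal_part_zero_iff)

lemma lin_power_pole_0: "lin x ^ n * pole x n = pole x 0"
proof (induction n)
  case (Suc n)
  have "lin x ^ Suc n * pole x (Suc n) = lin x ^ n * (lin x * pole x (Suc n))"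
    by (simp only: power_Suc2 mult.assoc)
  then show ?case by (simp only: lin_power_pole(2) Suc)
qed simp

lemma simple_pole_part:
  assumes "x \<noteq> 0" "g \<in> laurent_polys"
  shows "g * pole x 0 - fls_const (laurent_eval g x) * pole x 0 \<in> laurent_polys"
proof -
  obtain h where h: "h \<in> laurent_polys" "g = fls_const (laurent_eval g x) + lin x * h"
    using laurent_factor[OF assms] by blast
  have "g * pole x 0 = fls_const (laurent_eval g x) * pole x 0 + h * (lin x * pole x 0)"
    by (subst h(2)) (simp add: algebra_simps)
  then show ?thesis using h(1) by (simp add: lin_power_pole(3))
qed

lemma N_simple:
  fixes x \<gamma> :: "'k::field_char_0"
  assumes x: "x \<noteq> 0" and \<gamma>: "\<gamma> \<noteq> 1"
  shows "simple_left_module U_W (N_module x \<gamma>)"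
  unfolding simple_left_module_def
proof (intro conjI allI impI)
  let ?N = "N_module x \<gamma>"
  show "left_module U_W ?N" by (rule N_left_module)
  show "carrier ?N \<noteq> {\<zero>\<^bsub>?N\<^esub>}"
    using simple_pole_nonzero[OF x] localised_pole[of x 0] by (auto simp: N_carrier N_zero)
  fix H assume sub: "submodule H U_W ?N"
  interpret H: left_submodule U_W ?N H
    using sub by (simp add: left_submodule_def N_left_module)
  show "H = {\<zero>\<^bsub>?N\<^esub>} \<or> H = carrier ?N"
  proof (cases "H = {\<zero>\<^bsub>?N\<^esub>}")
    case False
    then obtain m where m: "m \<in> H" "m \<noteq> \<zero>\<^bsub>?N\<^esub>" using H.H.zero_closed by blast
    then have "m \<in> carrier ?N" using H.H.a_subset by blast
    then obtain r where r: "r \<in> localised x" "m = principal_part x r"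
      by (auto simp: N_carrier)
    have "r \<notin> laurent_polys" using m(2) r by (simp add: N_zero principal_part_zero_iff)
    then obtain n g where g: "g \<in> laurent_polys" "laurent_eval g x \<noteq> 0" "r = g * pole x n"
      using localised_leading_pole[OF x r(1)] by blast
    \<comment> \<open>This power of \<open>t - x\<close> clears the denominator of \<open>r\<close>; the term \<open>f'r\<close> keeps a simple pole, and
      \<open>f r' + \<gamma> f'r = (f r)' + (\<gamma> - 1) f'r\<close>.\<close>
    define f where "f = lin x ^ Suc n"
    have f: "f \<in> laurent_polys" unfolding f_def by (intro laurent_power laurent_lin)
    have fr: "f * r = g"
      using lin_power_pole(1)[of x n] by (simp add: f_def g(3) mult.left_commute)
    have "fls_deriv f = of_nat (Suc n) * lin x ^ n"
      by (simp add: f_def fls_deriv_power del: power_Suc of_nat_Suc)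
    then have f'r: "fls_deriv f * r = of_nat (Suc n) * (g * pole x 0)"
      by (simp add: g(3) mult_ac flip: lin_power_pole_0[of x n])
    have "f * fls_deriv r + fls_const \<gamma> * (fls_deriv f * r) =
        fls_deriv (f * r) + fls_const (\<gamma> - 1) * (fls_deriv f * r)"
      by (simp add: algebra_simps flip: fls_minus_const)
    also have "\<dots> = fls_deriv g + fls_const ((\<gamma> - 1) * of_nat (Suc n)) * (g * pole x 0)"
      unfolding fr f'r by (simp add: fls_of_nat mult.assoc flip: fls_const_mult_const del: of_nat_Suc)
    finally have eq: "f * fls_deriv r + fls_const \<gamma> * (fls_deriv f * r) = \<dots>" .
    define c where "c = (\<gamma> - 1) * of_nat (Suc n)"
    have c: "c \<noteq> 0" using \<gamma> by (simp add: c_def del: of_nat_Suc)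
    have "ugen f \<odot>\<^bsub>?N\<^esub> m = principal_part x (fls_deriv g + fls_const c * (g * pole x 0))"
      unfolding r(2) N_gen[OF f r(1)] eq c_def ..
    also have "\<dots> = principal_part x (fls_const (c * laurent_eval g x) * pole x 0)"
    proof -
      have "fls_deriv g + fls_const c * (g * pole x 0 - fls_const (laurent_eval g x) * pole x 0) \<in> laurent_polys"
        using x g(1) by (intro laurent_add laurent_mult laurent_const laurent_deriv simple_pole_part)
      then show ?thesis unfolding principal_part_eq_iff
        by (simp add: algebra_simps flip: fls_const_mult_const)
    qed
    finally have "principal_part x (fls_const (c * laurent_eval g x) * pole x 0) \<in> H"
      using H.H.smult_closed[OF U_W_gen_closed[OF f] m(1)] by simp
    then have "uconst (1 / (c * laurent_eval g x)) \<odot>\<^bsub>?N\<^esub>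
        principal_part x (fls_const (c * laurent_eval g x) * pole x 0) \<in> H"
      by (intro H.H.smult_closed U_W_const_closed)
    then have "principal_part x (pole x 0) \<in> H"
      using c g(2) by (subst (asm) N_const)
        (auto intro: localised_mult laurent_const localised_pole simp: mult.assoc[symmetric])
    then show ?thesis using N_generated_by_simple_pole[OF x sub] by blast
  qed simp
qed

section \<open>The exact sequence\<close>

text \<open>
  The residue is singled out as the multiple of the simple pole by which \<open>r\<close> differs from a
  derivative. In this form its kernel is by definition the image of \<open>d/dt\<close>.
\<close>

definition residue_at :: "'k::field \<Rightarrow> 'k fls \<Rightarrow> 'k" where
  "residue_at x r = (THE c. \<exists>s\<in>localised x. r - (fls_deriv s + fls_const c * pole x 0) \<in> laurent_polys)"

lemma residue_at_eqI:
  fixes x :: "'k::field_char_0"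
  assumes x: "x \<noteq> 0" and s: "s \<in> localised x"
    and r: "r - (fls_deriv s + fls_const c * pole x 0) \<in> laurent_polys"
  shows "residue_at x r = c"
  unfolding residue_at_def
proof (rule the_equality)
  show "\<exists>s\<in>localised x. r - (fls_deriv s + fls_const c * pole x 0) \<in> laurent_polys"
    using s r by blast
next
  fix d assume "\<exists>s\<in>localised x. r - (fls_deriv s + fls_const d * pole x 0) \<in> laurent_polys"
  then obtain t where t: "t \<in> localised x"
    "r - (fls_deriv t + fls_const d * pole x 0) \<in> laurent_polys" by blast
  have "s + - t \<in> localised x"
    using s t(1) by (intro localised_add localised_uminus)
  moreover have "fls_deriv (s + - t) + fls_const (c - d) * pole x 0 \<in> laurent_polys"
    using laurent_diff[OF t(2) r] by (simp add: algebra_simps flip: fls_minus_const)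
  ultimately have "c - d = 0" by (rule deriv_plus_simple_pole(2)[OF x])
  then show "d = c" by simp
qed

lemma residue_atE:
  fixes x :: "'k::field_char_0"
  assumes "x \<noteq> 0" "r \<in> localised x"
  obtains s where "s \<in> localised x"
    "r - (fls_deriv s + fls_const (residue_at x r) * pole x 0) \<in> laurent_polys"
proof -
  obtain s c where "s \<in> localised x" "r - (fls_deriv s + fls_const c * pole x 0) \<in> laurent_polys"
    using localised_antiderivative[OF assms] by blast
  then show thesis using residue_at_eqI[OF assms(1)] that by blast
qed

lemma residue_at_add:
  fixes x :: "'k::field_char_0"
  assumes x: "x \<noteq> 0" and r: "r \<in> localised x" "r' \<in> localised x"
  shows "residue_at x (r + r') = residue_at x r + residue_at x r'"
proof -
  obtain s where s: "s \<in> localised x"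
    "r - (fls_deriv s + fls_const (residue_at x r) * pole x 0) \<in> laurent_polys"
    using residue_atE[OF x r(1)] by blast
  obtain s' where s': "s' \<in> localised x"
    "r' - (fls_deriv s' + fls_const (residue_at x r') * pole x 0) \<in> laurent_polys"
    using residue_atE[OF x r(2)] by blast
  show ?thesis
    using laurent_add[OF s(2) s'(2)]
    by (intro residue_at_eqI[OF x localised_add[OF s(1) s'(1)]])
       (simp add: algebra_simps flip: fls_plus_const)
qed

lemma residue_at_scale:
  fixes x :: "'k::field_char_0"
  assumes x: "x \<noteq> 0" and r: "r \<in> localised x"
  shows "residue_at x (fls_const c * r) = c * residue_at x r"
proof -
  obtain s where s: "s \<in> localised x"
    "r - (fls_deriv s + fls_const (residue_at x r) * pole x 0) \<in> laurent_polys"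
    using residue_atE[OF x r] by blast
  show ?thesis
    using laurent_mult[OF laurent_const[of c] s(2)]
    by (intro residue_at_eqI[OF x localised_mult[OF laurent_const[of c] s(1)]])
       (simp add: fls_deriv_mult_const_left algebra_simps flip: fls_const_mult_const)
qed

lemma residue_at_laurent:
  fixes x :: "'k::field_char_0"
  assumes "x \<noteq> 0" "l \<in> laurent_polys" shows "residue_at x l = 0"
  using assms by (intro residue_at_eqI[OF _ localised_laurent[OF laurent_0]]) auto

lemma residue_at_deriv:
  fixes x :: "'k::field_char_0"
  assumes "x \<noteq> 0" "s \<in> localised x" shows "residue_at x (fls_deriv s) = 0"
  using assms laurent_0 by (intro residue_at_eqI[OF _ assms(2)]) auto

lemma residue_at_simple_pole:
  fixes x :: "'k::field_char_0"
  assumes "x \<noteq> 0" shows "residue_at x (fls_const c * pole x 0) = c"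
  using assms laurent_0 by (intro residue_at_eqI[OF _ localised_laurent[OF laurent_0]]) auto

lemma (in enveloping) character_module:
  fixes \<chi> :: "'l \<Rightarrow> 'k"
  assumes add: "\<And>f g. f \<in> L \<Longrightarrow> g \<in> L \<Longrightarrow> \<chi> (f + g) = \<chi> f + \<chi> g"
    and scl: "\<And>c f. f \<in> L \<Longrightarrow> \<chi> (scl c f) = c * \<chi> f"
    and br: "\<And>f g. f \<in> L \<Longrightarrow> g \<in> L \<Longrightarrow> \<chi> (br f g) = 0"
  shows character_left_module: "left_module A (character_module \<chi>)"
    and character_const: "cls (fconst c) \<odot>\<^bsub>character_module \<chi>\<^esub> m = c * m"
    and character_gen: "f \<in> L \<Longrightarrow> cls (fgen f) \<odot>\<^bsub>character_module \<chi>\<^esub> m = \<chi> f * m"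
proof -
  let ?K = "ring_of_type_algebra :: 'k ring"
  have K: "ring ?K" by (rule ring_from_type_algebra)
  have id: "id \<in> ring_hom ?K ?K" by (simp add: ring_hom_def)
  have central: "id c \<otimes>\<^bsub>?K\<^esub> \<chi> g = \<chi> g \<otimes>\<^bsub>?K\<^esub> id c" for c g
    by (simp add: ring_of_type_algebra_def)
  have closed: "\<chi> g \<in> carrier ?K" for g by (simp add: ring_of_type_algebra_def)
  have add': "\<chi> (f + g) = \<chi> f \<oplus>\<^bsub>?K\<^esub> \<chi> g" if "f \<in> L" "g \<in> L" for f g
    using that by (simp add: ring_of_type_algebra_def add)
  have scl': "\<chi> (scl c f) = id c \<otimes>\<^bsub>?K\<^esub> \<chi> f" if "f \<in> L" for c f
    using that by (simp add: ring_of_type_algebra_def scl)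
  have br': "\<chi> f \<otimes>\<^bsub>?K\<^esub> \<chi> g = \<chi> g \<otimes>\<^bsub>?K\<^esub> \<chi> f \<oplus>\<^bsub>?K\<^esub> \<chi> (br f g)" if "f \<in> L" "g \<in> L" for f g
    using that by (simp add: ring_of_type_algebra_def br)
  note lift = env_lift[where \<eta> = id and \<phi> = \<chi>, OF K id central closed add' scl' br']
  show "left_module A (character_module \<chi>)"
    unfolding character_module_def
    by (rule restrict_scalars_left_module[OF regular_left_module[OF K] A.ring_axioms lift(1)])
  show "cls (fconst c) \<odot>\<^bsub>character_module \<chi>\<^esub> m = c * m"
    by (simp add: character_module_def restrict_scalars_def regular_left_module_def lift(2))
       (simp add: ring_of_type_algebra_def)
  show "cls (fgen f) \<odot>\<^bsub>character_module \<chi>\<^esub> m = \<chi> f * m" if "f \<in> L"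
    using lift(3)[of f] that
    by (simp add: character_module_def restrict_scalars_def regular_left_module_def)
       (simp add: ring_of_type_algebra_def)
qed

lemma character_module_simps:
  "carrier (character_module \<chi>) = UNIV" "\<zero>\<^bsub>character_module \<chi>\<^esub> = 0"
  "m \<oplus>\<^bsub>character_module \<chi>\<^esub> n = m + n"
  by (simp_all add: character_module_def restrict_scalars_def regular_left_module_def ring_of_type_algebra_def)

definition principal_part_lift :: "'k::field \<Rightarrow> ('k fls \<Rightarrow> 'b) \<Rightarrow> 'k fls set \<Rightarrow> 'b" where
  "principal_part_lift x h C = the_elem (h ` C)"

text \<open>
  Both maps commute with the generators of \<open>U(W)\<close> because the action on \<open>N\<^sub>x\<^sup>1\<close> is
  \<open>r \<mapsto> f r' + f' r = (f r)'\<close>: for \<open>d/dt\<close> put \<open>r = s'\<close> to get \<open>(f s')'\<close>, and residues of derivatives vanish.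
\<close>

lemma N_exact_sequence:
  fixes x :: "'k::field_char_0"
  assumes x: "x \<noteq> 0"
  shows "exists_short_exact_sequence U_W (N_module x 0) (N_module x 1) trivial_module"
proof -
  let ?N0 = "N_module x 0" and ?N1 = "N_module x 1"
  let ?T = "trivial_module :: (('k fls list \<Rightarrow>\<^sub>0 'k) set, 'k) module"
  have T: "left_module U_W ?T"
    unfolding U_W_eq trivial_module_def by (rule Witt.character_left_module) auto
  have T_const: "uconst c \<odot>\<^bsub>?T\<^esub> m = c * m" for c m
    unfolding U_W_class_def trivial_module_def by (rule Witt.character_const) auto
  have T_gen: "ugen f \<odot>\<^bsub>?T\<^esub> m = 0" if "f \<in> laurent_polys" for f m
    unfolding U_W_class_def trivial_module_def using that by (subst Witt.character_gen) auto
  define d where "d = principal_part_lift x (\<lambda>r. principal_part x (fls_deriv r))"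
  define g where "g = principal_part_lift x (residue_at x)"
  have d: "d (principal_part x r) = principal_part x (fls_deriv r)" for r
    unfolding d_def principal_part_lift_def
    by (rule the_elem_principal_part) (simp add: principal_part_eq_iff laurent_deriv)
  have g: "g (principal_part x r) = residue_at x r" if "r \<in> localised x" for r
    unfolding g_def principal_part_lift_def
    using x that by (intro the_elem_principal_part) (simp add: residue_at_add localised_laurent residue_at_laurent)
  have d_hom: "d \<in> left_module_hom U_W ?N0 ?N1"
    unfolding U_W_eq
  proof (rule Witt.hom_presentedI, unfold U_W_fold)
    show "d \<in> carrier ?N0 \<rightarrow> carrier ?N1"
      by (auto simp: N_carrier d localised_deriv)
    show "d (m \<oplus>\<^bsub>?N0\<^esub> n) = d m \<oplus>\<^bsub>?N1\<^esub> d n"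
      if "m \<in> carrier ?N0" "n \<in> carrier ?N0" for m n
      using that by (auto simp: N_carrier N_add d localised_deriv)
    show "d (uconst c \<odot>\<^bsub>?N0\<^esub> m) = uconst c \<odot>\<^bsub>?N1\<^esub> d m"
      if "m \<in> carrier ?N0" for c m
      using that by (auto simp: N_carrier N_const d localised_deriv fls_deriv_mult_const_left)
    show "d (ugen f \<odot>\<^bsub>?N0\<^esub> m) = ugen f \<odot>\<^bsub>?N1\<^esub> d m"
      if "f \<in> laurent_polys" "m \<in> carrier ?N0" for f m
      using that by (auto simp: N_carrier N_gen d localised_deriv add.commute)
  qed (rule N_left_module)+
  have g_hom: "g \<in> left_module_hom U_W ?N1 ?T"
    unfolding U_W_eq
  proof (rule Witt.hom_presentedI, unfold U_W_fold)
    show "g \<in> carrier ?N1 \<rightarrow> carrier ?T"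
      by (auto simp: trivial_module_def character_module_simps)
    show "g (m \<oplus>\<^bsub>?N1\<^esub> n) = g m \<oplus>\<^bsub>?T\<^esub> g n"
      if "m \<in> carrier ?N1" "n \<in> carrier ?N1" for m n
      using that x by (auto simp: N_carrier N_add g localised_add residue_at_add
          trivial_module_def character_module_simps)
    show "g (uconst c \<odot>\<^bsub>?N1\<^esub> m) = uconst c \<odot>\<^bsub>?T\<^esub> g m"
      if "m \<in> carrier ?N1" for c m
      using that x by (auto simp: N_carrier N_const g T_const localised_mult laurent_const residue_at_scale)
    show "g (ugen f \<odot>\<^bsub>?N1\<^esub> m) = ugen f \<odot>\<^bsub>?T\<^esub> g m"
      if f: "f \<in> laurent_polys" and m: "m \<in> carrier ?N1" for f m
    proof -
      obtain r where r: "r \<in> localised x" "m = principal_part x r"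
        using m by (auto simp: N_carrier)
      have "ugen f \<odot>\<^bsub>?N1\<^esub> m = principal_part x (fls_deriv (f * r))"
        using f r by (simp add: N_gen)
      then show ?thesis
        using f r x by (simp add: g T_gen localised_deriv localised_mult residue_at_deriv del: fls_deriv_mult)
    qed
  qed (rule N_left_module T)+
  have "inj_on d (carrier ?N0)"
  proof (rule left_module_hom_inj[OF N_left_module N_left_module d_hom])
    fix m assume "m \<in> carrier ?N0" and 0: "d m = \<zero>\<^bsub>?N1\<^esub>"
    then obtain r where r: "r \<in> localised x" "m = principal_part x r"
      by (auto simp: N_carrier)
    then have "fls_deriv r + fls_const 0 * pole x 0 \<in> laurent_polys"
      using 0 by (simp add: d N_zero principal_part_zero_iff)
    then have "r \<in> laurent_polys" by (rule deriv_plus_simple_pole(1)[OF x r(1)])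
    then show "m = \<zero>\<^bsub>?N0\<^esub>" using r by (simp add: N_zero principal_part_zero_iff)
  qed
  moreover have "d ` carrier ?N0 = a_kernel ?N1 ?T g"
  proof -
    have "residue_at x r = 0 \<longleftrightarrow> (\<exists>s\<in>localised x. principal_part x r = principal_part x (fls_deriv s))"
      if r: "r \<in> localised x" for r
    proof
      assume 0: "residue_at x r = 0"
      obtain s where "s \<in> localised x"
        "r - (fls_deriv s + fls_const (residue_at x r) * pole x 0) \<in> laurent_polys"
        using residue_atE[OF x r] by blast
      then show "\<exists>s\<in>localised x. principal_part x r = principal_part x (fls_deriv s)"
        by (auto simp: principal_part_eq_iff 0)
    next
      assume "\<exists>s\<in>localised x. principal_part x r = principal_part x (fls_deriv s)"
      then obtain s where s: "s \<in> localised x" "r - fls_deriv s \<in> laurent_polys"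
        by (auto simp: principal_part_eq_iff)
      then show "residue_at x r = 0" by (intro residue_at_eqI[OF x s(1)]) simp
    qed
    then show ?thesis
      unfolding a_kernel_def'
      by (auto simp: N_carrier d g localised_deriv residue_at_deriv[OF x] trivial_module_def
          character_module_simps image_iff)
  qed
  moreover have "g ` carrier ?N1 = carrier ?T"
  proof -
    have "c \<in> g ` carrier ?N1" for c
    proof -
      have "fls_const c * pole x 0 \<in> localised x"
        by (intro localised_mult laurent_const localised_pole)
      then show ?thesis
        using residue_at_simple_pole[OF x, of c] by (force simp: N_carrier g)
    qed
    then show ?thesis by (auto simp: trivial_module_def character_module_simps)
  qed
  ultimately show ?thesis
    unfolding exists_short_exact_sequence_def using N_left_module T d_hom g_hom by blast
qed

section \<open>The induced module\<close>

text \<open>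
  The linear span of the vectors \<open>\<partial>\<^sup>i v\<close>, generated in Horner form \<open>c v + \<partial> m\<close>. This form suits both uses:
  closure under the Witt algebra and injectivity of maps are proved by peeling off one \<open>\<partial>\<close> at a time.
\<close>

inductive_set horner_span :: "(('k::field fls list \<Rightarrow>\<^sub>0 'k) set, 'm) module \<Rightarrow> 'm \<Rightarrow> 'm set"
  for M :: "(('k::field fls list \<Rightarrow>\<^sub>0 'k) set, 'm) module" and v :: 'm where
  zero: "\<zero>\<^bsub>M\<^esub> \<in> horner_span M v"
| step: "m \<in> horner_span M v \<Longrightarrow>
    uconst c \<odot>\<^bsub>M\<^esub> v \<oplus>\<^bsub>M\<^esub> ugen 1 \<odot>\<^bsub>M\<^esub> m \<in> horner_span M v"

lemma U_W_const_mult: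
  "uconst (c * d) = uconst c \<otimes>\<^bsub>U_W\<^esub> uconst d"
  and U_W_const_add:
  "uconst (c + d) = uconst c \<oplus>\<^bsub>U_W\<^esub> uconst d"
  and U_W_const_one: "uconst 1 = \<one>\<^bsub>U_W\<^esub>"
  using ring_hom_mult[OF Witt.const_hom, of c d] ring_hom_add[OF Witt.const_hom, of c d]
    ring_hom_one[OF Witt.const_hom]
  by (simp_all add: U_W_fold ring_of_type_algebra_def)

lemma U_W_const_zero: "uconst (0 :: 'k::field) = \<zero>\<^bsub>U_W\<^esub>"
proof -
  interpret U: ring "U_W :: ('k fls list \<Rightarrow>\<^sub>0 'k) set ring" by (rule ring_U_W)
  have "uconst (0 :: 'k) \<oplus>\<^bsub>U_W\<^esub> uconst 0 = uconst 0"
    by (simp add: U_W_const_add[symmetric] del: single_zero)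
  then show ?thesis using U_W_const_closed[of "0 :: 'k"] by (simp del: single_zero)
qed

context
  fixes M :: "(('k::field fls list \<Rightarrow>\<^sub>0 'k) set, 'm) module" and v :: 'm
    and x :: 'k and \<chi> :: "'k fls \<Rightarrow> 'k"
  assumes M: "left_module U_W M" and v: "v \<in> carrier M" and x: "x \<noteq> 0"
    and eigen: "\<And>q. q \<in> witt_at x \<Longrightarrow>
      ugen q \<odot>\<^bsub>M\<^esub> v = uconst (\<chi> q) \<odot>\<^bsub>M\<^esub> v"
begin

interpretation M: left_module U_W M by (rule M)

abbreviation "scale c m \<equiv> uconst c \<odot>\<^bsub>M\<^esub> m"
abbreviation "op f m \<equiv> ugen f \<odot>\<^bsub>M\<^esub> m"
abbreviation "S \<equiv> horner_span M v"

lemma scale_closed: "m \<in> carrier M \<Longrightarrow> scale c m \<in> carrier M"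
  by (intro M.smult_closed U_W_const_closed)

lemma op_closed: "f \<in> laurent_polys \<Longrightarrow> m \<in> carrier M \<Longrightarrow> op f m \<in> carrier M"
  by (intro M.smult_closed U_W_gen_closed)

lemma scale_zero: "m \<in> carrier M \<Longrightarrow> scale 0 m = \<zero>\<^bsub>M\<^esub>"
  by (simp only: U_W_const_zero M.smult_l_zero)

lemma scale_add_right:
  "m \<in> carrier M \<Longrightarrow> n \<in> carrier M \<Longrightarrow> scale c (m \<oplus>\<^bsub>M\<^esub> n) = scale c m \<oplus>\<^bsub>M\<^esub> scale c n"
  by (intro M.smult_r_distr U_W_const_closed)

lemma op_add_right:
  "f \<in> laurent_polys \<Longrightarrow> m \<in> carrier M \<Longrightarrow> n \<in> carrier M \<Longrightarrow> op f (m \<oplus>\<^bsub>M\<^esub> n) = op f m \<oplus>\<^bsub>M\<^esub> op f n"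
  by (intro M.smult_r_distr U_W_gen_closed)

lemma scale_add: "m \<in> carrier M \<Longrightarrow> scale (c + d) m = scale c m \<oplus>\<^bsub>M\<^esub> scale d m"
  by (simp only: U_W_const_add M.smult_l_distr U_W_const_closed)

lemma scale_scale: "m \<in> carrier M \<Longrightarrow> scale c (scale d m) = scale (c * d) m"
  by (simp only: U_W_const_mult M.smult_assoc1 U_W_const_closed)

lemma scale_op:
  assumes "f \<in> laurent_polys" "m \<in> carrier M" shows "scale c (op f m) = op f (scale c m)"
  using Witt.const_central[OF assms(1), of c, unfolded U_W_fold] assms
  by (simp only: M.smult_assoc1[symmetric] U_W_const_closed U_W_gen_closed)

lemma op_add:
  assumes "f \<in> laurent_polys" "g \<in> laurent_polys" "m \<in> carrier M"
  shows "op (f + g) m = op f m \<oplus>\<^bsub>M\<^esub> op g m"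
  using Witt.cls_gen_add[OF assms(1,2), unfolded U_W_fold] assms
  by (simp only: M.smult_l_distr U_W_gen_closed)

lemma op_scale:
  assumes "f \<in> laurent_polys" "m \<in> carrier M"
  shows "op (fls_const c * f) m = scale c (op f m)"
  using Witt.cls_gen_scl[OF assms(1), of c, unfolded U_W_fold] assms
  by (simp only: M.smult_assoc1 U_W_gen_closed U_W_const_closed)

lemma op_commute:
  assumes fg: "f \<in> laurent_polys" "g \<in> laurent_polys" and m: "m \<in> carrier M"
  shows "op f (op g m) = op g (op f m) \<oplus>\<^bsub>M\<^esub> op (witt_bracket f g) m"
proof -
  interpret U: ring "U_W :: ('k fls list \<Rightarrow>\<^sub>0 'k) set ring" by (rule ring_U_W)
  note cl = U_W_gen_closed[OF fg(1)] U_W_gen_closed[OF fg(2)] U_W_gen_closed[OF Witt.L_br[OF fg]]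
  have "op f (op g m) = (ugen f \<otimes>\<^bsub>U_W\<^esub> ugen g) \<odot>\<^bsub>M\<^esub> m"
    using cl m by (simp add: M.smult_assoc1)
  also have "\<dots> = (ugen g \<otimes>\<^bsub>U_W\<^esub> ugen f
      \<oplus>\<^bsub>U_W\<^esub> ugen (witt_bracket f g)) \<odot>\<^bsub>M\<^esub> m"
    by (subst Witt.cls_gen_br[OF fg, unfolded U_W_fold]) rule
  also have "\<dots> = op g (op f m) \<oplus>\<^bsub>M\<^esub> op (witt_bracket f g) m"
    using cl m by (simp add: M.smult_assoc1 M.smult_l_distr)
  finally show ?thesis .
qed

lemma span_carrier: "m \<in> S \<Longrightarrow> m \<in> carrier M"
  by (induction m rule: horner_span.induct) (auto intro: scale_closed op_closed laurent_1 v)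

lemma span_add:
  assumes "m \<in> S" "n \<in> S" shows "m \<oplus>\<^bsub>M\<^esub> n \<in> S"
  using assms
proof (induction m arbitrary: n rule: horner_span.induct)
  case zero
  then show ?case using span_carrier by simp
next
  case (step m c)
  from step.prems show ?case
  proof (cases rule: horner_span.cases)
    case zero
    then show ?thesis
      using horner_span.step[OF step.hyps, of c] span_carrier by simp
  next
    case (step n' d)
    have cl: "m \<in> carrier M" "n' \<in> carrier M"
      using span_carrier step(2) \<open>m \<in> S\<close> by auto
    have cl': "scale c v \<in> carrier M" "scale d v \<in> carrier M" "op 1 m \<in> carrier M" "op 1 n' \<in> carrier M"
      by (intro scale_closed op_closed laurent_1 v cl)+
    have "(scale c v \<oplus>\<^bsub>M\<^esub> op 1 m) \<oplus>\<^bsub>M\<^esub> (scale d v \<oplus>\<^bsub>M\<^esub> op 1 n') =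
       (scale c v \<oplus>\<^bsub>M\<^esub> scale d v) \<oplus>\<^bsub>M\<^esub> (op 1 m \<oplus>\<^bsub>M\<^esub> op 1 n')"
      using cl' by (simp add: M.M.a_ac)
    also have "\<dots> = scale (c + d) v \<oplus>\<^bsub>M\<^esub> op 1 (m \<oplus>\<^bsub>M\<^esub> n')"
      using cl v by (simp only: scale_add op_add_right laurent_1)
    also have "\<dots> \<in> S" by (intro horner_span.step step.IH step(2))
    finally show ?thesis unfolding step(1) .
  qed
qed

lemma span_v: "scale c v \<in> S"
proof -
  have "scale c v \<oplus>\<^bsub>M\<^esub> op 1 \<zero>\<^bsub>M\<^esub> \<in> S" by (intro horner_span.intros)
  then show ?thesis
    using v by (simp add: M.smult_r_zero U_W_gen_closed laurent_1 scale_closed)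
qed

lemma span_op_1: "m \<in> S \<Longrightarrow> op 1 m \<in> S"
  using horner_span.step[of m M v 0] span_carrier[of m] v
  by (simp add: scale_zero op_closed laurent_1 del: single_zero)

lemma span_scale: "m \<in> S \<Longrightarrow> scale c m \<in> S"
proof (induction m rule: horner_span.induct)
  case zero
  then show ?case by (simp add: M.smult_r_zero U_W_const_closed horner_span.zero)
next
  case (step m d)
  have "scale c (scale d v \<oplus>\<^bsub>M\<^esub> op 1 m) = scale (c * d) v \<oplus>\<^bsub>M\<^esub> op 1 (scale c m)"
    using span_carrier[OF step(1)] v
    by (simp add: scale_add_right scale_closed op_closed laurent_1 scale_scale scale_op)
  then show ?case using horner_span.step[OF step(2)] by simp
qed

lemma witt_at_laurent: "q \<in> witt_at x \<Longrightarrow> q \<in> laurent_polys"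
  unfolding witt_at_def by (auto intro: laurent_mult laurent_lin)

text \<open>
  This is where the decomposition of \<open>W\<close> into \<open>W(t-x)\<close> and the line through \<open>\<partial>\<close> enters:
  \<open>f\<partial> = f(x) \<partial> + q\<partial>\<close> with \<open>q\<close> divisible by \<open>t - x\<close>.
\<close>

lemma span_op_v:
  assumes f: "f \<in> laurent_polys" shows "op f v \<in> S"
proof -
  obtain g where g: "g \<in> laurent_polys" "f = fls_const (laurent_eval f x) + lin x * g"
    using laurent_factor[OF x f] by blast
  define q where "q = lin x * g"
  have q: "q \<in> witt_at x" unfolding witt_at_def q_def using g(1) by blast
  have "op f v = op (fls_const (laurent_eval f x) * 1 + q) v"
    using g(2) by (simp add: q_def)
  also have "\<dots> = scale (laurent_eval f x) (op 1 v) \<oplus>\<^bsub>M\<^esub> scale (\<chi> q) v"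
    using v q eigen[OF q]
    by (simp only: op_add op_scale laurent_1 laurent_mult laurent_const witt_at_laurent)
  also have "\<dots> \<in> S"
    using span_v[of 1] v by (intro span_add span_scale span_op_1 span_v) (simp add: U_W_const_one M.smult_one)
  finally show ?thesis .
qed

text \<open>
  An operator \<open>f\<partial>\<close> moves past \<open>\<partial>\<close> at the cost of \<open>[f\<partial>, \<partial>] = -f'\<partial>\<close>, applied to a shorter expression. The
  induction therefore has to run over all \<open>f\<close> at once.
\<close>

lemma span_op: "m \<in> S \<Longrightarrow> f \<in> laurent_polys \<Longrightarrow> op f m \<in> S"
proof (induction m arbitrary: f rule: horner_span.induct)
  case zero
  then show ?case by (simp add: M.smult_r_zero U_W_gen_closed horner_span.zero)
next
  case (step m c)
  have m: "m \<in> carrier M" by (rule span_carrier[OF step(1)])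
  have br: "witt_bracket f 1 \<in> laurent_polys" by (intro Witt.L_br step.prems laurent_1)
  have "op f (scale c v \<oplus>\<^bsub>M\<^esub> op 1 m) = scale c (op f v) \<oplus>\<^bsub>M\<^esub> op f (op 1 m)"
    using m v step.prems by (simp add: op_add_right scale_closed op_closed laurent_1 scale_op)
  also have "op f (op 1 m) = op 1 (op f m) \<oplus>\<^bsub>M\<^esub> op (witt_bracket f 1) m"
    by (intro op_commute step.prems laurent_1 m)
  finally show ?case
    using step br by (simp add: span_add span_scale span_op_v span_op_1)
qed

lemma horner_span_submodule: "submodule (horner_span M v) U_W M"
  unfolding U_W_eq
proof (rule Witt.submodule_presentedI, unfold U_W_fold)
  show "horner_span M v \<noteq> {}" using horner_span.zero[of M v] by auto
qed (use M span_carrier span_add span_scale span_op in auto)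

lemma horner_span_generator: "v \<in> horner_span M v"
  using span_v[of 1] v by (simp add: U_W_const_one M.smult_one)

end

text \<open>
  The simple pole is an eigenvector of \<open>W(t-x)\<close>: for \<open>q = (t-x)h\<close>, the image of \<open>(t-x)\<inverse>\<close> under \<open>q\<partial> + \<gamma> q'\<close> is
  \<open>(\<gamma> - 1) h (t-x)\<inverse>\<close> up to a Laurent polynomial, with \<open>h(x) = q'(x)\<close>. The resulting map from the induced
  module is surjective since the simple pole generates, and injective since a vector \<open>c v + \<partial> m\<close> of the
  Horner span goes to \<open>c (t-x)\<inverse> + s'\<close>, where \<open>s\<close> represents the image of \<open>m\<close>.
\<close>

lemma N_M_isomorphic:
  fixes x \<gamma> :: "'k::field_char_0"
  assumes x: "x \<noteq> 0"
  shows "left_modules_isomorphic U_W (N_module x \<gamma>) (M_module x (\<gamma> - 1))"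
proof -
  let ?\<chi> = "\<lambda>p. (\<gamma> - 1) * laurent_eval (fls_deriv p) x"
  let ?K = "character_module ?\<chi> :: (('k fls list \<Rightarrow>\<^sub>0 'k) set, 'k) module"
  let ?N = "N_module x \<gamma>" and ?M = "M_module x (\<gamma> - 1)"
  have at_laurent: "p \<in> laurent_polys" and at_eval: "laurent_eval p x = 0" if "p \<in> witt_at x" for p
    using that x by (auto simp: witt_at_def laurent_eval_mult eval_lin laurent_lin intro: laurent_mult laurent_lin)
  interpret At: enveloping witt_scale witt_bracket "witt_at x"
  proof
    fix f g :: "'k fls" and c assume fg: "f \<in> witt_at x" "g \<in> witt_at x"
    obtain f' g' where f': "f = lin x * f'" "f' \<in> laurent_polys" and g': "g = lin x * g'" "g' \<in> laurent_polys"
      using fg unfolding witt_at_def by blast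
    have in_at: "lin x * h \<in> witt_at x" if "h \<in> laurent_polys" for h
      unfolding witt_at_def using that by blast
    show "f + g \<in> witt_at x"
      using in_at[OF laurent_add[OF f'(2) g'(2)]] by (simp add: f' g' distrib_left)
    show "witt_scale c f \<in> witt_at x"
      using in_at[OF laurent_mult[OF laurent_const[of c] f'(2)]] by (simp add: f' mult.left_commute)
    have "f' * fls_deriv g - fls_deriv f * g' \<in> laurent_polys"
      using fg at_laurent f' g' by (intro laurent_closed)
    then show "witt_bracket f g \<in> witt_at x"
      using in_at[of "f' * fls_deriv g - fls_deriv f * g'"]
      by (simp add: witt_bracket_def f'(1) g'(1) algebra_simps)
  qed
  have at_eq: "U_W_at x = At.A" by (simp add: U_W_at_def env_algebra_def)
  have \<chi>_add: "?\<chi> (f + g) = ?\<chi> f + ?\<chi> g" if "f \<in> witt_at x" "g \<in> witt_at x" for f g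
    using that by (simp add: laurent_eval_add laurent_deriv at_laurent algebra_simps)
  have \<chi>_scl: "?\<chi> (witt_scale c f) = c * ?\<chi> f" if "f \<in> witt_at x" for c f
    using that x by (simp add: fls_deriv_mult_const_left laurent_eval_mult laurent_eval_const laurent_const
        laurent_deriv at_laurent)
  have \<chi>_br: "?\<chi> (witt_bracket f g) = 0" if "f \<in> witt_at x" "g \<in> witt_at x" for f g
    using that x at_laurent at_eval
    by (simp add: witt_bracket_def laurent_eval_diff laurent_eval_add laurent_eval_mult laurent_closed)
  note K = At.character_left_module[of ?\<chi>, OF \<chi>_add \<chi>_scl \<chi>_br, folded at_eq]
  note K_const = At.character_const[of ?\<chi>, OF \<chi>_add \<chi>_scl \<chi>_br]
  note K_gen = At.character_gen[of ?\<chi>, OF \<chi>_add \<chi>_scl \<chi>_br]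
  have const_hom: "(\<lambda>c. uconst c) \<in> ring_hom ring_of_type_algebra U_W"
    using Witt.const_hom by (simp add: U_W_fold)
  note incl = At.env_lift[where \<eta> = "\<lambda>c. uconst c" and \<phi> = "\<lambda>f. ugen f",
      OF ring_U_W const_hom Witt.const_central[unfolded U_W_fold] U_W_gen_closed Witt.cls_gen_add[unfolded U_W_fold]
      Witt.cls_gen_scl[unfolded U_W_fold] Witt.cls_gen_br[unfolded U_W_fold],
      folded U_W_at_incl_def, OF at_laurent at_laurent at_laurent at_laurent at_laurent at_laurent at_laurent]
  interpret ind: induction_along U_W "U_W_at x" U_W_at_incl ?K
    unfolding induction_along_def induction_along_axioms_def
    using ring_U_W K incl(1) at_eq by auto
  have M_eq: "?M = ind.Ind" by (simp add: M_module_def)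
  interpret M: left_module U_W ?M unfolding M_eq by (rule ind.left_module_Ind)
  interpret N: left_module U_W ?N by (rule N_left_module)
  interpret U: ring "U_W :: ('k fls list \<Rightarrow>\<^sub>0 'k) set ring" by (rule ring_U_W)
  define v where "v = ind.tensor \<one>\<^bsub>U_W\<^esub> (1 :: 'k)"
  have v: "v \<in> carrier ?M"
    unfolding v_def M_eq by (intro ind.tensor_closed) (simp_all add: character_module_simps)
  have at_closed: "At.cls (fconst c) \<in> carrier (U_W_at x)" "q \<in> witt_at x \<Longrightarrow> At.cls (fgen q) \<in> carrier (U_W_at x)"
    for c q
    unfolding at_eq by (simp_all add: At.cls_closed free_algebra_closed)
  have incl_v: "U_W_at_incl s \<odot>\<^bsub>?M\<^esub> v = ind.tensor \<one>\<^bsub>U_W\<^esub> (s \<odot>\<^bsub>?K\<^esub> 1)"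
    if s: "s \<in> carrier (U_W_at x)" for s
  proof -
    have "U_W_at_incl s \<odot>\<^bsub>?M\<^esub> v = ind.tensor (U_W_at_incl s \<otimes>\<^bsub>U_W\<^esub> \<one>\<^bsub>U_W\<^esub>) 1"
      unfolding v_def M_eq using s by (intro ind.tensor_smult) (simp_all add: character_module_simps)
    also have "U_W_at_incl s \<otimes>\<^bsub>U_W\<^esub> \<one>\<^bsub>U_W\<^esub> = \<one>\<^bsub>U_W\<^esub> \<otimes>\<^bsub>U_W\<^esub> U_W_at_incl s" using s by simp
    also have "ind.tensor \<dots> 1 = ind.tensor \<one>\<^bsub>U_W\<^esub> (s \<odot>\<^bsub>?K\<^esub> 1)"
      using s by (intro ind.tensor_balanced) (simp_all add: character_module_simps)
    finally show ?thesis .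
  qed
  have eigen: "ugen q \<odot>\<^bsub>?M\<^esub> v = uconst (?\<chi> q) \<odot>\<^bsub>?M\<^esub> v" if q: "q \<in> witt_at x" for q
    using incl_v[OF at_closed(2)[OF q]] incl_v[OF at_closed(1)[of "?\<chi> q"]] q
    by (simp add: incl K_const K_gen)
  have span: "horner_span ?M v = carrier ?M"
  proof -
    interpret H: submodule "horner_span ?M v" U_W ?M
      by (rule horner_span_submodule[OF M.left_module_axioms v x eigen])
    have "C \<in> horner_span ?M v" if C: "C \<in> carrier ?M" for C
    proof -
      have "\<exists>u\<in>carrier U_W. C = u \<odot>\<^bsub>?M\<^esub> v"
        unfolding v_def M_eq
      proof (rule ind.cyclic_Ind)
        show "\<exists>s\<in>carrier (U_W_at x). n = s \<odot>\<^bsub>?K\<^esub> 1" for n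
          by (intro bexI[of _ "At.cls (fconst n)"] at_closed) (simp add: K_const)
      qed (use C M_eq in \<open>simp_all add: character_module_simps\<close>)
      then show ?thesis
        using H.smult_closed[OF _ horner_span_generator[OF M.left_module_axioms v x eigen]] by blast
    qed
    moreover have "horner_span ?M v \<subseteq> carrier ?M" using H.subset by simp
    ultimately show ?thesis by blast
  qed
  define \<phi> where "\<phi> c = principal_part x (fls_const c * pole x 0)" for c
  have c_pole: "fls_const c * pole x 0 \<in> localised x" for c
    by (intro localised_mult laurent_const localised_pole)
  have \<phi>_add: "\<phi> (c + d) = \<phi> c \<oplus>\<^bsub>?N\<^esub> \<phi> d" for c d
    by (simp add: \<phi>_def N_add c_pole distrib_right flip: fls_plus_const)
  have \<phi>_const: "\<phi> (c * d) = uconst c \<odot>\<^bsub>?N\<^esub> \<phi> d" for c d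
    by (simp add: \<phi>_def N_const c_pole mult.assoc flip: fls_const_mult_const)
  have \<phi>_gen: "\<phi> (?\<chi> q * d) = ugen q \<odot>\<^bsub>?N\<^esub> \<phi> d" if q: "q \<in> witt_at x" for q d
  proof -
    obtain h where h: "q = lin x * h" "h \<in> laurent_polys" using q unfolding witt_at_def by blast
    have dq: "fls_deriv q = h + lin x * fls_deriv h" by (simp add: h(1))
    have ev: "laurent_eval (fls_deriv q) x = laurent_eval h x"
      using x h(2) by (simp add: dq laurent_eval_add laurent_eval_mult laurent_mult laurent_lin laurent_deriv eval_lin)
    have "lin x * pole x (Suc 0) = pole x 0" by (rule lin_power_pole(2))
    then have "q * fls_deriv (fls_const d * pole x 0) = - fls_const d * (h * pole x 0)"
      by (simp add: fls_deriv_mult_const_left deriv_pole h(1) mult.left_commute[of "lin x"] mult_ac)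
    moreover have "fls_deriv q * (fls_const d * pole x 0) = fls_const d * (h * pole x 0) + fls_const d * fls_deriv h"
    proof -
      have "fls_deriv q * (fls_const d * pole x 0) =
          fls_const d * (h * pole x 0) + fls_const d * (fls_deriv h * (lin x * pole x 0))"
        by (simp only: dq distrib_left distrib_right mult_ac)
      then show ?thesis by (simp only: lin_power_pole(3) mult_1_right)
    qed
    ultimately have act: "q * fls_deriv (fls_const d * pole x 0) + fls_const \<gamma> * (fls_deriv q * (fls_const d * pole x 0))
        = fls_const ((\<gamma> - 1) * d) * (h * pole x 0) + fls_const (\<gamma> * d) * fls_deriv h"
      by (simp add: algebra_simps flip: fls_minus_const fls_const_mult_const)
    have "fls_const ((\<gamma> - 1) * d) * (h * pole x 0 - fls_const (laurent_eval h x) * pole x 0)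
        + fls_const (\<gamma> * d) * fls_deriv h \<in> laurent_polys"
      using x h(2) by (intro laurent_add laurent_mult laurent_const laurent_deriv simple_pole_part)
    moreover have c: "fls_const ((\<gamma> - 1) * laurent_eval h x * d) = fls_const ((\<gamma> - 1) * d) * fls_const (laurent_eval h x)"
      by (simp add: mult_ac)
    ultimately have "principal_part x (fls_const ((\<gamma> - 1) * d) * (h * pole x 0) + fls_const (\<gamma> * d) * fls_deriv h)
      = \<phi> (?\<chi> q * d)"
      unfolding \<phi>_def principal_part_eq_iff ev c by (simp only: algebra_simps)
    then show ?thesis
      using q by (simp only: \<phi>_def[of d] N_gen[OF at_laurent c_pole] act)
  qed
  have \<phi>_smult: "\<phi> (s \<odot>\<^bsub>?K\<^esub> c) = U_W_at_incl s \<odot>\<^bsub>?N\<^esub> \<phi> c" if s: "s \<in> carrier (U_W_at x)" for s c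
  proof -
    have "\<phi> \<in> left_module_hom At.A ?K (restrict_scalars U_W_at_incl ?N)"
    proof (rule At.hom_presentedI)
      show "left_module At.A (restrict_scalars U_W_at_incl ?N)"
        by (rule restrict_scalars_left_module[OF N_left_module At.A.ring_axioms incl(1)])
      show "\<phi> \<in> carrier ?K \<rightarrow> carrier (restrict_scalars U_W_at_incl ?N)"
        using c_pole by (auto simp: restrict_scalars_def \<phi>_def N_carrier)
    qed (use K \<phi>_add \<phi>_const \<phi>_gen in
        \<open>auto simp: at_eq restrict_scalars_def character_module_simps K_const K_gen incl\<close>)
    then show ?thesis
      using s by (auto simp: left_module_hom_def at_eq restrict_scalars_def character_module_simps)
  qed
  obtain \<Phi> where \<Phi>: "\<Phi> \<in> left_module_hom U_W ?M ?N"
    and \<Phi>_tensor: "\<And>u n. u \<in> carrier U_W \<Longrightarrow> n \<in> carrier ?K \<Longrightarrow> \<Phi> (ind.tensor u n) = u \<odot>\<^bsub>?N\<^esub> \<phi> n"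
    unfolding M_eq
  proof (rule ind.induced_hom[OF N_left_module])
    show "\<phi> \<in> carrier ?K \<rightarrow> carrier ?N" using c_pole by (auto simp: \<phi>_def N_carrier)
  qed (use \<phi>_add \<phi>_smult in \<open>simp_all add: character_module_simps\<close>)
  have \<Phi>_add: "\<Phi> (m \<oplus>\<^bsub>?M\<^esub> n) = \<Phi> m \<oplus>\<^bsub>?N\<^esub> \<Phi> n" if "m \<in> carrier ?M" "n \<in> carrier ?M" for m n
    using \<Phi> that by (auto simp: left_module_hom_def)
  have \<Phi>_smult: "\<Phi> (u \<odot>\<^bsub>?M\<^esub> m) = u \<odot>\<^bsub>?N\<^esub> \<Phi> m" if "u \<in> carrier U_W" "m \<in> carrier ?M" for u m
    using \<Phi> that by (auto simp: left_module_hom_def)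
  have \<Phi>_closed: "\<Phi> m \<in> carrier ?N" if "m \<in> carrier ?M" for m
    using \<Phi> that by (auto simp: left_module_hom_def)
  have \<Phi>_v: "\<Phi> v = principal_part x (pole x 0)"
  proof -
    have "\<phi> 1 = principal_part x (pole x 0)" by (simp add: \<phi>_def)
    moreover have "\<phi> 1 \<in> carrier ?N" by (simp add: \<phi>_def N_carrier localised_pole)
    ultimately show ?thesis
      unfolding v_def by (simp add: \<Phi>_tensor character_module_simps N.smult_one)
  qed
  have inj: "inj_on \<Phi> (carrier ?M)"
  proof (rule left_module_hom_inj[OF M.left_module_axioms N_left_module \<Phi>])
    fix m assume "m \<in> carrier ?M" and 0: "\<Phi> m = \<zero>\<^bsub>?N\<^esub>"
    then have "m \<in> horner_span ?M v" by (simp only: span)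
    then show "m = \<zero>\<^bsub>?M\<^esub>" using 0
    proof (induction m rule: horner_span.induct)
      case (step m c)
      have m: "m \<in> carrier ?M" using step(1) by (simp only: span)
      then obtain s where s: "s \<in> localised x" "\<Phi> m = principal_part x s"
        using \<Phi>_closed by (auto simp: N_carrier)
      have cv: "uconst c \<odot>\<^bsub>?M\<^esub> v \<in> carrier ?M" "ugen 1 \<odot>\<^bsub>?M\<^esub> m \<in> carrier ?M"
        by (intro M.smult_closed U_W_const_closed U_W_gen_closed laurent_1 v m)+
      have "\<Phi> (uconst c \<odot>\<^bsub>?M\<^esub> v \<oplus>\<^bsub>?M\<^esub> ugen 1 \<odot>\<^bsub>?M\<^esub> m)
         = principal_part x (fls_const c * pole x 0 + fls_deriv s)"
        using cv v m s
        by (simp add: \<Phi>_add \<Phi>_smult U_W_const_closed U_W_gen_closed laurent_1 \<Phi>_v N_const N_gen N_add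
            localised_pole c_pole localised_deriv)
      then have "principal_part x (fls_deriv s + fls_const c * pole x 0) = principal_part x 0"
        using step.prems by (simp add: N_zero add.commute)
      then have "fls_deriv s + fls_const c * pole x 0 \<in> laurent_polys"
        by (simp only: principal_part_zero_iff)
      then have *: "s \<in> laurent_polys" "c = 0" using deriv_plus_simple_pole[OF x s(1)] by blast+
      then have "\<Phi> m = \<zero>\<^bsub>?N\<^esub>" using s by (simp add: N_zero principal_part_zero_iff)
      then have "m = \<zero>\<^bsub>?M\<^esub>" by (rule step.IH)
      then show ?case
        unfolding *(2) U_W_const_zero
        using v by (simp add: M.smult_l_zero M.smult_r_zero U_W_gen_closed laurent_1)
    qed simp
  qed
  have surj: "\<Phi> ` carrier ?M = carrier ?N"
  proof (rule N_generated_by_simple_pole[OF x])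
    show "submodule (\<Phi> ` carrier ?M) U_W ?N"
      by (rule left_module_hom_image[OF M.left_module_axioms N_left_module \<Phi>])
    show "principal_part x (pole x 0) \<in> \<Phi> ` carrier ?M" using \<Phi>_v v by (metis imageI)
  qed
  have "left_modules_isomorphic U_W ?M ?N"
    unfolding left_modules_isomorphic_def bij_betw_def
    using \<Phi> inj surj M.left_module_axioms N_left_module by blast
  then show ?thesis by (rule left_modules_isomorphic_sym)
qed

section \<open>Primitivity\<close>

text \<open>
  This is \<open>\<pi>\<^sub>1(u) \<partial> = \<partial> \<pi>\<^sub>0(u)\<close>: the relation passes to products in \<open>u\<close>, and for a generator it
  reads \<open>(f\<partial> + f') \<partial> = \<partial> (f\<partial>)\<close>.
\<close>

lemma witt_op_1_deriv:
  fixes u :: "('k::field_char_0 fls list \<Rightarrow>\<^sub>0 'k) set"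
  assumes "u \<in> carrier U_W"
  shows "witt_op 1 u (fls_deriv r) = fls_deriv (witt_op 0 u r)"
  using assms unfolding U_W_eq
proof (induction u rule: Witt.A_induct)
  case (const c)
  then show ?case by (simp add: U_W_fold witt_op_const fls_deriv_mult_const_left)
next
  case (add u v)
  then show ?case by (simp add: U_W_fold witt_op_add)
next
  case (gen f u)
  then show ?case by (simp add: U_W_fold witt_op_mult witt_op_gen U_W_gen_closed add.commute)
qed

text \<open>
  In \<open>\<pi>\<^sub>1(u) \<partial> = \<partial> \<pi>\<^sub>0(u)\<close> the factor \<open>\<partial>\<close> can be cancelled on either side: on the right by normal forms, on the left
  because a principal part with zero derivative is zero.
\<close>

lemma weyl_pi_0_1_kernel:
  "a_kernel U_W weyl_algebra (weyl_pi (0 :: 'k::field_char_0)) = a_kernel U_W weyl_algebra (weyl_pi 1)"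
proof -
  have "weyl_pi 0 u = \<zero>\<^bsub>weyl_algebra\<^esub> \<longleftrightarrow> weyl_pi 1 u = \<zero>\<^bsub>weyl_algebra\<^esub>"
    if u: "u \<in> carrier U_W" for u :: "('k fls list \<Rightarrow>\<^sub>0 'k) set"
  proof
    assume "weyl_pi 0 u = \<zero>\<^bsub>weyl_algebra\<^esub>"
    then have "witt_op 0 u r = 0" for r
      by (simp add: witt_op_def weyl_op_0 flip: weyl_class_0)
    then have "weyl_action (weyl_pi 1 u) ((fls_deriv ^^ 1) r) \<in> laurent_polys" for r
      using witt_op_1_deriv[OF u, of r] by (simp add: witt_op_def laurent_0)
    then show "weyl_pi 1 u = \<zero>\<^bsub>weyl_algebra\<^esub>"
      by (intro weyl_action_faithful_deriv[OF one_neq_zero weyl_pi_closed[OF u]])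
  next
    assume "weyl_pi 1 u = \<zero>\<^bsub>weyl_algebra\<^esub>"
    then have 1: "witt_op 1 u r = 0" for r
      by (simp add: witt_op_def weyl_op_0 flip: weyl_class_0)
    show "weyl_pi 0 u = \<zero>\<^bsub>weyl_algebra\<^esub>"
    proof (rule weyl_action_faithful[OF one_neq_zero weyl_pi_closed[OF u]])
      fix r :: "'k fls" assume r: "r \<in> localised 1"
      have "fls_deriv (witt_op 0 u r) + fls_const 0 * pole 1 0 \<in> laurent_polys"
        using 1 witt_op_1_deriv[OF u, of r] by (simp add: laurent_0)
      then show "weyl_action (weyl_pi 0 u) r \<in> laurent_polys"
        unfolding witt_op_def[symmetric]
        by (rule deriv_plus_simple_pole(1)[OF one_neq_zero witt_op_localised[OF u r]])
    qed
  qed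
  then show ?thesis by (auto simp: a_kernel_def')
qed

text \<open>
  The image of \<open>N\<^sub>x\<^sup>0\<close> in the exact sequence is a proper nonzero submodule.
\<close>

lemma N_1_not_simple:
  fixes x :: "'k::field_char_0"
  assumes x: "x \<noteq> 0" shows "\<not> simple_left_module U_W (N_module x 1)"
proof
  assume simple: "simple_left_module U_W (N_module x 1)"
  let ?N0 = "N_module x 0" and ?N1 = "N_module x 1"
  let ?T = "trivial_module :: (('k fls list \<Rightarrow>\<^sub>0 'k) set, 'k) module"
  obtain f g where f: "f \<in> left_module_hom U_W ?N0 ?N1"
    and g: "g \<in> left_module_hom U_W ?N1 ?T"
    and inj: "inj_on f (carrier ?N0)"
    and exact: "f ` carrier ?N0 = a_kernel ?N1 ?T g"
    and surj: "g ` carrier ?N1 = carrier ?T"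
    and T: "left_module U_W ?T"
    using N_exact_sequence[OF x] unfolding exists_short_exact_sequence_def by blast
  have "submodule (f ` carrier ?N0) U_W ?N1"
    by (rule left_module_hom_image[OF N_left_module N_left_module f])
  then consider "f ` carrier ?N0 = {\<zero>\<^bsub>?N1\<^esub>}" | "f ` carrier ?N0 = carrier ?N1"
    using simple unfolding simple_left_module_def by blast
  then show False
  proof cases
    case 1
    have c: "principal_part x (pole x 0) \<in> carrier ?N0" "principal_part x 0 \<in> carrier ?N0"
      by (simp_all add: N_carrier localised_pole localised_laurent laurent_0)
    have "f (principal_part x (pole x 0)) = f (principal_part x 0)"
      using imageI[OF c(1), of f] imageI[OF c(2), of f] unfolding 1 by simp
    then show False
      using inj_onD[OF inj _ c] simple_pole_nonzero[OF x] by blast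
  next
    case 2
    then have "g ` carrier ?N1 \<subseteq> {\<zero>\<^bsub>?T\<^esub>}" unfolding exact by (auto simp: a_kernel_def')
    then have "(UNIV :: 'k set) \<subseteq> {0}"
      unfolding surj by (simp add: trivial_module_def character_module_simps)
    then show False using one_neq_zero[where 'a = 'k] by blast
  qed
qed

text \<open>
  The point \<open>1\<close> serves for all \<open>\<gamma>\<close>, as \<open>ker \<pi>\<^sub>\<gamma>\<close> does not depend on a point.
\<close>

lemma weyl_pi_kernel_primitive:
  fixes \<gamma> :: "'k::field_char_0"
  shows "left_primitive_ideal U_W (a_kernel U_W weyl_algebra (weyl_pi \<gamma>))"
proof -
  have *: "left_primitive_ideal U_W (a_kernel U_W weyl_algebra (weyl_pi \<delta>))" if "\<delta> \<noteq> 1" for \<delta> :: 'k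
    using left_primitive_ideal_annihilator[OF N_simple[OF one_neq_zero that]]
    by (simp add: N_annihilator)
  show ?thesis
  proof (cases "\<gamma> = 1")
    case True
    then show ?thesis using *[of 0] by (simp add: weyl_pi_0_1_kernel)
  qed (rule *)
qed

theorem proposition7p1p5:
  fixes x \<gamma> :: "'k::{alg_closed_field, field_char_0}"
  assumes "uncountable (UNIV :: 'k set)"
    and "x \<noteq> 0"
  shows "left_modules_isomorphic U_W (N_module x \<gamma>) (M_module x (\<gamma> - 1)) \<and>
         (simple_left_module U_W (N_module x \<gamma>) \<longleftrightarrow> \<gamma> \<noteq> 1) \<and>
         exists_short_exact_sequence U_W (N_module x 0) (N_module x 1) trivial_module \<and>
         module_annihilator U_W (N_module x \<gamma>) = a_kernel U_W weyl_algebra (weyl_pi \<gamma>) \<and>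
         left_primitive_ideal U_W (a_kernel U_W weyl_algebra (weyl_pi \<gamma>))"
  using N_M_isomorphic[OF assms(2)] N_simple[OF assms(2)] N_1_not_simple[OF assms(2)]
    N_exact_sequence[OF assms(2)] N_annihilator[OF assms(2)] weyl_pi_kernel_primitive
  by blast

end
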